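(* Let $\Omega\subset\mathbb R^2$ be a domain and let $\rho_{(F_1,V_1)}$ and $\rho_{(F_2,V_2)}$ be two conformal capacitary metrics on $\Omega$. Then the metric spaces $(H_\rho,\rho_{(F_1,V_1)})$ and $(H_\rho,\rho_{(F_2,V_2)})$ are quasi-isometric. That is, there exists a constant $0<K<\infty$ such that $$\frac1K\rho_{(F_2,V_2)}(x,y)\le\rho_{(F_1,V_1)}(x,y)\le K\rho_{(F_2,V_2)}(x,y)\quad\text{for all }x,y\in H_\rho.$$
   Context: For disjoint sets $F_0,F_1\subset\Omega$, the conformal capacity is $\mathrm{cap}(F_0,F_1;\Omega)=\inf\int_\Omega|\nabla v|^2dx$, where the infimum is over nonnegative $v\in C(\Omega)$ with square integrable weak gradient, $v=0$ in a neighborhood of $F_0$, and $v\ge1$ in a neighborhood of $F_1$. A conformal capacitary metric is determined by a pair $(F,V)$, where $F\subset\Omega$ is a continuum and $V$ is a domain with $F\subset V\subset\overline V\subset\Omega$, $\overline V$ compact, and $\partial V$ the image of the unit circle under a quasiconformal homeomorphism of $\mathbb R^2$. For $x,y\in\Omega$, $$\rho_{(F,V)}(x,y)=\inf_{l(x,y)}\big\{\mathrm{cap}^{1/2}(F,l(x,y)\setminus V;\Omega)+\mathrm{cap}^{1/2}(\partial\Omega,l(x,y)\cap V;\Omega)\big\},$$ where the infimum is over rectifiable curves $l(x,y)$ in $\Omega$ joining $x$ and $y$. The conformal capacitary boundary is $H_\rho=\widetilde\Omega_\rho\setminus\Omega$, where $\widetilde\Omega_\rho$ is the metric completion of $(\Omega,\rho)$;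 its points are equivalence classes of $\rho$-Cauchy sequences in $\Omega$. The two metrics are comparable on $\Omega$, so they have the same Cauchy sequences, and $H_\rho$ is the same set for both. The metrics are extended to $H_\rho$ by limits. *)

theory Defs
  imports "HOL-Analysis.Analysis"
begin

type_synonym R2 = "real^2"

definition rectifiable_path :: "(real \<Rightarrow> R2) \<Rightarrow> bool" where
  "rectifiable_path g \<longleftrightarrow> path g \<and>
     bdd_above {(\<Sum>i<n. dist (g (t (Suc i))) (g (t i))) | n t.
                 t 0 = 0 \<and> t n = 1 \<and> (\<forall>i<n. t i \<le> t (Suc i))}"

definition curves_joining :: "R2 set \<Rightarrow> R2 \<Rightarrow> R2 \<Rightarrow> (real \<Rightarrow> R2) set" where
  "curves_joining \<Omega> x y = {g. rectifiable_path g \<and> path_image g \<subseteq> \<Omega> \<and>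
                                pathstart g = x \<and> pathfinish g = y}"

definition test_function :: "R2 set \<Rightarrow> (R2 \<Rightarrow> real) \<Rightarrow> (R2 \<Rightarrow> R2 \<Rightarrow> real) \<Rightarrow> bool" where
  "test_function \<Omega> \<phi> \<phi>' \<longleftrightarrow> (\<forall>x. (\<phi> has_derivative \<phi>' x) (at x)) \<and>
     (\<forall>i\<in>Basis. continuous_on UNIV (\<lambda>x. \<phi>' x i)) \<and>
     (\<exists>K. compact K \<and> K \<subseteq> \<Omega> \<and> (\<forall>x. x \<notin> K \<longrightarrow> \<phi> x = 0))"

definition weak_gradient :: "R2 set \<Rightarrow> (R2 \<Rightarrow> real) \<Rightarrow> (R2 \<Rightarrow> R2) \<Rightarrow> bool" where
  "weak_gradient \<Omega> v g \<longleftrightarrow>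
     (\<forall>K. compact K \<and> K \<subseteq> \<Omega> \<longrightarrow> g absolutely_integrable_on K) \<and>
     (\<forall>\<phi> \<phi>'. test_function \<Omega> \<phi> \<phi>' \<longrightarrow> (\<forall>i\<in>Basis.
        integral \<Omega> (\<lambda>x. v x * \<phi>' x i)
          = - integral \<Omega> (\<lambda>x. (g x \<bullet> i) * \<phi> x)))"

definition admissible_cap :: "R2 set \<Rightarrow> R2 set \<Rightarrow> R2 set \<Rightarrow> (R2 \<Rightarrow> real) \<Rightarrow> (R2 \<Rightarrow> R2) \<Rightarrow> bool" where
  "admissible_cap F0 F1 \<Omega> v g \<longleftrightarrow>
     continuous_on \<Omega> v \<and> (\<forall>x\<in>\<Omega>. 0 \<le> v x) \<and> weak_gradient \<Omega> v g \<and>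
     (\<lambda>x. norm (g x) ^ 2) integrable_on \<Omega> \<and>
     (\<exists>U. open U \<and> F0 \<subseteq> U \<and> (\<forall>x\<in>U \<inter> \<Omega>. v x = 0)) \<and>
     (\<exists>U. open U \<and> F1 \<subseteq> U \<and> (\<forall>x\<in>U \<inter> \<Omega>. 1 \<le> v x))"

definition cap :: "R2 set \<Rightarrow> R2 set \<Rightarrow> R2 set \<Rightarrow> real" where
  "cap F0 F1 \<Omega> = Inf {integral \<Omega> (\<lambda>x. norm (g x) ^ 2) | v g. admissible_cap F0 F1 \<Omega> v g}"

definition quasiconformal :: "(R2 \<Rightarrow> R2) \<Rightarrow> bool" where
  "quasiconformal f \<longleftrightarrow> (\<exists>h. homeomorphism UNIV UNIV f h) \<and>
     (\<exists>H::real. \<forall>x. Limsup (at_right 0)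
        (\<lambda>r. ereal (Sup {dist (f y) (f x) | y. dist y x = r} /
                     Inf {dist (f y) (f x) | y. dist y x = r})) \<le> ereal H)"

definition continuum :: "R2 set \<Rightarrow> bool" where
  "continuum F \<longleftrightarrow> compact F \<and> connected F \<and> (\<exists>a b. a \<in> F \<and> b \<in> F \<and> a \<noteq> b)"

definition cap_pair :: "R2 set \<Rightarrow> R2 set \<Rightarrow> R2 set \<Rightarrow> bool" where
  "cap_pair \<Omega> F V \<longleftrightarrow> continuum F \<and> F \<subseteq> \<Omega> \<and> open V \<and> connected V \<and>
     F \<subseteq> V \<and> closure V \<subseteq> \<Omega> \<and> compact (closure V) \<and>
     (\<exists>f. quasiconformal f \<and> frontier V = f ` sphere 0 1)"

definition cap_metric :: "R2 set \<Rightarrow> R2 set \<Rightarrow> R2 set \<Rightarrow> R2 \<Rightarrow> R2 \<Rightarrow> real" where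
  "cap_metric \<Omega> F V x y = Inf {sqrt (cap F (path_image l - V) \<Omega>)
                                  + sqrt (cap (frontier \<Omega>) (path_image l \<inter> V) \<Omega>)
                                | l. l \<in> curves_joining \<Omega> x y}"

text \<open>Sequences in Omega that are Cauchy for d and do not converge (for d) to a point
  of Omega: representatives of points of the capacitary boundary H.\<close>
definition boundary_seq :: "R2 set \<Rightarrow> (R2 \<Rightarrow> R2 \<Rightarrow> real) \<Rightarrow> (nat \<Rightarrow> R2) \<Rightarrow> bool" where
  "boundary_seq \<Omega> d s \<longleftrightarrow> (\<forall>n. s n \<in> \<Omega>) \<and>
     (\<forall>e>0. \<exists>N. \<forall>m\<ge>N. \<forall>n\<ge>N. d (s m) (s n) < e) \<and>
     \<not> (\<exists>p\<in>\<Omega>. (\<lambda>n. d (s n) p) \<longlonglongrightarrow> 0)"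

end

theory Submission
  imports Defs
begin

text \<open>The costs of a curve for the two pairs are compared. If a curve avoids both V's, a test
  function v for (F2, l) is multiplied by a cutoff vanishing near F1; the extra term in the energy
  is controlled by a Poincare inequality for functions vanishing on the continuum F2. If a curve
  starts off a suitable compact set and meets one of the V's, then it crosses a square of fixed size outside
  both V's, and the Poincare inequality together with v at least 1 on the curve bounds the second
  cost from below, while the first cost is always bounded. Both estimates rest on the fact that a continuum
  meets all concentric square boundaries in a range of radii, and that the oscillation of v on almost all lines
  is controlled by the energy. A boundary sequence leaves every compact set since small balls have
  small capacity, so comparability off a compact set is enough.\<close>

section \<open>Continuously differentiable functions and cutoffs\<close>

text \<open>A competitor v for a capacity is continuous but has only a weak gradient, so it cannot
  simply be differentiated along a line. Its oscillation on a line is read off from the weak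
  equation: two mollified averages of v centred on a common coordinate line differ by the pairing of
  the weak gradient with one explicit test function living in a thin strip around that line. Energy
  of the strip divided by its width, integrated over all parallel lines, is bounded by the total
  energy uniformly in the width, and uniform continuity of v absorbs the mollification error.
  Squares replace discs because their boundaries lie on coordinate lines: a point with known value
  of v on each square boundary in a range of radii then gives, on average over the radii, a line of
  controlled oscillation. All numerical constants are crude; what matters is that they do not depend
  on v, its gradient or the curve.\<close>

definition c1 :: "(R2 \<Rightarrow> real) \<Rightarrow> (R2 \<Rightarrow> R2) \<Rightarrow> bool" where
  "c1 f G \<longleftrightarrow> continuous_on UNIV G \<and> (\<forall>x. (f has_derivative (\<lambda>h. G x \<bullet> h)) (at x))"

lemma c1_continuous: "c1 f G \<Longrightarrow> continuous_on S f"
  unfolding c1_def by (meson continuous_at_imp_continuous_on has_derivative_continuous)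

lemma c1_continuous_grad: "c1 f G \<Longrightarrow> continuous_on S G"
  unfolding c1_def using continuous_on_subset by blast

lemma c1_const: "c1 (\<lambda>x. c) (\<lambda>x. 0)"
  by (simp add: c1_def)

lemma c1_inner: "c1 (\<lambda>x. x \<bullet> k) (\<lambda>x. k)"
  unfolding c1_def by (auto intro!: derivative_eq_intros simp: inner_commute)

lemma c1_add:
  assumes "c1 f F" "c1 g G" shows "c1 (\<lambda>x. f x + g x) (\<lambda>x. F x + G x)"
  using assms unfolding c1_def
  by (auto intro!: continuous_intros derivative_eq_intros simp: inner_add_left)

lemma c1_diff:
  assumes "c1 f F" "c1 g G" shows "c1 (\<lambda>x. f x - g x) (\<lambda>x. F x - G x)"
  using assms unfolding c1_def
  by (auto intro!: continuous_intros derivative_eq_intros simp: inner_diff_left)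

lemma c1_mult:
  assumes "c1 f F" "c1 g G" shows "c1 (\<lambda>x. f x * g x) (\<lambda>x. f x *\<^sub>R G x + g x *\<^sub>R F x)"
proof -
  have "continuous_on UNIV f" "continuous_on UNIV g" using assms by (auto intro: c1_continuous)
  moreover have "((\<lambda>x. f x * g x) has_derivative (\<lambda>h. (f x *\<^sub>R G x + g x *\<^sub>R F x) \<bullet> h)) (at x)" for x
    using assms unfolding c1_def
    by (auto intro!: derivative_eq_intros simp: inner_add_left algebra_simps)
  ultimately show ?thesis
    using assms unfolding c1_def by (auto intro!: continuous_intros)
qed

lemma c1_compose:
  assumes f: "c1 f F" and h: "\<And>t. (h has_real_derivative h' t) (at t)" and h': "continuous_on UNIV h'"
  shows "c1 (\<lambda>x. h (f x)) (\<lambda>x. h' (f x) *\<^sub>R F x)"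
proof -
  have "continuous_on UNIV (\<lambda>x. h' (f x))"
    using continuous_on_compose2[OF h' c1_continuous[OF f]] by auto
  moreover have "((\<lambda>x. h (f x)) has_derivative (\<lambda>y. (h' (f x) *\<^sub>R F x) \<bullet> y)) (at x)" for x
  proof -
    have "(f has_derivative (\<lambda>h. F x \<bullet> h)) (at x)" using f by (auto simp: c1_def)
    from has_derivative_compose[OF this h[unfolded has_field_derivative_def, of "f x"]]
    show ?thesis by (simp add: inner_scaleR_left)
  qed
  ultimately show ?thesis using f by (auto simp: c1_def intro!: continuous_intros)
qed

lemma c1_cmult: "c1 f F \<Longrightarrow> c1 (\<lambda>x. c * f x) (\<lambda>x. c *\<^sub>R F x)"
  using c1_mult[OF c1_const] by simp

lemma c1_sum:
  assumes "finite I" "\<And>i. i \<in> I \<Longrightarrow> c1 (f i) (F i)"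
  shows "c1 (\<lambda>x. \<Sum>i\<in>I. f i x) (\<lambda>x. \<Sum>i\<in>I. F i x)"
  using assms by (induction I rule: finite_induct) (auto simp: c1_const intro: c1_add)

lemma c1_grad_zero:
  assumes "c1 f G" "open U" "x \<in> U" "\<And>y. y \<in> U \<Longrightarrow> f y = c"
  shows "G x = 0"
proof -
  have "((\<lambda>y. c) has_derivative (\<lambda>h. G x \<bullet> h)) (at x)"
    using has_derivative_transform_within_open[of f _ x UNIV U "\<lambda>y. c"] assms by (auto simp: c1_def)
  then have "(\<lambda>h. G x \<bullet> h) = (\<lambda>h. 0)"
    using has_derivative_unique has_derivative_const by blast
  then show ?thesis by (metis inner_eq_zero_iff)
qed

text \<open>A linear functional is determined by its values on \<open>Basis\<close>, so the gradient
  is reassembled from the partial derivatives, and it inherits their continuity.\<close>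

lemma test_function_imp_c1:
  assumes "test_function \<Omega> \<phi> \<phi>'"
  obtains G where "c1 \<phi> G" "\<And>x i. i \<in> Basis \<Longrightarrow> \<phi>' x i = G x \<bullet> i"
proof
  let ?G = "\<lambda>x. \<Sum>i\<in>Basis. \<phi>' x i *\<^sub>R i"
  have G: "\<phi>' x h = ?G x \<bullet> h" for x h
  proof -
    have "linear (\<phi>' x)" using assms unfolding test_function_def
      by (meson has_derivative_linear)
    then interpret linear "\<phi>' x" .
    have "\<phi>' x h = \<phi>' x (\<Sum>i\<in>Basis. (h \<bullet> i) *\<^sub>R i)" by (simp add: euclidean_representation)
    also have "\<dots> = (\<Sum>i\<in>Basis. (h \<bullet> i) * \<phi>' x i)" by (simp add: sum scale)
    finally show ?thesis by (simp add: inner_sum_left inner_commute[of h] mult.commute)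
  qed
  show "c1 \<phi> ?G" unfolding c1_def
  proof (intro conjI allI)
    show "continuous_on UNIV ?G" using assms unfolding test_function_def
      by (intro continuous_on_sum continuous_on_scaleR continuous_on_const) blast
    show "(\<phi> has_derivative (\<lambda>h. ?G x \<bullet> h)) (at x)" for x
    proof -
      have "(\<lambda>h. ?G x \<bullet> h) = \<phi>' x" by (rule ext) (rule G[symmetric])
      then show ?thesis using assms unfolding test_function_def by simp
    qed
  qed
  show "\<phi>' x i = ?G x \<bullet> i" for x i by (rule G)
qed

lemma c1_imp_test_function:
  assumes "c1 \<phi> G" "compact K" "K \<subseteq> \<Omega>" "\<And>x. x \<notin> K \<Longrightarrow> \<phi> x = 0"
  shows "test_function \<Omega> \<phi> (\<lambda>x h. G x \<bullet> h)"
  using assms unfolding test_function_def c1_def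
  by (auto intro!: continuous_intros)

lemma c1_grad_support:
  assumes "c1 f G" "closed K" "\<And>x. x \<notin> K \<Longrightarrow> f x = 0" "x \<notin> K"
  shows "G x = 0"
  using c1_grad_zero[of f G "-K" x 0] assms by auto

section \<open>One-variable profiles: a C^1 bump, its primitive, a step function, and the resulting
  cutoffs\<close>

text \<open>The square of a positive part is continuously differentiable, so this polynomial bump on
  \<open>[-1,1]\<close> suffices for C^1 cutoffs and mollifiers, with elementary bounds.\<close>

definition beta :: "real \<Rightarrow> real" where "beta s = (max 0 (1 - s^2))^2"

lemma max0_sq_deriv: "((\<lambda>t::real. (max 0 t)^2) has_real_derivative 2 * max 0 t) (at t)"
proof -
  consider "t > 0" | "t < 0" | "t = 0" by linarith
  then show ?thesis
  proof cases
    case 1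
    have "((\<lambda>t::real. t^2) has_real_derivative 2 * max 0 t) (at t)"
      using 1 by (auto intro!: derivative_eq_intros)
    then show ?thesis
      by (rule has_field_derivative_transform_within[where d=t]) (use 1 in \<open>auto simp: dist_real_def\<close>)
  next
    case 2
    have "((\<lambda>t::real. 0) has_real_derivative 2 * max 0 t) (at t)"
      using 2 by (auto intro!: derivative_eq_intros)
    then show ?thesis
      by (rule has_field_derivative_transform_within[where d="-t"]) (use 2 in \<open>auto simp: dist_real_def\<close>)
  next
    case 3
    have "((\<lambda>h::real. (max 0 h)^2 / h) \<longlongrightarrow> 0) (at 0)"
    proof (rule Lim_null_comparison)
      show "\<forall>\<^sub>F h in at 0. norm ((max 0 h)^2 / h) \<le> \<bar>h\<bar>"
        by (auto simp: eventually_at_filter max_def power2_eq_square)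
    qed (auto intro!: tendsto_eq_intros)
    then show ?thesis using 3 by (simp add: DERIV_def)
  qed
qed

lemma beta_deriv: "(beta has_real_derivative (-4 * s * max 0 (1 - s^2))) (at s)"
proof -
  have "((\<lambda>s::real. 1 - s^2) has_real_derivative (- 2 * s)) (at s)"
    by (auto intro!: derivative_eq_intros)
  from DERIV_chain2[OF max0_sq_deriv this]
  show ?thesis unfolding beta_def by (simp add: algebra_simps)
qed

lemma beta_nonneg: "beta s \<ge> 0" by (simp add: beta_def)
lemma beta_le1: "beta s \<le> 1"
  by (simp add: beta_def power_le_one)
lemma beta_zero: "\<bar>s\<bar> \<ge> 1 \<Longrightarrow> beta s = 0"
proof -
  assume "\<bar>s\<bar> \<ge> 1"
  then have "s^2 \<ge> 1" using abs_le_square_iff[of 1 s] by simp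
  then show ?thesis by (simp add: beta_def)
qed
lemma beta_pos: "\<bar>s\<bar> < 1 \<Longrightarrow> beta s > 0"
  using abs_square_less_1[of s] by (simp add: beta_def)
lemma beta_ge_half: "\<bar>s\<bar> \<le> 1/2 \<Longrightarrow> beta s \<ge> 1/2"
proof -
  assume "\<bar>s\<bar> \<le> 1/2"
  then have "s^2 \<le> (1/2)^2" using abs_le_square_iff[of s "1/2"] by simp
  then have "max 0 (1 - s^2) \<ge> 3/4" by (simp add: power_divide)
  then have "beta s \<ge> (3/4)^2" unfolding beta_def by (rule power_mono) simp
  then show ?thesis by (simp add: power_divide)
qed
lemma beta_continuous: "continuous_on S beta"
  unfolding beta_def by (intro continuous_intros)

text \<open>Serves twice: normalised by its final value it yields a step function, and in one
  coordinate it is the antiderivative that turns a difference of two mollifiers into a partial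
  derivative of a compactly supported function.\<close>

definition bump_primitive :: "real \<Rightarrow> real" where "bump_primitive s = integral {-1..s} beta"

lemma bump_primitive_left: "s \<le> -1 \<Longrightarrow> bump_primitive s = 0"
  unfolding bump_primitive_def by (cases "s = -1") auto

lemma bump_primitive_deriv: "(bump_primitive has_real_derivative beta s) (at s)"
proof (cases "s > -1")
  case True
  have "((\<lambda>u. integral {-1..u} beta) has_real_derivative beta s) (at s within {-1..s+1})"
    by (rule integral_has_real_derivative) (use True in \<open>auto intro: beta_continuous\<close>)
  moreover have "s \<in> interior {-1..s+1}" using True by simp
  ultimately show ?thesis unfolding bump_primitive_def[abs_def]
    by (metis at_within_interior)
next
  case False
  have A: "(bump_primitive has_real_derivative 0) (at s within {..-1})" if "s \<le> -1"
    by (rule has_field_derivative_transform_within[where f="\<lambda>_. 0" and d=1]) (use that bump_primitive_left in auto)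
  show ?thesis
  proof (cases "s = -1")
    case True
    \<comment> \<open>At -1 the integral formula gives the derivative from the right only; it is
      glued to the constant branch on the left, both derivatives being 0.\<close>
    have "((\<lambda>u. integral {-1..u} beta) has_real_derivative beta s) (at s within {-1..0})"
      by (rule integral_has_real_derivative) (use True in \<open>auto intro: beta_continuous\<close>)
    then have 1: "(bump_primitive has_real_derivative 0) (at s within {-1..0})"
      unfolding bump_primitive_def[abs_def] using beta_zero[of s] True by simp
    have "(bump_primitive has_real_derivative 0) (at s within {..-1} \<union> {-1..0})"
      using 1 A True unfolding has_field_derivative_iff
      by (auto simp: at_within_union intro!: filterlim_sup)
    moreover have "s \<in> interior ({..-1} \<union> {-1..0})"
    proof -
      have "{..<0} \<subseteq> ({..-1} \<union> {-1..0::real})" by auto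
      then have "{..<0} \<subseteq> interior ({..-1} \<union> {-1..0::real})" by (intro interior_maximal) auto
      then show ?thesis using True by auto
    qed
    ultimately have "(bump_primitive has_real_derivative 0) (at s)" by (metis at_within_interior)
    then show ?thesis using beta_zero[of s] True by simp
  next
    case F2: False
    then have "s \<in> interior {..-1}" using False by simp
    moreover have "(bump_primitive has_real_derivative 0) (at s within {..-1})" using A False by simp
    ultimately have "(bump_primitive has_real_derivative 0) (at s)" by (metis at_within_interior)
    then show ?thesis using beta_zero[of s] False by simp
  qed
qed

lemma bump_primitive_mono: "s \<le> t \<Longrightarrow> bump_primitive s \<le> bump_primitive t"
  by (rule DERIV_nonneg_imp_nondecreasing) (use bump_primitive_deriv beta_nonneg in blast)+

lemma bump_primitive_nonneg: "bump_primitive s \<ge> 0"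
proof -
  have "bump_primitive (min s (-1)) \<le> bump_primitive s" by (intro bump_primitive_mono) auto
  then show ?thesis by (simp add: bump_primitive_left)
qed

lemma bump_primitive_right: "s \<ge> 1 \<Longrightarrow> bump_primitive s = bump_primitive 1"
proof -
  assume s: "s \<ge> 1"
  have "(bump_primitive has_derivative (\<lambda>h. 0)) (at x within {1..})" if "x \<ge> 1" for x
    using bump_primitive_deriv[of x] beta_zero[of x] that unfolding has_field_derivative_def
    by (auto intro!: has_derivative_at_withinI simp: mult_zero_left[abs_def])
  then show ?thesis using has_derivative_zero_unique[of "{1..}" bump_primitive 1 s] s by force
qed

lemma bump_primitive_le2: "bump_primitive s \<le> 2"
proof -
  have "bump_primitive s \<le> bump_primitive (max 1 s)" by (intro bump_primitive_mono) auto
  also have "\<dots> = bump_primitive 1" by (intro bump_primitive_right) auto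
  also have "\<dots> \<le> integral {-1..1::real} (\<lambda>_. 1)" unfolding bump_primitive_def
    by (rule Henstock_Kurzweil_Integration.integral_le) (auto simp: beta_le1 intro!: integrable_continuous_real beta_continuous)
  finally show ?thesis by simp
qed

lemma bump_primitive1_pos: "bump_primitive 1 > 0"
proof -
  have "bump_primitive (-1) < bump_primitive 1"
    by (rule DERIV_pos_imp_increasing_open)
      (use bump_primitive_deriv beta_pos in \<open>auto intro!: DERIV_isCont continuous_at_imp_continuous_on exI[of _ "beta _"]\<close>)
  then show ?thesis by (simp add: bump_primitive_left)
qed

definition smoothstep :: "real \<Rightarrow> real" where "smoothstep t = bump_primitive (2*t - 1) / bump_primitive 1"

lemma smoothstep_deriv: "(smoothstep has_real_derivative (2 * beta (2*t - 1) / bump_primitive 1)) (at t)"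
proof -
  have "((\<lambda>t. bump_primitive (2*t-1)) has_real_derivative (beta (2*t - 1) * 2)) (at t)"
    by (rule DERIV_chain2[OF bump_primitive_deriv]) (auto intro!: derivative_eq_intros)
  from DERIV_cdivide[OF this, of "bump_primitive 1"] show ?thesis unfolding smoothstep_def by (simp add: mult.commute)
qed

lemma smoothstep_0: "t \<le> 0 \<Longrightarrow> smoothstep t = 0" by (simp add: smoothstep_def bump_primitive_left)
lemma smoothstep_1: "t \<ge> 1 \<Longrightarrow> smoothstep t = 1" using bump_primitive_right[of "2*t-1"] bump_primitive1_pos by (simp add: smoothstep_def)
lemma smoothstep_nonneg: "0 \<le> smoothstep t" by (simp add: smoothstep_def bump_primitive_nonneg)
lemma smoothstep_le1: "smoothstep t \<le> 1"
proof -
  have "bump_primitive (2*t-1) \<le> bump_primitive (max 1 (2*t-1))" by (intro bump_primitive_mono) auto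
  also have "\<dots> = bump_primitive 1" by (intro bump_primitive_right) auto
  finally show ?thesis using bump_primitive1_pos by (simp add: smoothstep_def)
qed

lemma c1_smoothstep: "c1 f F \<Longrightarrow> c1 (\<lambda>x. smoothstep (f x)) (\<lambda>x. (2 * beta (2 * f x - 1) / bump_primitive 1) *\<^sub>R F x)"
  by (rule c1_compose[of f F smoothstep]) (use bump_primitive1_pos in \<open>auto intro!: smoothstep_deriv continuous_intros continuous_on_compose2[OF beta_continuous[of UNIV]]\<close>)

lemma c1_dist_sq: "c1 (\<lambda>x. (x - p) \<bullet> (x - p)) (\<lambda>x. 2 *\<^sub>R (x - p))"
  unfolding c1_def by (auto intro!: continuous_intros derivative_eq_intros simp: inner_commute algebra_simps)

text \<open>No partition of unity is used: finitely many radial bumps are added, the sum is at least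
  1 near C, and composition with \<open>smoothstep\<close> truncates it to \<open>[0,1]\<close>
  while keeping it C^1.\<close>

lemma cutoff_exists:
  assumes "compact C" "open W" "C \<subseteq> W"
  obtains \<eta> G T U where "c1 \<eta> G" "\<And>x. 0 \<le> \<eta> x" "\<And>x. \<eta> x \<le> 1" "open U" "C \<subseteq> U"
    "\<And>x. x \<in> U \<Longrightarrow> \<eta> x = 1" "compact T" "T \<subseteq> W" "\<And>x. x \<notin> T \<Longrightarrow> \<eta> x = 0"
proof -
  have "\<forall>p\<in>C. \<exists>r>0. cball p r \<subseteq> W" using assms open_contains_cball by blast
  then obtain r where r: "\<And>p. p \<in> C \<Longrightarrow> r p > 0" "\<And>p. p \<in> C \<Longrightarrow> cball p (r p) \<subseteq> W" by metis
  have "C \<subseteq> (\<Union>p\<in>C. ball p (r p / 2))" using r by force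
  then obtain D where D: "D \<subseteq> C" "finite D" "C \<subseteq> (\<Union>p\<in>D. ball p (r p / 2))"
    using compactE_image[OF assms(1), of C "\<lambda>p. ball p (r p / 2)"] by blast
  \<comment> \<open>The argument of \<open>smoothstep\<close> is at least 1 when |x - p|^2 is at
    most half of (r p)^2, in particular on the ball of radius \<open>r p / 2\<close>, and at most 0
    once |x - p| reaches \<open>r p\<close>.\<close>
  define f where "f p x = smoothstep (2 - 2 * ((x - p) \<bullet> (x - p)) / (r p)^2)" for p x :: R2
  have "\<exists>F. c1 (f p) F" for p
  proof -
    have "c1 (\<lambda>x. 2 - (2 / (r p)^2) * ((x - p) \<bullet> (x - p))) (\<lambda>x. 0 - (2 / (r p)^2) *\<^sub>R (2 *\<^sub>R (x - p)))"
      by (intro c1_diff c1_const c1_cmult c1_dist_sq)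
    from c1_smoothstep[OF this] show ?thesis unfolding f_def by auto
  qed
  then obtain F where F: "\<And>p. c1 (f p) (F p)" by metis
  have f1: "f p x = 1" if "p \<in> C" "x \<in> ball p (r p / 2)" for p x
  proof -
    have "norm (x - p) \<le> r p / 2" using that by (simp add: dist_norm norm_minus_commute)
    then have "(norm (x - p))^2 \<le> (r p / 2)^2" by (intro power_mono) auto
    then have "4 * ((x - p) \<bullet> (x - p)) \<le> (r p)^2"
      by (simp add: power2_norm_eq_inner power_divide)
    then have "2 * ((x - p) \<bullet> (x - p)) \<le> (r p)^2"
      using inner_ge_zero[of "x - p"] by linarith
    then have "2 * ((x - p) \<bullet> (x - p)) / (r p)^2 \<le> 1"
      using r(1)[OF that(1)] by (simp add: divide_le_eq)
    then show ?thesis unfolding f_def by (intro smoothstep_1) auto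
  qed
  have f0: "f p x = 0" if "p \<in> C" "x \<notin> cball p (r p)" for p x
  proof -
    have "norm (x - p) \<ge> r p" using that by (simp add: dist_norm norm_minus_commute)
    then have "(norm (x - p))^2 \<ge> (r p)^2" using r(1)[OF that(1)] by (intro power_mono) auto
    then have "2 * ((x - p) \<bullet> (x - p)) / (r p)^2 \<ge> 2"
      using r(1)[OF that(1)] by (simp add: power2_norm_eq_inner divide_simps)
    then show ?thesis unfolding f_def by (intro smoothstep_0) auto
  qed
  have s: "c1 (\<lambda>x. \<Sum>p\<in>D. f p x) (\<lambda>x. \<Sum>p\<in>D. F p x)"
    by (intro c1_sum D F)
  show ?thesis
  proof (rule that[OF c1_smoothstep[OF s]])
    show "open (\<Union>p\<in>D. ball p (r p / 2))" by auto
    show "compact (\<Union>p\<in>D. cball p (r p))" using D by auto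
    show "(\<Union>p\<in>D. cball p (r p)) \<subseteq> W" using D r by blast
    show "smoothstep (\<Sum>p\<in>D. f p x) = 1" if x: "x \<in> (\<Union>p\<in>D. ball p (r p / 2))" for x
    proof -
      obtain p where p: "p \<in> D" "x \<in> ball p (r p / 2)" using x by blast
      have "1 = f p x" using f1 p D by auto
      also have "\<dots> \<le> (\<Sum>p\<in>D. f p x)" by (rule member_le_sum) (use p D in \<open>auto simp: f_def smoothstep_nonneg\<close>)
      finally show ?thesis by (rule smoothstep_1)
    qed
    show "smoothstep (\<Sum>p\<in>D. f p x) = 0" if "x \<notin> (\<Union>p\<in>D. cball p (r p))" for x
    proof -
      have "(\<Sum>p\<in>D. f p x) = 0" by (intro sum.neutral ballI f0) (use that D in auto)
      then show ?thesis by (simp add: smoothstep_0)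
    qed
  qed (use D in \<open>auto simp: smoothstep_nonneg smoothstep_le1\<close>)
qed

section \<open>Weak gradients\<close>

lemma continuous_support_integrable:
  fixes f :: "R2 \<Rightarrow> 'b::euclidean_space"
  assumes "continuous_on UNIV f" "compact K" "\<And>x. x \<notin> K \<Longrightarrow> f x = 0"
  shows "integrable lborel f"
proof -
  have "integrable lborel (\<lambda>x. indicator K x *\<^sub>R f x)"
    using assms by (intro borel_integrable_compact) (auto intro: continuous_on_subset)
  also have "(\<lambda>x. indicator K x *\<^sub>R f x) = f" using assms(3) by (auto simp: indicator_def)
  finally show ?thesis .
qed

lemma continuous_compact_abs_integrable:
  fixes f :: "'a::euclidean_space \<Rightarrow> 'b::euclidean_space"
  assumes "compact K" "continuous_on K f"
  shows "f absolutely_integrable_on K"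
  using borel_integrable_compact[OF assms] unfolding set_integrable_def
  by (simp add: integrable_completion borel_measurable_integrable)

lemma integral_support:
  fixes f :: "'a::euclidean_space \<Rightarrow> 'b::euclidean_space"
  assumes "K \<subseteq> S" "\<And>x. x \<notin> K \<Longrightarrow> f x = 0"
  shows "integral S f = integral K f"
proof -
  have "(\<lambda>x. if x \<in> S then f x else 0) = (\<lambda>x. if x \<in> K then f x else 0)" using assms by (intro ext) (auto simp: subset_iff)
  then show ?thesis by (metis integral_restrict_UNIV)
qed

lemma integral_translate_lborel:
  fixes f :: "R2 \<Rightarrow> real"
  assumes "integrable lborel f"
  shows "integrable lborel (\<lambda>x. f (c + x))" "integral\<^sup>L lborel (\<lambda>x. f (c + x)) = integral\<^sup>L lborel f"
proof -
  have m: "(+) c \<in> measurable lborel borel" "f \<in> borel_measurable borel"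
    using assms by (auto dest: borel_measurable_integrable)
  show "integrable lborel (\<lambda>x. f (c + x))"
    using integrable_distr_eq[OF m] assms by (simp add: lborel_distr_plus)
  show "integral\<^sup>L lborel (\<lambda>x. f (c + x)) = integral\<^sup>L lborel f"
    using integral_distr[OF m] by (simp add: lborel_distr_plus)
qed

text \<open>The difference quotients of a compactly supported function integrate to 0 by translation
  invariance; they converge boundedly to the partial derivative.\<close>

lemma c1_partial_integral_zero:
  assumes f: "c1 f G" and K: "compact K" "\<And>x. x \<notin> K \<Longrightarrow> f x = 0" and i: "i \<in> Basis"
  shows "integral UNIV (\<lambda>x. G x \<bullet> i) = 0"
proof -
  define D where "D n x = (f ((1 / real (Suc n)) *\<^sub>R i + x) - f x) * real (Suc n)" for n x
  have fi: "integrable lborel f"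
    using continuous_support_integrable[OF c1_continuous[OF f] K] .
  have Di: "integrable lborel (D n)" and D0: "integral\<^sup>L lborel (D n) = 0" for n
    unfolding D_def using integral_translate_lborel[OF fi, of "(1 / real (Suc n)) *\<^sub>R i"] fi by auto
  have "bounded (G ` K)"
    using c1_continuous_grad[OF f] K(1) compact_continuous_image compact_imp_bounded by blast
  then obtain B where B: "\<And>x. x \<in> K \<Longrightarrow> norm (G x) \<le> B" "B > 0" by (auto simp: bounded_pos)
  have GB: "norm (G x) \<le> B" for x
    using B c1_grad_support[OF f compact_imp_closed[OF K(1)] K(2)] by (cases "x \<in> K") auto
  have lip: "\<bar>f (x + h) - f x\<bar> \<le> B * norm h" for x h
  proof -
    have "norm (f (x + h) - f x) \<le> B * norm ((x + h) - x)"
    proof (rule differentiable_bound)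
      show "convex (UNIV :: R2 set)" by simp
      show "(f has_derivative (\<lambda>h. G x \<bullet> h)) (at x within UNIV)" for x
        using f by (simp add: c1_def)
      show "onorm (\<lambda>h. G x \<bullet> h) \<le> B" for x
        proof (rule onorm_le)
        fix h
        have "norm (G x \<bullet> h) \<le> norm (G x) * norm h" by (simp add: Cauchy_Schwarz_ineq2)
        also have "\<dots> \<le> B * norm h" by (intro mult_right_mono GB) auto
        finally show "norm (G x \<bullet> h) \<le> B * norm h" .
      qed
    qed auto
    then show ?thesis by simp
  qed
  obtain a b where ab: "K \<subseteq> cbox a b" using K(1) bounded_subset_cbox_symmetric compact_imp_bounded by metis
  \<comment> \<open>Enlarging the box by 1 in each direction leaves room for the translation, whose
    length is at most 1, so off \<open>Q\<close> both values of f in \<open>D n\<close>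
    vanish.\<close>
  define Q where "Q = cbox (a - One) (b + One)"
  have bound: "norm (D n x) \<le> B * indicator Q x" for n x
  proof (cases "x \<in> Q")
    case True
    have "\<bar>f (x + (1 / real (Suc n)) *\<^sub>R i) - f x\<bar> * real (Suc n) \<le> (B * norm ((1 / real (Suc n)) *\<^sub>R i)) * real (Suc n)"
      by (intro mult_right_mono lip) auto
    also have "\<dots> = B" using i by simp
    finally show ?thesis using True by (simp add: D_def abs_mult add.commute)
  next
    case False
    have "x \<notin> K" "(1 / real (Suc n)) *\<^sub>R i + x \<notin> K"
    proof -
      obtain k where k: "k \<in> Basis" "x \<bullet> k < a \<bullet> k - 1 \<or> x \<bullet> k > b \<bullet> k + 1"
        using False by (auto simp: Q_def mem_box inner_diff_left inner_add_left not_le)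
      define w where "w = (1 / real (Suc n)) *\<^sub>R i"
      have "0 \<le> w \<bullet> k" "w \<bullet> k \<le> 1"
        using i k by (auto simp: w_def inner_Basis)
      then have "x \<notin> cbox a b" "w + x \<notin> cbox a b"
        using k by (auto simp: mem_box inner_add_left intro!: bexI[of _ k])
      then show "x \<notin> K" "(1 / real (Suc n)) *\<^sub>R i + x \<notin> K" unfolding w_def using ab by auto
    qed
    then show ?thesis using K(2) False by (simp add: D_def)
  qed
  have conv: "(\<lambda>n. D n x) \<longlonglongrightarrow> G x \<bullet> i" for x
  proof -
    have "((\<lambda>t. f (x + t *\<^sub>R i)) has_real_derivative (G x \<bullet> i)) (at 0)"
    proof -
      have "((\<lambda>t. x + t *\<^sub>R i) has_derivative (\<lambda>t. t *\<^sub>R i)) (at 0)"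
        by (auto intro!: derivative_eq_intros)
      moreover have "(f has_derivative (\<lambda>h. G x \<bullet> h)) (at (x + 0 *\<^sub>R i))" using f by (simp add: c1_def)
      ultimately have "((\<lambda>t. f (x + t *\<^sub>R i)) has_derivative (\<lambda>t. G x \<bullet> (t *\<^sub>R i))) (at 0)"
        by (rule has_derivative_compose)
      moreover have "(\<lambda>t. G x \<bullet> (t *\<^sub>R i)) = (*) (G x \<bullet> i)" by (rule ext) simp
      ultimately show ?thesis unfolding has_field_derivative_def by (simp only:)
    qed
    then have "((\<lambda>t. (f (x + t *\<^sub>R i) - f x) / t) \<longlongrightarrow> G x \<bullet> i) (at 0)"
      by (simp add: DERIV_def)
    moreover have "filterlim (\<lambda>n. 1 / real (Suc n)) (at 0) sequentially"
      unfolding filterlim_at using LIMSEQ_inverse_real_of_nat by (simp add: inverse_eq_divide)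
    ultimately have "(\<lambda>n. (f (x + (1 / real (Suc n)) *\<^sub>R i) - f x) / (1 / real (Suc n))) \<longlonglongrightarrow> G x \<bullet> i"
      by (rule filterlim_compose)
    then show ?thesis by (simp add: D_def add.commute)
  qed
  have "(\<lambda>n. integral\<^sup>L lborel (D n)) \<longlonglongrightarrow> integral\<^sup>L lborel (\<lambda>x. G x \<bullet> i)"
  proof (rule integral_dominated_convergence[where w="\<lambda>x. B * indicator Q x"])
    show "(\<lambda>x. G x \<bullet> i) \<in> borel_measurable lborel"
      using c1_continuous_grad[OF f] by (auto intro!: borel_measurable_continuous_onI continuous_intros)
    show "integrable lborel (\<lambda>x. B * indicator Q x)"
      unfolding Q_def by (intro integrable_mult_right integrable_real_indicator emeasure_lborel_cbox_finite) auto
    show "D n \<in> borel_measurable lborel" for n using Di by auto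
  qed (use conv bound in auto)
  then have "integral\<^sup>L lborel (\<lambda>x. G x \<bullet> i) = 0"
    unfolding D0 by (simp add: LIMSEQ_const_iff)
  moreover have "integrable lborel (\<lambda>x. G x \<bullet> i)"
  proof (rule continuous_support_integrable[OF _ K(1)])
    show "continuous_on UNIV (\<lambda>x. G x \<bullet> i)" using c1_continuous_grad[OF f] by (intro continuous_intros)
    show "G x \<bullet> i = 0" if "x \<notin> K" for x
      using c1_grad_support[OF f compact_imp_closed[OF K(1)] K(2) that] by simp
  qed
  ultimately show ?thesis by (simp add: integral_lborel)
qed

lemma test_functionE:
  assumes "test_function \<Omega> \<phi> \<phi>'"
  obtains G K where "c1 \<phi> G" "\<And>x i. i \<in> Basis \<Longrightarrow> \<phi>' x i = G x \<bullet> i" "compact K" "K \<subseteq> \<Omega>"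
    "\<And>x. x \<notin> K \<Longrightarrow> \<phi> x = 0" "\<And>x. x \<notin> K \<Longrightarrow> G x = 0"
proof -
  obtain K where K: "compact K" "K \<subseteq> \<Omega>" "\<And>x. x \<notin> K \<Longrightarrow> \<phi> x = 0"
    using assms unfolding test_function_def by blast
  obtain G where G: "c1 \<phi> G" "\<And>x i. i \<in> Basis \<Longrightarrow> \<phi>' x i = G x \<bullet> i"
    using test_function_imp_c1[OF assms] by blast
  show ?thesis
    by (rule that[OF G K]) (use c1_grad_support[OF G(1) compact_imp_closed[OF K(1)] K(3)] in auto)
qed

text \<open>Test functions vanish off a compact K, so the identity is only asked for on K; there
  products of continuous and locally integrable factors are integrable.\<close>

lemma weak_gradientI:
  assumes "\<And>K. compact K \<Longrightarrow> K \<subseteq> \<Omega> \<Longrightarrow> g absolutely_integrable_on K"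
    and "\<And>\<phi> G K i. c1 \<phi> G \<Longrightarrow> compact K \<Longrightarrow> K \<subseteq> \<Omega> \<Longrightarrow> (\<And>x. x \<notin> K \<Longrightarrow> \<phi> x = 0) \<Longrightarrow>
      (\<And>x. x \<notin> K \<Longrightarrow> G x = 0) \<Longrightarrow> i \<in> Basis \<Longrightarrow>
      integral K (\<lambda>x. v x * (G x \<bullet> i)) = - integral K (\<lambda>x. (g x \<bullet> i) * \<phi> x)"
  shows "weak_gradient \<Omega> v g"
  unfolding weak_gradient_def
proof (intro conjI allI impI ballI)
  fix \<phi> \<phi>' and i :: R2
  assume t: "test_function \<Omega> \<phi> \<phi>'" and i: "i \<in> Basis"
  obtain G K where GK: "c1 \<phi> G" "\<And>x i. i \<in> Basis \<Longrightarrow> \<phi>' x i = G x \<bullet> i" "compact K" "K \<subseteq> \<Omega>"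
    "\<And>x. x \<notin> K \<Longrightarrow> \<phi> x = 0" "\<And>x. x \<notin> K \<Longrightarrow> G x = 0" using test_functionE[OF t] by blast
  have "integral \<Omega> (\<lambda>x. v x * \<phi>' x i) = integral K (\<lambda>x. v x * (G x \<bullet> i))"
    using GK i by (subst integral_support[of K]) auto
  moreover have "integral \<Omega> (\<lambda>x. (g x \<bullet> i) * \<phi> x) = integral K (\<lambda>x. (g x \<bullet> i) * \<phi> x)"
    using GK i by (subst integral_support[of K]) auto
  ultimately show "integral \<Omega> (\<lambda>x. v x * \<phi>' x i) = - integral \<Omega> (\<lambda>x. (g x \<bullet> i) * \<phi> x)"
    using assms(2)[OF GK(1,3-6) i] by simp
qed (use assms(1) in blast)

lemma weak_gradientD:
  assumes "weak_gradient \<Omega> v g" "c1 \<phi> G" "compact K" "K \<subseteq> \<Omega>" "\<And>x. x \<notin> K \<Longrightarrow> \<phi> x = 0" "i \<in> Basis"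
  shows "integral K (\<lambda>x. v x * (G x \<bullet> i)) = - integral K (\<lambda>x. (g x \<bullet> i) * \<phi> x)"
proof -
  have "test_function \<Omega> \<phi> (\<lambda>x h. G x \<bullet> h)" using c1_imp_test_function assms by blast
  then have "integral \<Omega> (\<lambda>x. v x * (G x \<bullet> i)) = - integral \<Omega> (\<lambda>x. (g x \<bullet> i) * \<phi> x)"
    using assms(1,6) unfolding weak_gradient_def by blast
  moreover have "integral \<Omega> (\<lambda>x. v x * (G x \<bullet> i)) = integral K (\<lambda>x. v x * (G x \<bullet> i))"
    using assms c1_grad_support[OF assms(2) compact_imp_closed[OF assms(3)] assms(5)]
    by (intro integral_support) auto
  moreover have "integral \<Omega> (\<lambda>x. (g x \<bullet> i) * \<phi> x) = integral K (\<lambda>x. (g x \<bullet> i) * \<phi> x)"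
    using assms by (intro integral_support) auto
  ultimately show ?thesis by simp
qed

text \<open>Pairing a constant with a test function gives a multiple of the integral of a compactly
  supported partial derivative, which is 0.\<close>

lemma weak_gradient_const: "weak_gradient \<Omega> (\<lambda>x. c) (\<lambda>x. 0)"
proof (rule weak_gradientI)
  fix \<phi> G K and i :: R2
  assume a: "c1 \<phi> G" "compact K" "\<And>x. x \<notin> K \<Longrightarrow> \<phi> x = 0" "\<And>x. x \<notin> K \<Longrightarrow> G x = 0" "i \<in> Basis"
  have "integral K (\<lambda>x. G x \<bullet> i) = integral UNIV (\<lambda>x. G x \<bullet> i)"
    using integral_support[of K UNIV "\<lambda>x. G x \<bullet> i"] a(4) by simp
  then show "integral K (\<lambda>x. c * (G x \<bullet> i)) = - integral K (\<lambda>x. (0 \<bullet> i) * \<phi> x)"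
    using c1_partial_integral_zero[OF a(1-3,5)] by simp
qed auto

lemma abs_integrable_inner_mult:
  fixes g :: "R2 \<Rightarrow> R2"
  assumes "g absolutely_integrable_on K" "compact K" "continuous_on K \<phi>"
  shows "(\<lambda>x. (g x \<bullet> i) * \<phi> x) absolutely_integrable_on K"
proof -
  have "(\<lambda>x. g x \<bullet> i) absolutely_integrable_on K"
    using absolutely_integrable_linear[OF assms(1) bounded_linear_inner_left[of i]] by (simp add: o_def)
  then have "(\<lambda>x. \<phi> x * (g x \<bullet> i)) absolutely_integrable_on K"
    by (intro absolutely_integrable_bounded_measurable_product[of "(*)"])
      (use assms in \<open>auto intro!: bilinear_times continuous_imp_measurable_on_sets_lebesgue
        compact_imp_bounded compact_continuous_image lmeasurable_compact fmeasurableD\<close>)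
  then show ?thesis by (simp add: mult.commute)
qed

text \<open>The product rule is moved to the test side: \<open>\<eta> * \<phi>\<close> is again a
  test function, and the term of its gradient containing \<open>N\<close> becomes the second part of
  the new weak gradient.\<close>

lemma weak_gradient_mult:
  assumes w: "weak_gradient \<Omega> v g" and v: "continuous_on \<Omega> v" and \<eta>: "c1 \<eta> N"
  shows "weak_gradient \<Omega> (\<lambda>x. \<eta> x * v x) (\<lambda>x. \<eta> x *\<^sub>R g x + v x *\<^sub>R N x)"
proof (rule weak_gradientI)
  have gK: "g absolutely_integrable_on K" if "compact K" "K \<subseteq> \<Omega>" for K
    using w that by (auto simp: weak_gradient_def)
  fix K assume K: "compact K" "K \<subseteq> \<Omega>"
  have "(\<lambda>x. \<eta> x *\<^sub>R g x) absolutely_integrable_on K"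
    by (intro absolutely_integrable_bounded_measurable_product[of "(*\<^sub>R)"])
      (use K gK[OF K] c1_continuous[OF \<eta>] in \<open>auto intro!: continuous_imp_measurable_on_sets_lebesgue
        compact_imp_bounded compact_continuous_image lmeasurable_compact fmeasurableD
        simp: bilinear_conv_bounded_bilinear bounded_bilinear_scaleR\<close>)
  moreover have "(\<lambda>x. v x *\<^sub>R N x) absolutely_integrable_on K"
    by (intro continuous_compact_abs_integrable K continuous_intros c1_continuous_grad[OF \<eta>]
        continuous_on_subset[OF v])
  ultimately show "(\<lambda>x. \<eta> x *\<^sub>R g x + v x *\<^sub>R N x) absolutely_integrable_on K"
    by (rule set_integral_add)
  fix \<phi> G and i :: R2
  assume \<phi>: "c1 \<phi> G" and K0: "\<And>x. x \<notin> K \<Longrightarrow> \<phi> x = 0" and i: "i \<in> Basis"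
  note c[continuous_intros] = c1_continuous[OF \<phi>] c1_continuous[OF \<eta>] c1_continuous_grad[OF \<phi>] c1_continuous_grad[OF \<eta>]
    continuous_on_subset[OF v K(2)]
  have 1: "(\<lambda>x. v x * (\<eta> x * (G x \<bullet> i))) integrable_on K" "(\<lambda>x. v x * (\<phi> x * (N x \<bullet> i))) integrable_on K"
    by (intro absolutely_integrable_on_def[THEN iffD1, THEN conjunct1] continuous_compact_abs_integrable K continuous_intros)+
  have 2: "(\<lambda>x. (g x \<bullet> i) * (\<eta> x * \<phi> x)) integrable_on K"
    by (intro absolutely_integrable_on_def[THEN iffD1, THEN conjunct1] abs_integrable_inner_mult gK K continuous_intros)
  have "integral K (\<lambda>x. v x * ((\<eta> x *\<^sub>R G x + \<phi> x *\<^sub>R N x) \<bullet> i)) = - integral K (\<lambda>x. (g x \<bullet> i) * (\<eta> x * \<phi> x))"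
    by (rule weak_gradientD[OF w c1_mult[OF \<eta> \<phi>] K]) (use K0 i in auto)
  moreover have "integral K (\<lambda>x. v x * ((\<eta> x *\<^sub>R G x + \<phi> x *\<^sub>R N x) \<bullet> i)) =
     integral K (\<lambda>x. v x * (\<eta> x * (G x \<bullet> i))) + integral K (\<lambda>x. v x * (\<phi> x * (N x \<bullet> i)))"
    by (subst integral_add[symmetric]) (use 1 in \<open>auto simp: inner_add_left algebra_simps intro!: integral_cong\<close>)
  moreover have "integral K (\<lambda>x. ((\<eta> x *\<^sub>R g x + v x *\<^sub>R N x) \<bullet> i) * \<phi> x) =
     integral K (\<lambda>x. (g x \<bullet> i) * (\<eta> x * \<phi> x)) + integral K (\<lambda>x. v x * (\<phi> x * (N x \<bullet> i)))"
    by (subst integral_add[symmetric]) (use 1 2 in \<open>auto simp: inner_add_left algebra_simps intro!: integral_cong\<close>)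
  ultimately show "integral K (\<lambda>x. \<eta> x * v x * (G x \<bullet> i)) =
      - integral K (\<lambda>x. ((\<eta> x *\<^sub>R g x + v x *\<^sub>R N x) \<bullet> i) * \<phi> x)"
    by (simp add: algebra_simps)
qed

lemma weak_gradient_c1: "c1 \<eta> N \<Longrightarrow> weak_gradient \<Omega> \<eta> N"
  using weak_gradient_mult[OF weak_gradient_const[of \<Omega> 1], of \<eta> N] by simp

lemma weak_gradient_add:
  assumes w1: "weak_gradient \<Omega> v g" "continuous_on \<Omega> v" and w2: "weak_gradient \<Omega> w h" "continuous_on \<Omega> w"
  shows "weak_gradient \<Omega> (\<lambda>x. v x + w x) (\<lambda>x. g x + h x)"
proof (rule weak_gradientI)
  fix K assume K: "compact K" "K \<subseteq> \<Omega>"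
  have gK: "g absolutely_integrable_on K" "h absolutely_integrable_on K"
    using w1 w2 K by (auto simp: weak_gradient_def)
  then show "(\<lambda>x. g x + h x) absolutely_integrable_on K" by (rule set_integral_add)
  fix \<phi> G and i :: R2
  assume \<phi>: "c1 \<phi> G" and K0: "\<And>x. x \<notin> K \<Longrightarrow> \<phi> x = 0" and i: "i \<in> Basis"
  note c[continuous_intros] = c1_continuous[OF \<phi>] c1_continuous_grad[OF \<phi>]
    continuous_on_subset[OF w1(2) K(2)] continuous_on_subset[OF w2(2) K(2)]
  have 1: "(\<lambda>x. v x * (G x \<bullet> i)) integrable_on K" "(\<lambda>x. w x * (G x \<bullet> i)) integrable_on K"
    by (intro absolutely_integrable_on_def[THEN iffD1, THEN conjunct1] continuous_compact_abs_integrable K continuous_intros)+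
  have 2: "(\<lambda>x. (g x \<bullet> i) * \<phi> x) integrable_on K" "(\<lambda>x. (h x \<bullet> i) * \<phi> x) integrable_on K"
    by (intro absolutely_integrable_on_def[THEN iffD1, THEN conjunct1] abs_integrable_inner_mult gK K continuous_intros)+
  show "integral K (\<lambda>x. (v x + w x) * (G x \<bullet> i)) = - integral K (\<lambda>x. ((g x + h x) \<bullet> i) * \<phi> x)"
    using weak_gradientD[OF w1(1) \<phi> K K0 i] weak_gradientD[OF w2(1) \<phi> K K0 i] 1 2
    by (simp add: inner_add_left distrib_right integral_add)
qed

text \<open>Local integrability gives measurability on compact sets; an exhaustion carries it to
  \<Omega>. With it, a pointwise bound on the norm of g yields integrability of its square.\<close>

lemma weak_gradient_measurable:
  assumes "weak_gradient \<Omega> v g" "open \<Omega>"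
  shows "g \<in> borel_measurable (lebesgue_on \<Omega>)"
proof -
  obtain C where C: "\<And>n. compact (C n)" "\<And>n. C n \<subseteq> \<Omega>" "\<And>n. C n \<subseteq> interior (C (Suc n))" "\<Union>(range C) = \<Omega>"
    using open_Union_compact_subsets[OF assms(2)] by metis
  have mono: "mono C" using C(3) interior_subset by (intro mono_iff_le_Suc[THEN iffD2] allI) blast
  have "(\<lambda>x. indicator (C n) x *\<^sub>R g x) \<in> borel_measurable lebesgue" for n
    using assms(1) C unfolding weak_gradient_def set_integrable_def by (meson borel_measurable_integrable)
  moreover have "(\<lambda>n. indicator (C n) x *\<^sub>R g x) \<longlonglongrightarrow> indicator \<Omega> x *\<^sub>R g x" for x
  proof (cases "x \<in> \<Omega>")
    case True
    then obtain N where "x \<in> C N" using C(4) by blast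
    then have "x \<in> C n" if "n \<ge> N" for n using mono that by (auto simp: mono_def)
    then have "\<forall>\<^sub>F n in sequentially. indicator (C n) x *\<^sub>R g x = indicator \<Omega> x *\<^sub>R g x"
      using True by (auto simp: eventually_sequentially intro!: exI[of _ N])
    then show ?thesis by (rule tendsto_eventually)
  next
    case False
    then have "x \<notin> C n" for n using C(2) by blast
    then show ?thesis using False by simp
  qed
  ultimately have "(\<lambda>x. indicator \<Omega> x *\<^sub>R g x) \<in> borel_measurable lebesgue"
    by (rule borel_measurable_LIMSEQ_metric) 
  then show ?thesis
    using assms(2) by (subst borel_measurable_restrict_space_iff) auto
qed

lemma sq_integrable_bounded_by:
  fixes g :: "R2 \<Rightarrow> R2"
  assumes "g \<in> borel_measurable (lebesgue_on \<Omega>)" "open \<Omega>" "F integrable_on \<Omega>"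
    "\<And>x. x \<in> \<Omega> \<Longrightarrow> norm (g x) ^ 2 \<le> F x"
  shows "(\<lambda>x. norm (g x) ^ 2) integrable_on \<Omega>"
proof (rule measurable_bounded_by_integrable_imp_integrable[OF _ assms(3)])
  show "(\<lambda>x. (norm (g x))\<^sup>2) \<in> borel_measurable (lebesgue_on \<Omega>)" using assms(1) by measurable
qed (use assms in auto)

section \<open>Capacity\<close>

text \<open>The conditions of \<open>admissible_cap\<close> other than those on sign and boundary
  values. The weak gradient is carried along as data instead of being chosen from v.\<close>

definition sobolev :: "R2 set \<Rightarrow> (R2 \<Rightarrow> real) \<Rightarrow> (R2 \<Rightarrow> R2) \<Rightarrow> bool" where
  "sobolev \<Omega> v g \<longleftrightarrow> continuous_on \<Omega> v \<and> weak_gradient \<Omega> v g \<and> (\<lambda>x. norm (g x) ^ 2) integrable_on \<Omega>"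

definition energy :: "R2 set \<Rightarrow> (R2 \<Rightarrow> R2) \<Rightarrow> real" where
  "energy \<Omega> g = integral \<Omega> (\<lambda>x. norm (g x) ^ 2)"

text \<open>When the square is not integrable, \<open>integral\<close> takes the default value 0, so
  the sign is right for every g.\<close>

lemma energy_nonneg: "0 \<le> energy \<Omega> g"
  unfolding energy_def
  by (cases "(\<lambda>x. norm (g x) ^ 2) integrable_on \<Omega>") (auto intro: integral_nonneg simp: not_integrable_integral)

lemma admissible_imp_sobolev: "admissible_cap F0 F1 \<Omega> v g \<Longrightarrow> sobolev \<Omega> v g"
  by (simp add: admissible_cap_def sobolev_def)

lemma admissibleI:
  assumes "sobolev \<Omega> v g" "\<And>x. x \<in> \<Omega> \<Longrightarrow> 0 \<le> v x"
    "open U" "F0 \<subseteq> U" "\<And>x. x \<in> U \<Longrightarrow> x \<in> \<Omega> \<Longrightarrow> v x = 0"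
    "open W" "F1 \<subseteq> W" "\<And>x. x \<in> W \<Longrightarrow> x \<in> \<Omega> \<Longrightarrow> 1 \<le> v x"
  shows "admissible_cap F0 F1 \<Omega> v g"
  using assms unfolding admissible_cap_def sobolev_def by blast

lemma cap_le_energy: "admissible_cap F0 F1 \<Omega> v g \<Longrightarrow> cap F0 F1 \<Omega> \<le> energy \<Omega> g"
  unfolding cap_def energy_def
  by (rule cInf_lower) (auto intro!: bdd_belowI[of _ 0] simp: energy_nonneg[unfolded energy_def])

text \<open>\<open>Inf\<close> of the empty set of reals carries no information, so a lower bound
  for \<open>cap\<close> presupposes a competitor. This existence premise accompanies capacities
  from here on.\<close>

lemma cap_greatest:
  assumes "\<exists>v g. admissible_cap F0 F1 \<Omega> v g" "\<And>v g. admissible_cap F0 F1 \<Omega> v g \<Longrightarrow> c \<le> energy \<Omega> g"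
  shows "c \<le> cap F0 F1 \<Omega>"
  unfolding cap_def by (rule cInf_greatest) (use assms in \<open>auto simp: energy_def\<close>)

lemma cap_nonneg: "\<exists>v g. admissible_cap F0 F1 \<Omega> v g \<Longrightarrow> 0 \<le> cap F0 F1 \<Omega>"
  by (rule cap_greatest) (auto simp: energy_nonneg)

lemma cap_lessD:
  assumes "\<exists>v g. admissible_cap F0 F1 \<Omega> v g" "cap F0 F1 \<Omega> < e"
  shows "\<exists>v g. admissible_cap F0 F1 \<Omega> v g \<and> energy \<Omega> g < e"
  using assms cap_greatest[OF assms(1), of e] by (meson not_le)

lemma admissible_mono:
  "admissible_cap F0 B \<Omega> v g \<Longrightarrow> A \<subseteq> B \<Longrightarrow> admissible_cap F0 A \<Omega> v g"
  unfolding admissible_cap_def by (meson order_trans)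

lemma cap_mono:
  "A \<subseteq> B \<Longrightarrow> \<exists>v g. admissible_cap F0 B \<Omega> v g \<Longrightarrow> cap F0 A \<Omega> \<le> cap F0 B \<Omega>"
  by (rule cap_greatest) (auto dest: admissible_mono cap_le_energy)

lemma admissible_empty: "admissible_cap F0 {} \<Omega> (\<lambda>_. 0) (\<lambda>_. 0)"
  by (rule admissibleI[of _ _ _ UNIV _ "{}"])
    (auto simp: sobolev_def weak_gradient_const integrable_0)

lemma cap_empty: "cap F0 {} \<Omega> = 0"
proof (rule antisym)
  show "cap F0 {} \<Omega> \<le> 0"
    using cap_le_energy[OF admissible_empty, of F0 \<Omega>] by (simp add: energy_def)
  show "0 \<le> cap F0 {} \<Omega>" using cap_nonneg admissible_empty by blast
qed

text \<open>Young's inequality with a free weight t; a suitable t later turns the quadratic bound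
  into a triangle inequality for square roots of energies.\<close>

lemma norm_add_sq_le:
  fixes a b :: "'a::real_inner"
  assumes "t > 0"
  shows "norm (a + b) ^ 2 \<le> (1 + t) * norm a ^ 2 + (1 + 1/t) * norm b ^ 2"
proof -
  have "0 \<le> (sqrt t * norm a - norm b / sqrt t)^2" by simp
  also have "\<dots> = t * norm a ^ 2 - 2 * norm a * norm b + norm b ^ 2 / t"
    using assms by (simp add: power2_diff power_mult_distrib power_divide)
  finally have 1: "2 * norm a * norm b \<le> t * norm a ^ 2 + norm b ^ 2 / t" by simp
  have "norm (a + b) ^ 2 \<le> (norm a + norm b)^2" by (intro power_mono norm_triangle_ineq) auto
  also have "\<dots> = norm a ^ 2 + norm b ^ 2 + 2 * norm a * norm b" by (simp add: power2_sum)
  also have "\<dots> \<le> (1 + t) * norm a ^ 2 + (1 + 1/t) * norm b ^ 2" using 1 by (simp add: algebra_simps)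
  finally show ?thesis .
qed

lemma sobolev_add:
  assumes "open \<Omega>" "sobolev \<Omega> v g" "sobolev \<Omega> w h"
  shows "sobolev \<Omega> (\<lambda>x. v x + w x) (\<lambda>x. g x + h x)"
    and "t > 0 \<Longrightarrow> energy \<Omega> (\<lambda>x. g x + h x) \<le> (1 + t) * energy \<Omega> g + (1 + 1/t) * energy \<Omega> h"
proof -
  have w: "weak_gradient \<Omega> (\<lambda>x. v x + w x) (\<lambda>x. g x + h x)"
    using assms unfolding sobolev_def by (intro weak_gradient_add) auto
  have i: "(\<lambda>x. (1 + t) * norm (g x) ^ 2 + (1 + 1/t) * norm (h x) ^ 2) integrable_on \<Omega>" for t
    using assms unfolding sobolev_def by (intro integrable_add integrable_on_mult_right) auto
  have 1: "(\<lambda>x. norm (g x + h x) ^ 2) integrable_on \<Omega>"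
    by (rule sq_integrable_bounded_by[OF weak_gradient_measurable[OF w assms(1)] assms(1) i[of 1]])
      (rule norm_add_sq_le, simp)
  then show "sobolev \<Omega> (\<lambda>x. v x + w x) (\<lambda>x. g x + h x)"
    using w assms unfolding sobolev_def by (auto intro!: continuous_intros)
  assume t: "t > 0"
  have "energy \<Omega> (\<lambda>x. g x + h x) \<le> integral \<Omega> (\<lambda>x. (1 + t) * norm (g x) ^ 2 + (1 + 1/t) * norm (h x) ^ 2)"
    unfolding energy_def by (rule integral_le[OF 1 i]) (rule norm_add_sq_le[OF t])
  also have "\<dots> = (1 + t) * energy \<Omega> g + (1 + 1/t) * energy \<Omega> h"
    using assms unfolding sobolev_def energy_def
    by (subst integral_add) (auto intro!: integrable_on_mult_right)
  finally show "energy \<Omega> (\<lambda>x. g x + h x) \<le> (1 + t) * energy \<Omega> g + (1 + 1/t) * energy \<Omega> h" .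
qed

lemma admissible_Un:
  assumes "open \<Omega>" "admissible_cap F A \<Omega> v g" "admissible_cap F B \<Omega> w h"
  shows "admissible_cap F (A \<union> B) \<Omega> (\<lambda>x. v x + w x) (\<lambda>x. g x + h x)"
proof -
  have s: "sobolev \<Omega> (\<lambda>x. v x + w x) (\<lambda>x. g x + h x)"
    using sobolev_add(1)[OF assms(1) admissible_imp_sobolev[OF assms(2)] admissible_imp_sobolev[OF assms(3)]] .
  have nn: "\<And>x. x \<in> \<Omega> \<Longrightarrow> 0 \<le> v x" "\<And>x. x \<in> \<Omega> \<Longrightarrow> 0 \<le> w x" using assms unfolding admissible_cap_def by auto
  obtain U1 U2 where U: "open U1" "F \<subseteq> U1" "\<forall>x\<in>U1 \<inter> \<Omega>. v x = 0" "open U2" "F \<subseteq> U2" "\<forall>x\<in>U2 \<inter> \<Omega>. w x = 0"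
    using assms unfolding admissible_cap_def by metis
  obtain W1 W2 where W: "open W1" "A \<subseteq> W1" "\<forall>x\<in>W1 \<inter> \<Omega>. 1 \<le> v x" "open W2" "B \<subseteq> W2" "\<forall>x\<in>W2 \<inter> \<Omega>. 1 \<le> w x"
    using assms unfolding admissible_cap_def by metis
  have "\<exists>U. open U \<and> F \<subseteq> U \<and> (\<forall>x\<in>U \<inter> \<Omega>. v x + w x = 0)"
    using U by (intro exI[of _ "U1 \<inter> U2"]) auto
  moreover have "\<exists>U. open U \<and> A \<union> B \<subseteq> U \<and> (\<forall>x\<in>U \<inter> \<Omega>. 1 \<le> v x + w x)"
    using W nn by (intro exI[of _ "W1 \<union> W2"]) (force intro: add_increasing add_increasing2)
  ultimately show ?thesis using s nn unfolding admissible_cap_def sobolev_def by auto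
qed

text \<open>The square root of the energy behaves like an L^2 norm, and v + w competes for the union
  because both summands are nonnegative. This is the source of the triangle inequality for the
  metric.\<close>

lemma sqrt_cap_Un:
  assumes \<Omega>: "open \<Omega>" and A: "\<exists>v g. admissible_cap F A \<Omega> v g" and B: "\<exists>v g. admissible_cap F B \<Omega> v g"
  shows "sqrt (cap F (A \<union> B) \<Omega>) \<le> sqrt (cap F A \<Omega>) + sqrt (cap F B \<Omega>)"
proof (rule field_le_epsilon)
  fix e :: real assume e: "e > 0"
  define a b where "a = sqrt (cap F A \<Omega>) + e/2" and "b = sqrt (cap F B \<Omega>) + e/2"
  have pos: "a > 0" "b > 0" using e cap_nonneg[OF A] cap_nonneg[OF B] unfolding a_def b_def
    by (auto intro: add_nonneg_pos)
  have "(sqrt (cap F A \<Omega>))^2 < a^2" "(sqrt (cap F B \<Omega>))^2 < b^2"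
    using e cap_nonneg[OF A] cap_nonneg[OF B] unfolding a_def b_def
    by (intro power_strict_mono; simp)+
  then have "cap F A \<Omega> < a^2" "cap F B \<Omega> < b^2"
    using cap_nonneg[OF A] cap_nonneg[OF B] by auto
  then obtain v g w h where vg: "admissible_cap F A \<Omega> v g" "energy \<Omega> g < a^2"
    and wh: "admissible_cap F B \<Omega> w h" "energy \<Omega> h < b^2"
    using cap_lessD[OF A] cap_lessD[OF B] by metis
  have "cap F (A \<union> B) \<Omega> \<le> energy \<Omega> (\<lambda>x. g x + h x)"
    by (rule cap_le_energy[OF admissible_Un[OF \<Omega> vg(1) wh(1)]])
  \<comment> \<open>The weight \<open>b/a\<close> is optimal: for energies a^2 and b^2 the right
    side becomes exactly (a + b)^2.\<close>
  also have "\<dots> \<le> (1 + b/a) * energy \<Omega> g + (1 + 1/(b/a)) * energy \<Omega> h"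
    by (rule sobolev_add(2)[OF \<Omega> admissible_imp_sobolev[OF vg(1)] admissible_imp_sobolev[OF wh(1)]])
      (use pos in auto)
  also have "\<dots> \<le> (1 + b/a) * a^2 + (1 + 1/(b/a)) * b^2"
    using vg wh pos by (intro add_mono mult_left_mono) auto
  also have "\<dots> = (a + b)^2" using pos by (simp add: field_simps power2_eq_square)
  finally have "sqrt (cap F (A \<union> B) \<Omega>) \<le> a + b" using pos by (intro real_le_lsqrt) auto
  then show "sqrt (cap F (A \<union> B) \<Omega>) \<le> sqrt (cap F A \<Omega>) + sqrt (cap F B \<Omega>) + e"
    unfolding a_def b_def by simp
qed

text \<open>The outer value c is left free so that both a cutoff (c = 0) and one minus a cutoff (c =
  1) are covered; in either case the gradient lives on T.\<close>

lemma c1_support_sobolev: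
  assumes "open \<Omega>" "c1 f G" "compact T" "\<And>x. x \<notin> T \<Longrightarrow> f x = c"
  shows "sobolev \<Omega> f G"
proof -
  have G0: "G x = 0" if "x \<notin> T" for x
    using c1_grad_zero[OF assms(2), of "-T" x c] assms(3,4) that by (auto intro: compact_imp_closed)
  have "integrable lborel (\<lambda>x. norm (G x) ^ 2)"
    by (rule continuous_support_integrable[OF _ assms(3)])
      (use G0 in \<open>auto intro!: continuous_intros c1_continuous_grad[OF assms(2)]\<close>)
  then have "(\<lambda>x. norm (G x) ^ 2) absolutely_integrable_on UNIV"
    by (simp add: set_integrable_def integrable_completion borel_measurable_integrable)
  then have "(\<lambda>x. norm (G x) ^ 2) absolutely_integrable_on \<Omega>"
    by (rule set_integrable_subset) (use assms(1) in auto)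
  then show ?thesis
    unfolding sobolev_def absolutely_integrable_on_def
    using weak_gradient_c1[OF assms(2)] c1_continuous[OF assms(2)] by auto
qed

section \<open>Existence of competitors, and vanishing capacity of points\<close>

text \<open>One minus a cutoff that is 1 near F and vanishes off a compact T inside V is 0 near F
  and equals 1 on the complement of T, an open set containing \<open>- V\<close>.\<close>

lemma admissible_inner_exists:
  assumes "open \<Omega>" "compact F" "open V" "F \<subseteq> V"
  shows "\<exists>v g. admissible_cap F (- V) \<Omega> v g"
proof -
  obtain \<eta> G T U where c: "c1 \<eta> G" "\<And>x. 0 \<le> \<eta> x" "\<And>x. \<eta> x \<le> 1" "open U" "F \<subseteq> U"
    "\<And>x. x \<in> U \<Longrightarrow> \<eta> x = 1" "compact T" "T \<subseteq> V" "\<And>x. x \<notin> T \<Longrightarrow> \<eta> x = 0"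
    using cutoff_exists[OF assms(2-4)] by metis
  have "sobolev \<Omega> (\<lambda>x. 1 - \<eta> x) (\<lambda>x. 0 - G x)"
    by (rule c1_support_sobolev[OF assms(1) c1_diff[OF c1_const c(1)] c(7), of _ 1]) (use c in auto)
  then have "admissible_cap F (- V) \<Omega> (\<lambda>x. 1 - \<eta> x) (\<lambda>x. 0 - G x)"
    by (intro admissibleI[of _ _ _ U _ "-T"]) (use c in \<open>auto simp: compact_imp_closed open_Compl\<close>)
  then show ?thesis by blast
qed

lemma admissible_outer_exists:
  assumes "open \<Omega>" "compact C" "C \<subseteq> \<Omega>"
  shows "\<exists>v g. admissible_cap (frontier \<Omega>) C \<Omega> v g"
proof -
  obtain \<eta> G T U where c: "c1 \<eta> G" "\<And>x. 0 \<le> \<eta> x" "\<And>x. \<eta> x \<le> 1" "open U" "C \<subseteq> U"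
    "\<And>x. x \<in> U \<Longrightarrow> \<eta> x = 1" "compact T" "T \<subseteq> \<Omega>" "\<And>x. x \<notin> T \<Longrightarrow> \<eta> x = 0"
    using cutoff_exists[OF assms(2,1,3)] by metis
  have "sobolev \<Omega> \<eta> G"
    by (rule c1_support_sobolev[OF assms(1) c(1,7,9)])
  moreover have "frontier \<Omega> \<subseteq> - T" using c(8) assms(1) by (auto simp: frontier_def interior_open)
  ultimately have "admissible_cap (frontier \<Omega>) C \<Omega> \<eta> G"
    by (intro admissibleI[of _ _ _ "-T" _ U]) (use c in \<open>auto simp: compact_imp_closed open_Compl\<close>)
  then show ?thesis by blast
qed

lemma content_square:
  fixes p :: R2
  assumes "r > 0"
  shows "measure lborel (cbox (p - r *\<^sub>R One) (p + r *\<^sub>R One)) = 4 * r^2"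
proof -
  have "measure lborel (cbox (p - r *\<^sub>R One) (p + r *\<^sub>R One)) = (\<Prod>k\<in>(Basis :: R2 set). 2 * r)"
    using assms by (subst content_cbox) (auto simp: inner_diff_left inner_add_left intro!: prod.cong)
  also have "\<dots> = 4 * r^2" by (simp add: power2_eq_square)
  finally show ?thesis .
qed

text \<open>The average of n dyadic bumps has energy O(1/n), because the gradients have disjoint supports.\<close>

lemma dyadic_bumps:
  assumes \<Omega>: "open \<Omega>" and \<rho>: "\<rho> > 0"
  obtains M where "\<And>n. \<exists>u G r. r > 0 \<and> c1 u G \<and> (\<forall>x. 0 \<le> u x) \<and> (\<forall>x\<in>ball p r. u x = real n) \<and>
     (\<forall>x. x \<notin> ball p \<rho> \<longrightarrow> u x = 0) \<and> energy \<Omega> G \<le> real n * M"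
proof -
  obtain \<eta> N T U where c: "c1 \<eta> N" "\<And>x. 0 \<le> \<eta> x" "\<And>x. \<eta> x \<le> 1" "open U" "cball (0::R2) (1/2) \<subseteq> U"
    "\<And>x. x \<in> U \<Longrightarrow> \<eta> x = 1" "compact T" "T \<subseteq> ball 0 1" "\<And>x. x \<notin> T \<Longrightarrow> \<eta> x = 0"
  proof -
    have "cball (0::R2) (1/2) \<subseteq> ball 0 1" by (auto simp: subset_iff)
    then show ?thesis using cutoff_exists[OF compact_cball open_ball] that by metis
  qed
  have N0: "N x = 0" if "x \<notin> T" for x
    using c1_grad_support[OF c(1) compact_imp_closed[OF c(7)] c(9) that] .
  have N1: "N x = 0" if "norm x \<le> 1/2" for x
    using c1_grad_zero[OF c(1,4), of x 1] c(5,6) that by (auto simp: subset_iff)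
  have "bounded (N ` T)" using c1_continuous_grad[OF c(1)] c(7) compact_continuous_image compact_imp_bounded by blast
  then obtain L where L: "\<And>x. x \<in> T \<Longrightarrow> norm (N x) \<le> L" "L > 0" by (auto simp: bounded_pos)
  have NL: "norm (N x) \<le> L" for x using L N0 by (cases "x \<in> T") auto
  \<comment> \<open>Dirichlet energy is scale invariant in the plane: a gradient of size at most
    \<open>L / r\<close> on a square of area \<open>4 * r^2\<close> contributes at most
    \<open>4 * L^2\<close>, whatever r is.\<close>
  define M where "M = 4 * L^2"
  have bump: "\<exists>f F. c1 f F \<and> (\<forall>x. 0 \<le> f x) \<and> (\<forall>x\<in>ball p (r/2). f x = 1) \<and> (\<forall>x\<in>ball p (r/2). F x = 0) \<and>
      (\<forall>x. x \<notin> ball p r \<longrightarrow> f x = 0) \<and> (\<forall>x. x \<notin> ball p r \<longrightarrow> F x = 0) \<and> energy \<Omega> F \<le> M" if r: "r > 0" for r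
  proof -
    define f F where "f x = \<eta> ((1/r) *\<^sub>R (x - p))" and "F x = (1/r) *\<^sub>R N ((1/r) *\<^sub>R (x - p))" for x
    have in1: "norm ((1/r) *\<^sub>R (x - p)) \<le> 1/2" if "x \<in> ball p (r/2)" for x
    proof -
      have "norm ((1/r) *\<^sub>R (x - p)) = norm (x - p) / r" using r by simp
      then show ?thesis using that r by (simp add: dist_norm norm_minus_commute divide_le_eq)
    qed
    have in2: "(1/r) *\<^sub>R (x - p) \<notin> T" if "x \<notin> ball p r" for x
    proof -
      have "norm ((1/r) *\<^sub>R (x - p)) = norm (x - p) / r" using r by simp
      then have "norm ((1/r) *\<^sub>R (x - p)) \<ge> 1" using that r by (simp add: dist_norm norm_minus_commute)
      then show ?thesis using c(8) by (auto simp: subset_iff)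
    qed
    have cF: "c1 f F"
      unfolding c1_def
    proof (intro conjI allI)
      show "continuous_on UNIV F" unfolding F_def
        by (intro continuous_intros continuous_on_compose2[OF c1_continuous_grad[OF c(1), of UNIV]]) auto
      fix x
      have "((\<lambda>x. (1/r) *\<^sub>R (x - p)) has_derivative (\<lambda>h. (1/r) *\<^sub>R h)) (at x)"
        by (auto intro!: derivative_eq_intros)
      moreover have "(\<eta> has_derivative (\<lambda>h. N ((1/r) *\<^sub>R (x - p)) \<bullet> h)) (at ((1/r) *\<^sub>R (x - p)))"
        using c(1) by (simp add: c1_def)
      ultimately have "((\<lambda>x. \<eta> ((1/r) *\<^sub>R (x - p))) has_derivative (\<lambda>h. N ((1/r) *\<^sub>R (x - p)) \<bullet> ((1/r) *\<^sub>R h))) (at x)"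
        by (rule has_derivative_compose)
      then show "(f has_derivative (\<lambda>h. F x \<bullet> h)) (at x)" unfolding f_def F_def by simp
    qed
    have f0: "f x = 0" if "x \<notin> ball p r" for x using c(9) in2[OF that] by (simp add: f_def)
    have F0: "F x = 0" if "x \<notin> ball p r" for x using N0 in2[OF that] by (simp add: F_def)
    have "sobolev \<Omega> f F"
      by (rule c1_support_sobolev[OF \<Omega> cF compact_cball[of p r], of 0]) (use f0 in auto)
    then have int: "(\<lambda>x. norm (F x) ^ 2) integrable_on \<Omega>" by (simp add: sobolev_def)
    let ?Q = "cbox (p - r *\<^sub>R One) (p + r *\<^sub>R One)"
    have le: "norm (F x) ^ 2 \<le> indicator ?Q x * (L/r)^2" for x
    proof (cases "x \<in> ?Q")
      case True
      have "norm (F x) \<le> L/r" using NL[of "(1/r) *\<^sub>R (x - p)"] r by (simp add: F_def divide_simps)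
      then have "norm (F x) ^ 2 \<le> (L/r)^2" by (intro power_mono) auto
      then show ?thesis using True by simp
    next
      case False
      then have "x \<notin> ball p r"
      proof -
        obtain k where k: "k \<in> Basis" "\<not> (p \<bullet> k - r \<le> x \<bullet> k \<and> x \<bullet> k \<le> p \<bullet> k + r)"
          using False by (auto simp: mem_box inner_diff_left inner_add_left)
        then have "\<bar>(x - p) \<bullet> k\<bar> > r" by (auto simp: inner_diff_left)
        then have "norm (x - p) > r" using Basis_le_norm[OF k(1), of "x - p"] by simp
        then show ?thesis by (simp add: dist_norm norm_minus_commute)
      qed
      then show ?thesis using F0 False by simp
    qed
    have iQ: "(\<lambda>x. indicator ?Q x * (L/r)^2) integrable_on UNIV"
      using integrable_on_indicator[of ?Q UNIV] by (intro integrable_on_mult_left) auto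
    have "energy \<Omega> F = integral UNIV (\<lambda>x. if x \<in> \<Omega> then norm (F x) ^ 2 else 0)"
      unfolding energy_def by (simp add: integral_restrict_UNIV)
    also have "\<dots> \<le> integral UNIV (\<lambda>x. indicator ?Q x * (L/r)^2)"
      by (rule integral_le) (use int iQ le in \<open>auto simp: integrable_restrict_UNIV\<close>)
    also have "\<dots> = measure lborel ?Q * (L/r)^2"
      by (simp add: integral_indicator)
    also have "measure lborel ?Q = 4 * r^2"
      using r by (rule content_square)
    finally have "energy \<Omega> F \<le> M" using r by (simp add: M_def power_divide)
    then show ?thesis using cF c(2,6) c(5) in1 f0 F0 N1
      by (intro exI[of _ f] exI[of _ F]) (auto simp: f_def F_def subset_iff)
  qed
  have "\<exists>u G r. r > 0 \<and> r \<le> \<rho> \<and> c1 u G \<and> (\<forall>x. 0 \<le> u x) \<and> (\<forall>x\<in>ball p r. u x = real n) \<and>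
     (\<forall>x. x \<notin> ball p \<rho> \<longrightarrow> u x = 0) \<and> energy \<Omega> G \<le> real n * M" for n
  proof (induction n)
    case 0
    show ?case using \<rho> by (intro exI[of _ "\<lambda>_. 0"] exI[of _ \<rho>]) (auto simp: c1_const energy_def)
  next
    case (Suc n)
    then obtain u G r where u: "r > 0" "r \<le> \<rho>" "c1 u G" "\<forall>x. 0 \<le> u x" "\<forall>x\<in>ball p r. u x = real n"
      "\<forall>x. x \<notin> ball p \<rho> \<longrightarrow> u x = 0" "energy \<Omega> G \<le> real n * M" by metis
    obtain f F where f: "c1 f F" "\<forall>x. 0 \<le> f x" "\<forall>x\<in>ball p (r/2). f x = 1" "\<forall>x. x \<notin> ball p r \<longrightarrow> f x = 0"
      "\<forall>x. x \<notin> ball p r \<longrightarrow> F x = 0" "energy \<Omega> F \<le> M" using bump[OF u(1)] by metis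
    have G0: "G x = 0" if "x \<in> ball p r" for x
      using c1_grad_zero[OF u(3) open_ball that, of "real n"] u(5) by auto
    have sG: "sobolev \<Omega> u G" by (rule c1_support_sobolev[OF \<Omega> u(3) compact_cball[of p \<rho>], of 0]) (use u in auto)
    have sF: "sobolev \<Omega> f F" by (rule c1_support_sobolev[OF \<Omega> f(1) compact_cball[of p r], of 0]) (use f in auto)
    have "norm (G x + F x) ^ 2 = norm (G x) ^ 2 + norm (F x) ^ 2" for x
      using G0[of x] f(5) by (cases "x \<in> ball p r") auto
    then have "energy \<Omega> (\<lambda>x. G x + F x) = energy \<Omega> G + energy \<Omega> F"
      using sG sF unfolding energy_def sobolev_def by (simp add: integral_add)
    then have "energy \<Omega> (\<lambda>x. G x + F x) \<le> real (Suc n) * M" using u(7) f(6) by (simp add: algebra_simps)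
    then show ?case using c1_add[OF u(3) f(1)] u f
      by (intro exI[of _ "\<lambda>x. u x + f x"] exI[of _ "\<lambda>x. G x + F x"] exI[of _ "r/2"]) auto
  qed
  then show ?thesis using that[of M] by metis
qed

text \<open>A point has zero capacity in the plane: the sum of n dyadic bumps divided by n equals 1
  near p, vanishes near F and has energy at most \<open>M / n\<close>.\<close>

lemma cap_small_ball:
  assumes \<Omega>: "open \<Omega>" and F: "closed F" "p \<notin> F" and e: "e > 0"
  obtains r where "r > 0" "\<exists>v g. admissible_cap F (ball p r) \<Omega> v g" "cap F (ball p r) \<Omega> \<le> e"
proof -
  obtain \<rho> where \<rho>: "\<rho> > 0" "cball p \<rho> \<inter> F = {}"
  proof -
    have "open (- F)" "p \<in> - F" using F by auto
    then obtain \<rho> where "\<rho> > 0" "cball p \<rho> \<subseteq> - F" by (meson open_contains_cball)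
    then show ?thesis using that by blast
  qed
  obtain M where M: "\<And>n. \<exists>u G r. r > 0 \<and> c1 u G \<and> (\<forall>x. 0 \<le> u x) \<and> (\<forall>x\<in>ball p r. u x = real n) \<and>
     (\<forall>x. x \<notin> ball p \<rho> \<longrightarrow> u x = 0) \<and> energy \<Omega> G \<le> real n * M"
    using dyadic_bumps[OF \<Omega> \<rho>(1)] by blast
  obtain n where n: "real n > M / e" "n > 0" using reals_Archimedean2[of "max 1 (M/e)"]
    by (metis max_less_iff_conj of_nat_0_less_iff less_trans zero_less_one)
  obtain u G r where u: "r > 0" "c1 u G" "\<forall>x. 0 \<le> u x" "\<forall>x\<in>ball p r. u x = real n"
      "\<forall>x. x \<notin> ball p \<rho> \<longrightarrow> u x = 0" "energy \<Omega> G \<le> real n * M" using M by metis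
  let ?v = "\<lambda>x. (1 / real n) * u x" and ?g = "\<lambda>x. (1 / real n) *\<^sub>R G x"
  have "c1 ?v ?g" by (rule c1_cmult[OF u(2)])
  then have "sobolev \<Omega> ?v ?g" by (rule c1_support_sobolev[OF \<Omega> _ compact_cball[of p \<rho>], of _ _ 0]) (use u in auto)
  then have adm: "admissible_cap F (ball p r) \<Omega> ?v ?g"
    by (rule admissibleI[of _ _ _ "- cball p \<rho>" _ "ball p r"]) (use u n \<rho> in auto)
  have "energy \<Omega> ?g = (1 / real n)^2 * energy \<Omega> G"
    unfolding energy_def by (simp add: power_divide)
  also have "\<dots> \<le> (1 / real n)^2 * (real n * M)" by (intro mult_left_mono u) auto
  also have "\<dots> = M / real n" using n by (simp add: power2_eq_square)
  also have "\<dots> \<le> e" using n e by (simp add: field_simps)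
  finally have "cap F (ball p r) \<Omega> \<le> e" using cap_le_energy[OF adm] by simp
  then show ?thesis using that u(1) adm by blast
qed

section \<open>Rectifiable curves and the capacitary metric\<close>

lemma partition_range:
  fixes t :: "nat \<Rightarrow> real"
  assumes "t 0 = 0" "t n = 1" "\<forall>i<n. t i \<le> t (Suc i)" "i \<le> n"
  shows "t i \<in> {0..1}"
proof -
  have up: "j \<le> n \<Longrightarrow> i \<le> j \<Longrightarrow> t i \<le> t j" for i j
  proof (induction j)
    case (Suc j)
    then show ?case using assms(3) by (cases "i = Suc j") (auto, metis Suc_le_eq le_SucE order_trans less_imp_le)
  qed auto
  show ?thesis using up[of i 0] up[of n i] assms by auto
qed

lemma lipschitz_imp_rectifiable:
  assumes "path g" "\<And>s t. s \<in> {0..1} \<Longrightarrow> t \<in> {0..1} \<Longrightarrow> dist (g s) (g t) \<le> L * dist s t"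
  shows "rectifiable_path g"
  unfolding rectifiable_path_def
proof (intro conjI bdd_aboveI[of _ L])
  fix S assume "S \<in> {(\<Sum>i<n. dist (g (t (Suc i))) (g (t i))) | n t.
                 t 0 = 0 \<and> t n = 1 \<and> (\<forall>i<n. t i \<le> t (Suc i))}"
  then obtain n t where t: "S = (\<Sum>i<n. dist (g (t (Suc i))) (g (t i)))" "t 0 = 0" "t n = 1" "\<forall>i<n. t i \<le> t (Suc i)"
    by blast
  have "S \<le> (\<Sum>i<n. L * (t (Suc i) - t i))" unfolding t(1)
  proof (rule sum_mono)
    fix i assume "i \<in> {..<n}"
    then have "dist (g (t (Suc i))) (g (t i)) \<le> L * dist (t (Suc i)) (t i)" "t i \<le> t (Suc i)"
      using t by (auto intro!: assms(2) partition_range[of t n])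
    then show "dist (g (t (Suc i))) (g (t i)) \<le> L * (t (Suc i) - t i)" by (simp add: dist_real_def)
  qed
  also have "\<dots> = L * (t n - t 0)" by (simp add: sum_distrib_left[symmetric] sum_lessThan_telescope)
  finally show "S \<le> L" using t by simp
qed (fact assms(1))

lemma rectifiable_linepath: "rectifiable_path (linepath a b)"
proof (rule lipschitz_imp_rectifiable)
  fix s t :: real
  have "linepath a b s - linepath a b t = (s - t) *\<^sub>R (b - a)"
    by (simp add: linepath_def algebra_simps)
  then show "dist (linepath a b s) (linepath a b t) \<le> norm (b - a) * dist s t"
    by (simp add: dist_norm)
qed simp

text \<open>The metric is an infimum over rectifiable curves, so this set has to be nonempty. Points
  of a connected open set are joined by polynomial curves, which are Lipschitz on
  \<open>[0,1]\<close>.\<close>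

lemma rectifiable_curve_exists:
  assumes "open \<Omega>" "connected \<Omega>" "x \<in> \<Omega>" "y \<in> \<Omega>"
  shows "curves_joining \<Omega> x y \<noteq> {}"
proof -
  obtain g where g: "polynomial_function g" "path_image g \<subseteq> \<Omega>" "pathstart g = x" "pathfinish g = y"
    using connected_open_polynomial_connected[OF assms] by blast
  obtain g' where g': "polynomial_function g'" "\<And>x. (g has_vector_derivative g' x) (at x)"
    using has_vector_derivative_polynomial_function[OF g(1)] by metis
  have "compact (g' ` {0..1})" using g'(1)
    by (intro compact_continuous_image continuous_on_polymonial_function) auto
  then obtain B where B: "\<And>t. t \<in> {0..1} \<Longrightarrow> norm (g' t) \<le> B"
    using compact_imp_bounded bounded_iff by (metis imageI)
  have "rectifiable_path g"
  proof (rule lipschitz_imp_rectifiable)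
    show "path g" using g(1) by (simp add: path_def continuous_on_polymonial_function)
    fix s t :: real assume st: "s \<in> {0..1}" "t \<in> {0..1}"
    have "norm (g s - g t) \<le> B * norm (s - t)"
    proof (rule differentiable_bound[of "{0..1}" g "\<lambda>x h. h *\<^sub>R g' x"])
      show "(g has_derivative (\<lambda>h. h *\<^sub>R g' x)) (at x within {0..1})" if "x \<in> {0..1}" for x
        using g'(2)[of x] unfolding has_vector_derivative_def by (rule has_derivative_at_withinI)
      show "onorm (\<lambda>h. h *\<^sub>R g' x) \<le> B" if "x \<in> {0..1}" for x
      proof (rule onorm_le)
        fix h :: real
        show "norm (h *\<^sub>R g' x) \<le> B * norm h" using mult_right_mono[OF B[OF that], of "norm h"]
          by (simp add: mult.commute)
      qed
    qed (use st in auto)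
    then show "dist (g s) (g t) \<le> B * dist s t" by (simp add: dist_norm)
  qed
  then show ?thesis using g by (auto simp: curves_joining_def)
qed

text \<open>A partition t of the parameter interval induces the partitions min(1, 2t) for g and
  max(0, 2t - 1) for h. Each increment of the joined path is at most the sum of the two induced
  increments, so the length bounds add.\<close>

lemma rectifiable_joinpaths:
  assumes g: "rectifiable_path g" and h: "rectifiable_path h" and gh: "pathfinish g = pathstart h"
  shows "rectifiable_path (g +++ h)"
proof -
  obtain A where A: "\<And>n t. t 0 = 0 \<Longrightarrow> t n = 1 \<Longrightarrow> \<forall>i<n. t i \<le> t (Suc i) \<Longrightarrow>
      (\<Sum>i<n. dist (g (t (Suc i))) (g (t i))) \<le> A"
    using g unfolding rectifiable_path_def bdd_above_def by blast
  obtain B where B: "\<And>n t. t 0 = 0 \<Longrightarrow> t n = 1 \<Longrightarrow> \<forall>i<n. t i \<le> t (Suc i) \<Longrightarrow>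
      (\<Sum>i<n. dist (h (t (Suc i))) (h (t i))) \<le> B"
    using h unfolding rectifiable_path_def bdd_above_def by blast
  have key: "dist ((g +++ h) t) ((g +++ h) s) \<le>
      dist (g (min 1 (2 * t))) (g (min 1 (2 * s))) + dist (h (max 0 (2 * t-1))) (h (max 0 (2 * s-1)))"
    if "s \<le> t" for s t :: real
  proof -
    have e: "g 1 = h 0" using gh by (simp add: pathfinish_def pathstart_def)
    consider "t \<le> 1/2" | "s \<le> 1/2" "t > 1/2" | "s > 1/2" by linarith
    then show ?thesis
    proof cases
      case 1
      then have "(g +++ h) t = g (min 1 (2 * t))" "(g +++ h) s = g (min 1 (2 * s))"
        using that by (auto simp: joinpaths_def)
      then show ?thesis by simp
    next
      case 2
      \<comment> \<open>The one step that straddles the junction: the triangle inequality passes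
        through the common point g 1 = h 0.\<close>
      then have "(g +++ h) t = h (max 0 (2 * t-1))" "(g +++ h) s = g (min 1 (2 * s))"
        "g (min 1 (2 * t)) = h (max 0 (2 * s-1))"
        using e by (auto simp: joinpaths_def)
      then show ?thesis by (metis add.commute dist_triangle)
    next
      case 3
      then have "(g +++ h) t = h (max 0 (2 * t-1))" "(g +++ h) s = h (max 0 (2 * s-1))"
        using that by (auto simp: joinpaths_def)
      then show ?thesis by simp
    qed
  qed
  show ?thesis unfolding rectifiable_path_def
  proof (intro conjI bdd_aboveI[of _ "A + B"])
    show "path (g +++ h)" using g h gh by (auto simp: rectifiable_path_def)
    fix S assume "S \<in> {(\<Sum>i<n. dist ((g +++ h) (t (Suc i))) ((g +++ h) (t i))) | n t.
                 t 0 = 0 \<and> t n = 1 \<and> (\<forall>i<n. t i \<le> t (Suc i))}"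
    then obtain n t where t: "S = (\<Sum>i<n. dist ((g +++ h) (t (Suc i))) ((g +++ h) (t i)))" "t 0 = 0" "t n = 1"
      "\<forall>i<n. t i \<le> t (Suc i)" by blast
    define p q where "p i = min 1 (2 * t i)" and "q i = max 0 (2 * t i - 1)" for i
    have "S \<le> (\<Sum>i<n. dist (g (p (Suc i))) (g (p i)) + dist (h (q (Suc i))) (h (q i)))"
      unfolding t(1) p_def q_def by (intro sum_mono key) (use t in auto)
    also have "\<dots> \<le> A + B" unfolding sum.distrib
      by (intro add_mono A B) (use t in \<open>auto simp: p_def q_def min_def max_def; fastforce\<close>)+
    finally show "S \<le> A + B" .
  qed
qed

lemma curves_joining_join:
  assumes "l \<in> curves_joining \<Omega> x y" "m \<in> curves_joining \<Omega> y z"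
  shows "l +++ m \<in> curves_joining \<Omega> x z" "path_image (l +++ m) = path_image l \<union> path_image m"
  using assms by (auto simp: curves_joining_def path_image_join intro: rectifiable_joinpaths)

lemma curves_joining_linepath:
  assumes "closed_segment x y \<subseteq> \<Omega>"
  shows "linepath x y \<in> curves_joining \<Omega> x y"
  using assms by (simp add: curves_joining_def rectifiable_linepath)

section \<open>The cost of a curve, and the metric as an infimum of costs\<close>

text \<open>Defined for a set A because only the image of the curve enters; joining curves then
  becomes taking unions.\<close>

definition curve_cost :: "R2 set \<Rightarrow> R2 set \<Rightarrow> R2 set \<Rightarrow> R2 set \<Rightarrow> real" where
  "curve_cost \<Omega> F V A = sqrt (cap F (A - V) \<Omega>) + sqrt (cap (frontier \<Omega>) (A \<inter> V) \<Omega>)"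

lemma cap_metric_eq: "cap_metric \<Omega> F V x y = Inf ((\<lambda>l. curve_cost \<Omega> F V (path_image l)) ` curves_joining \<Omega> x y)"
  unfolding cap_metric_def curve_cost_def by (rule arg_cong[of _ _ Inf]) blast

locale cap_domain =
  fixes \<Omega> F V :: "R2 set"
  assumes open_dom: "open \<Omega>" and connected_dom: "connected \<Omega>" and pair: "cap_pair \<Omega> F V"
begin

lemma F_compact: "compact F" and F_sub: "F \<subseteq> V" and V_open: "open V" and V_cl: "closure V \<subseteq> \<Omega>" "compact (closure V)"
  and F_connected: "connected F" and F_two: "\<exists>a b. a \<in> F \<and> b \<in> F \<and> a \<noteq> b" and F_dom: "F \<subseteq> \<Omega>"
  using pair unfolding cap_pair_def continuum_def by auto

lemma V_sub: "V \<subseteq> \<Omega>" using V_cl(1) closure_subset by blast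

lemma admissible_disjoint_exists: "A \<inter> V = {} \<Longrightarrow> \<exists>v g. admissible_cap F A \<Omega> v g"
  using admissible_inner_exists[OF open_dom F_compact V_open F_sub] admissible_mono
  by (metis disjoint_eq_subset_Compl)

lemma admissible_subset_exists: "A \<subseteq> V \<Longrightarrow> \<exists>v g. admissible_cap (frontier \<Omega>) A \<Omega> v g"
  using admissible_outer_exists[OF open_dom V_cl(2,1)] admissible_mono closure_subset
  by (metis order_trans)

lemma admissible_diff_exists: "\<exists>v g. admissible_cap F (A - V) \<Omega> v g" by (rule admissible_disjoint_exists) auto
lemma admissible_Int_exists: "\<exists>v g. admissible_cap (frontier \<Omega>) (A \<inter> V) \<Omega> v g" by (rule admissible_subset_exists) auto

lemma cost_nonneg: "0 \<le> curve_cost \<Omega> F V A"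
  unfolding curve_cost_def using cap_nonneg[OF admissible_diff_exists] cap_nonneg[OF admissible_Int_exists] by auto

lemma cost_Un: "curve_cost \<Omega> F V (A \<union> B) \<le> curve_cost \<Omega> F V A + curve_cost \<Omega> F V B"
proof -
  have "A \<union> B - V = (A - V) \<union> (B - V)" "(A \<union> B) \<inter> V = (A \<inter> V) \<union> (B \<inter> V)" by auto
  then show ?thesis unfolding curve_cost_def
    using sqrt_cap_Un[OF open_dom admissible_diff_exists admissible_diff_exists, of A B] sqrt_cap_Un[OF open_dom admissible_Int_exists admissible_Int_exists, of A B] by simp
qed

text \<open>Both \<open>- V\<close> and \<open>V\<close> have competitors and bound the two terms
  for every A. The absolute value and the summand 1 only serve to make the bound positive.\<close>

lemma cost_bounded:
  obtains M where "M > 0" "\<And>A. curve_cost \<Omega> F V A \<le> M"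
proof
  let ?M = "sqrt (cap F (- V) \<Omega>) + sqrt (cap (frontier \<Omega>) V \<Omega>)"
  show "curve_cost \<Omega> F V A \<le> \<bar>?M\<bar> + 1" for A
  proof -
    have "curve_cost \<Omega> F V A \<le> ?M" unfolding curve_cost_def
      by (intro add_mono real_sqrt_le_mono cap_mono admissible_disjoint_exists admissible_subset_exists) auto
    then show ?thesis by linarith
  qed
  show "\<bar>?M\<bar> + 1 > 0" by linarith
qed

abbreviation "\<rho> \<equiv> cap_metric \<Omega> F V"

lemma metric_le: "l \<in> curves_joining \<Omega> x y \<Longrightarrow> \<rho> x y \<le> curve_cost \<Omega> F V (path_image l)"
  unfolding cap_metric_eq by (intro cINF_lower bdd_belowI2[of _ 0] cost_nonneg)

lemma metric_greatest:
  assumes "x \<in> \<Omega>" "y \<in> \<Omega>" "\<And>l. l \<in> curves_joining \<Omega> x y \<Longrightarrow> c \<le> curve_cost \<Omega> F V (path_image l)"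
  shows "c \<le> \<rho> x y"
  unfolding cap_metric_eq
  using rectifiable_curve_exists[OF open_dom connected_dom assms(1,2)] assms(3) by (intro cINF_greatest) auto

lemma metric_nonneg: "x \<in> \<Omega> \<Longrightarrow> y \<in> \<Omega> \<Longrightarrow> 0 \<le> \<rho> x y"
  by (rule metric_greatest) (auto simp: cost_nonneg)

text \<open>Joined curves compete for the left side and the cost is subadditive under unions; the
  two infima on the right are taken one after the other.\<close>

lemma metric_triangle:
  assumes "x \<in> \<Omega>" "y \<in> \<Omega>" "z \<in> \<Omega>"
  shows "\<rho> x z \<le> \<rho> x y + \<rho> y z"
proof -
  have "\<rho> x z \<le> curve_cost \<Omega> F V (path_image l) + curve_cost \<Omega> F V (path_image m)"
    if "l \<in> curves_joining \<Omega> x y" "m \<in> curves_joining \<Omega> y z" for l m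
    using metric_le[OF curves_joining_join(1)[OF that]] curves_joining_join(2)[OF that] cost_Un
    by (metis order_trans)
  then have "\<rho> x z - curve_cost \<Omega> F V (path_image m) \<le> \<rho> x y" if "m \<in> curves_joining \<Omega> y z" for m
    using that by (intro metric_greatest[OF assms(1,2)]) (simp add: algebra_simps)
  then have "\<rho> x z - \<rho> x y \<le> \<rho> y z"
    by (intro metric_greatest[OF assms(2,3)]) (simp add: algebra_simps)
  then show ?thesis by simp
qed

text \<open>Both terms are bounded by capacities of small balls around p. If p lies in F, the first
  term disappears instead: a small ball is contained in V, so \<open>A - V\<close> is empty.\<close>

lemma cost_small:
  assumes p: "p \<in> \<Omega>" and e: "e > 0"
  obtains r where "r > 0" "ball p r \<subseteq> \<Omega>" "\<And>A. A \<subseteq> ball p r \<Longrightarrow> curve_cost \<Omega> F V A \<le> e"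
proof -
  obtain r0 where r0: "r0 > 0" "ball p r0 \<subseteq> \<Omega>" using open_dom p open_contains_ball by blast
  have "closed (frontier \<Omega>)" "p \<notin> frontier \<Omega>" using p open_dom by (auto simp: frontier_def interior_open)
  then obtain r2 where r2: "r2 > 0" "\<exists>v g. admissible_cap (frontier \<Omega>) (ball p r2) \<Omega> v g"
    "cap (frontier \<Omega>) (ball p r2) \<Omega> \<le> (e/2)^2"
    using cap_small_ball[OF open_dom, of "frontier \<Omega>" p "(e/2)^2"] e by auto
  have "\<exists>r1>0. \<forall>A \<subseteq> ball p r1. cap F (A - V) \<Omega> \<le> (e/2)^2"
  proof (cases "p \<in> F")
    case True
    then obtain r1 where "r1 > 0" "ball p r1 \<subseteq> V" using F_sub V_open open_contains_ball by blast
    then have "A - V = {}" if "A \<subseteq> ball p r1" for A using that by blast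
    then show ?thesis using \<open>r1 > 0\<close> e by (metis cap_empty zero_le_power2)
  next
    case False
    then obtain r1 where r1: "r1 > 0" "\<exists>v g. admissible_cap F (ball p r1) \<Omega> v g"
      "cap F (ball p r1) \<Omega> \<le> (e/2)^2"
      using cap_small_ball[OF open_dom compact_imp_closed[OF F_compact], of p "(e/2)^2"] e by auto
    have "cap F (A - V) \<Omega> \<le> (e/2)^2" if "A \<subseteq> ball p r1" for A
      using cap_mono[OF _ r1(2), of "A - V"] r1(3) that by fastforce
    then show ?thesis using r1(1) by blast
  qed
  then obtain r1 where r1: "r1 > 0" "\<And>A. A \<subseteq> ball p r1 \<Longrightarrow> cap F (A - V) \<Omega> \<le> (e/2)^2" by blast
  define r where "r = min r0 (min r1 r2)"
  show ?thesis
  proof (rule that)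
    show "r > 0" "ball p r \<subseteq> \<Omega>" using r0 r1 r2 by (auto simp: r_def)
    fix A assume A: "A \<subseteq> ball p r"
    then have A12: "A \<subseteq> ball p r1" "A \<subseteq> ball p r2" by (auto simp: r_def)
    have "cap (frontier \<Omega>) (A \<inter> V) \<Omega> \<le> (e/2)^2"
      using cap_mono[OF _ r2(2), of "A \<inter> V"] r2(3) A12(2) by fastforce
    then have "sqrt (cap F (A - V) \<Omega>) \<le> e/2" "sqrt (cap (frontier \<Omega>) (A \<inter> V) \<Omega>) \<le> e/2"
      using r1(2)[OF A12(1)] e by (intro real_le_lsqrt; simp)+
    then show "curve_cost \<Omega> F V A \<le> e" unfolding curve_cost_def by simp
  qed
qed

text \<open>A sequence returning to K infinitely often has a Euclidean cluster point p in K. Short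
  segments ending at p have small cost, and the Cauchy property extends the convergence from a
  subsequence to the whole sequence, so p would be a limit for the metric inside \<Omega>.\<close>

lemma boundary_seq_leaves_compact:
  assumes s: "boundary_seq \<Omega> \<rho> s" and K: "compact K" "K \<subseteq> \<Omega>"
  shows "\<forall>\<^sub>F n in sequentially. s n \<notin> K"
proof (rule ccontr)
  assume neg: "\<not> (\<forall>\<^sub>F n in sequentially. s n \<notin> K)"
  then have inf: "\<And>N. \<exists>n\<ge>N. s n \<in> K" by (auto simp: eventually_sequentially)
  have s\<Omega>: "\<And>n. s n \<in> \<Omega>" and cauchy: "\<And>e. e > 0 \<Longrightarrow> \<exists>N. \<forall>m\<ge>N. \<forall>n\<ge>N. \<rho> (s m) (s n) < e"
    and ncv: "\<And>p. p \<in> \<Omega> \<Longrightarrow> \<not> (\<lambda>n. \<rho> (s n) p) \<longlonglongrightarrow> 0"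
    using s unfolding boundary_seq_def by auto
  have "infinite {n. s n \<in> K}" using inf by (auto simp: infinite_nat_iff_unbounded_le)
  then obtain k :: "nat \<Rightarrow> nat" where k: "strict_mono k" "\<And>n. s (k n) \<in> K"
    using infinite_enumerate by blast
  obtain p j where p: "p \<in> K" "strict_mono (j :: nat \<Rightarrow> nat)" "((\<lambda>n. s (k n)) \<circ> j) \<longlonglongrightarrow> p"
    using K(1) k(2) unfolding compact_def by metis
  have p\<Omega>: "p \<in> \<Omega>" using p K by auto
  have "(\<lambda>n. \<rho> (s n) p) \<longlonglongrightarrow> 0"
  proof (rule LIMSEQ_I)
    fix e :: real assume e: "e > 0"
    obtain r where r: "r > 0" "ball p r \<subseteq> \<Omega>" "\<And>A. A \<subseteq> ball p r \<Longrightarrow> curve_cost \<Omega> F V A \<le> e/3"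
      using cost_small[OF p\<Omega>, of "e/3"] e by auto
    obtain N where N: "\<And>m n. m \<ge> N \<Longrightarrow> n \<ge> N \<Longrightarrow> \<rho> (s m) (s n) < e/3" using cauchy[of "e/3"] e by auto
    obtain M where M: "\<And>n. n \<ge> M \<Longrightarrow> dist (s (k (j n))) p < r"
      using p(3) r(1) unfolding lim_sequentially o_def by metis
    \<comment> \<open>One index beyond N whose term is also close to p suffices: every term from N
      on is compared with it.\<close>
    define m where "m = k (j (max M N))"
    have mN: "m \<ge> N" unfolding m_def
      by (meson k(1) p(2) le_trans max.cobounded2 strict_mono_imp_increasing)
    have "s m \<in> ball p r" using M[of "max M N"] by (simp add: m_def dist_commute)
    then have seg: "closed_segment (s m) p \<subseteq> ball p r" using r(1)
      by (intro closed_segment_subset) auto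
    then have "\<rho> (s m) p \<le> curve_cost \<Omega> F V (closed_segment (s m) p)"
      using metric_le[OF curves_joining_linepath[of "s m" p \<Omega>]] r(2) by auto
    also have "\<dots> \<le> e/3" by (rule r(3)[OF seg])
    finally have 1: "\<rho> (s m) p \<le> e/3" .
    have "norm (\<rho> (s n) p - 0) < e" if "n \<ge> N" for n
      using metric_triangle[OF s\<Omega>[of n] s\<Omega>[of m] p\<Omega>] N[OF that mN] 1 metric_nonneg[OF s\<Omega>[of n] p\<Omega>] e by simp
    then show "\<exists>N. \<forall>n\<ge>N. norm (\<rho> (s n) p - 0) < e" by blast
  qed
  then show False using ncv[OF p\<Omega>] by blast
qed

end

text \<open>The path from x m to y m goes through x n and y n, which uses the distance from x m to x
  n and the one from y n to y m. Exchanging m and n then bounds the absolute value of the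
  difference.\<close>

lemma metric_pair_cauchy:
  fixes d :: "'a \<Rightarrow> 'a \<Rightarrow> real"
  assumes tri: "\<And>x y z. x \<in> S \<Longrightarrow> y \<in> S \<Longrightarrow> z \<in> S \<Longrightarrow> d x z \<le> d x y + d y z"
    and x: "\<And>n. x n \<in> S" "\<And>e. e > 0 \<Longrightarrow> \<exists>N. \<forall>m\<ge>N. \<forall>n\<ge>N. d (x m) (x n) < e"
    and y: "\<And>n. y n \<in> S" "\<And>e. e > 0 \<Longrightarrow> \<exists>N. \<forall>m\<ge>N. \<forall>n\<ge>N. d (y m) (y n) < e"
  shows "convergent (\<lambda>n::nat. d (x n) (y n))"
proof (rule Cauchy_convergent, rule metric_CauchyI)
  fix e :: real assume e: "e > 0"
  obtain N where N: "\<forall>m\<ge>N. \<forall>n\<ge>N. d (x m) (x n) < e/2" using x(2)[of "e/2"] e by auto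
  obtain M where M: "\<forall>m\<ge>M. \<forall>n\<ge>M. d (y m) (y n) < e/2" using y(2)[of "e/2"] e by auto
  have half: "d (x m) (y m) - d (x n) (y n) < e" if "m \<ge> max M N" "n \<ge> max M N" for m n
    using tri[OF x(1)[of m] x(1)[of n] y(1)[of m]] tri[OF x(1)[of n] y(1)[of n] y(1)[of m]]
      N[rule_format, of m n] M[rule_format, of n m] that by auto
  have "dist (d (x m) (y m)) (d (x n) (y n)) < e" if "m \<ge> max M N" "n \<ge> max M N" for m n
    using half[OF that] half[OF that(2,1)] by (simp add: dist_real_def abs_less_iff)
  then show "\<exists>M. \<forall>m\<ge>M. \<forall>n\<ge>M. dist (d (x m) (y m)) (d (x n) (y n)) < e" by blast
qed

section \<open>Oscillation along lines\<close>

text \<open>Fubini for a kernel whose integral in the first variable is at most c. It is applied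
  with k a bump of width comparable to \<epsilon> around a coordinate line, where c is proportional
  to \<epsilon>.\<close>

lemma schur_integral:
  fixes S :: "'a::euclidean_space set" and T :: "'b::euclidean_space set" and k :: "'a \<Rightarrow> 'b \<Rightarrow> real"
  assumes S: "S \<in> lmeasurable" and T: "T \<in> lmeasurable"
    and f: "f integrable_on T" "\<And>w. w \<in> T \<Longrightarrow> 0 \<le> f w"
    and k: "continuous_on UNIV (\<lambda>x. k (fst x) (snd x))" "\<And>y w. 0 \<le> k y w" "\<And>y w. k y w \<le> 1"
    and c: "\<And>w. w \<in> T \<Longrightarrow> integral S (\<lambda>y. k y w) \<le> c"
  shows "(\<lambda>y. integral T (\<lambda>w. f w * k y w)) integrable_on S"
    and "integral S (\<lambda>y. integral T (\<lambda>w. f w * k y w)) \<le> c * integral T f"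
proof -
  let ?M1 = "lebesgue_on S" and ?M2 = "lebesgue_on T"
  have Ss: "S \<in> sets lebesgue" and Ts: "T \<in> sets lebesgue" using S T by (auto simp: fmeasurableD)
  interpret M1: finite_measure ?M1 using S by (rule finite_measure_lebesgue_on)
  interpret M2: finite_measure ?M2 using T by (rule finite_measure_lebesgue_on)
  interpret P: pair_sigma_finite ?M1 ?M2 ..
  have fa: "f absolutely_integrable_on T" using f by (rule nonnegative_absolutely_integrable_1)
  have fi: "integrable ?M2 f" using fa Ts by (rule absolutely_integrable_imp_integrable)
  have [measurable]: "f \<in> borel_measurable ?M2" using fi by auto
  have id1[measurable]: "(\<lambda>x. x) \<in> measurable ?M1 borel"
    by (intro continuous_imp_measurable_on_sets_lebesgue Ss) auto
  have id2[measurable]: "(\<lambda>x. x) \<in> measurable ?M2 borel"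
    by (intro continuous_imp_measurable_on_sets_lebesgue Ts) auto
  \<comment> \<open>The factors are completed measures, so the kernel is shown measurable as a
    continuous function of two Borel measurable coordinates.\<close>
  have 1: "fst \<in> measurable (?M1 \<Otimes>\<^sub>M ?M2) borel" "snd \<in> measurable (?M1 \<Otimes>\<^sub>M ?M2) borel"
    using measurable_compose[OF measurable_fst id1] measurable_compose[OF measurable_snd id2] by auto
  have km: "(\<lambda>x. k (fst x) (snd x)) \<in> borel_measurable (?M1 \<Otimes>\<^sub>M ?M2)"
    by (rule borel_measurable_continuous_Pair[OF 1 k(1)])
  have fm: "(\<lambda>x. f (snd x)) \<in> borel_measurable (?M1 \<Otimes>\<^sub>M ?M2)" by measurable
  have Fm: "(\<lambda>x. f (snd x) * k (fst x) (snd x)) \<in> borel_measurable (?M1 \<Otimes>\<^sub>M ?M2)"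
    using km fm by (rule borel_measurable_times[rotated])
  have fin: "(\<integral>\<^sup>+ w. ennreal (norm (f w)) \<partial>?M2) < \<infinity>"
    using fi by (simp add: integrable_iff_bounded)
  have Fi: "integrable (?M1 \<Otimes>\<^sub>M ?M2) (\<lambda>x. f (snd x) * k (fst x) (snd x))"
  proof (rule integrableI_bounded[OF Fm])
    have "(\<integral>\<^sup>+ x. ennreal (norm (f (snd x) * k (fst x) (snd x))) \<partial>(?M1 \<Otimes>\<^sub>M ?M2))
        \<le> (\<integral>\<^sup>+ x. ennreal (norm (f (snd x))) \<partial>(?M1 \<Otimes>\<^sub>M ?M2))"
      using k by (intro nn_integral_mono ennreal_leI) (auto simp: abs_mult intro!: mult_left_le)
    also have "\<dots> = (\<integral>\<^sup>+ y. (\<integral>\<^sup>+ w. ennreal (norm (f w)) \<partial>?M2) \<partial>?M1)"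
      using fm by (subst M2.nn_integral_fst[symmetric]) auto
    also have "\<dots> = (\<integral>\<^sup>+ w. ennreal (norm (f w)) \<partial>?M2) * emeasure ?M1 (space ?M1)" by simp
    also have "\<dots> < \<infinity>" using fin M1.emeasure_finite[of "space ?M1"]
      unfolding infinity_ennreal_def ennreal_mult_less_top top.not_eq_extremum by blast
    finally show "(\<integral>\<^sup>+ x. ennreal (norm (f (snd x) * k (fst x) (snd x))) \<partial>(?M1 \<Otimes>\<^sub>M ?M2)) < \<infinity>" .
  qed
  have kc1: "continuous_on A (\<lambda>w. k y w)" for A y
  proof -
    have "continuous_on A (\<lambda>w. (y, w))" by (intro continuous_intros)
    from continuous_on_compose2[OF k(1) this] show ?thesis by simp
  qed
  have kc2: "continuous_on A (\<lambda>y. k y w)" for A w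
  proof -
    have "continuous_on A (\<lambda>y. (y, w))" by (intro continuous_intros)
    from continuous_on_compose2[OF k(1) this] show ?thesis by simp
  qed
  have i2: "integrable ?M2 (\<lambda>w. f w * k y w)" for y
  proof (rule Bochner_Integration.integrable_bound[OF fi])
    show "(\<lambda>w. f w * k y w) \<in> borel_measurable ?M2"
      using continuous_imp_measurable_on_sets_lebesgue[OF kc1 Ts, of y] by (intro borel_measurable_times) auto
    show "AE w in ?M2. norm (f w * k y w) \<le> norm (f w)"
      using k by (auto simp: abs_mult intro!: mult_left_le)
  qed
  have i1: "integrable ?M1 (\<lambda>y. k y w)" for w
  proof (rule Bochner_Integration.integrable_bound[of _ "\<lambda>_. 1::real"])
    show "(\<lambda>y. k y w) \<in> borel_measurable ?M1"
      by (intro continuous_imp_measurable_on_sets_lebesgue kc2 Ss)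
  qed (use k in auto)
  have e2: "(\<integral>w. f w * k y w \<partial>?M2) = integral T (\<lambda>w. f w * k y w)" for y
    by (rule lebesgue_integral_eq_integral[OF i2 Ts])
  have e1: "(\<integral>y. k y w \<partial>?M1) = integral S (\<lambda>y. k y w)" for w
    by (rule lebesgue_integral_eq_integral[OF i1 Ss])
  have iy: "integrable ?M1 (\<lambda>y. integral T (\<lambda>w. f w * k y w))"
    using P.integrable_fst'[OF Fi] by (simp add: e2)
  then show "(\<lambda>y. integral T (\<lambda>w. f w * k y w)) integrable_on S"
    using Ss by (rule integrable_on_lebesgue_on)
  have "integral S (\<lambda>y. integral T (\<lambda>w. f w * k y w)) = (\<integral>y. (\<integral>w. f w * k y w \<partial>?M2) \<partial>?M1)"
    using lebesgue_integral_eq_integral[OF iy Ss] by (simp add: e2)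
  also have "\<dots> = (\<integral>w. (\<integral>y. f w * k y w \<partial>?M1) \<partial>?M2)"
    using P.Fubini_integral[of "\<lambda>y w. f w * k y w"] Fi by (simp add: case_prod_beta')
  also have "\<dots> = (\<integral>w. f w * integral S (\<lambda>y. k y w) \<partial>?M2)" by (simp add: e1)
  also have "\<dots> \<le> (\<integral>w. f w * c \<partial>?M2)"
  proof (rule integral_mono_AE)
    show "integrable ?M2 (\<lambda>w. f w * integral S (\<lambda>y. k y w))"
      using P.integrable_snd[of "\<lambda>y w. f w * k y w"] Fi by (simp add: case_prod_beta' e1)
    show "integrable ?M2 (\<lambda>w. f w * c)" using fi by auto
    show "AE w in ?M2. f w * integral S (\<lambda>y. k y w) \<le> f w * c"
      using f(2) c Ts by (intro AE_I2 mult_left_mono) auto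
  qed
  also have "\<dots> = c * integral T f" using lebesgue_integral_eq_integral[OF fi Ts] by simp
  finally show "integral S (\<lambda>y. integral T (\<lambda>w. f w * k y w)) \<le> c * integral T f" .
qed

section \<open>Squares, strips around coordinate lines, and product mollifiers\<close>

text \<open>The closed \<open>infnorm\<close> ball, R being half the side. Its boundary consists of
  segments of coordinate lines, so a boundary point lies on a line to which the oscillation bound
  applies.\<close>

definition square :: "R2 \<Rightarrow> real \<Rightarrow> R2 set" where "square a R = cbox (a - R *\<^sub>R One) (a + R *\<^sub>R One)"

lemma mem_square: "x \<in> square a R \<longleftrightarrow> (\<forall>k\<in>Basis. \<bar>(x - a) \<bullet> k\<bar> \<le> R)"
  unfolding square_def mem_box by (auto simp: inner_diff_left inner_add_left abs_le_iff algebra_simps)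

lemma square_infnorm: "x \<in> square a R \<longleftrightarrow> infnorm (x - a) \<le> R"
  unfolding mem_square infnorm_Max by (subst Max_le_iff) auto

lemma square_compact: "compact (square a R)" by (simp add: square_def compact_cbox)

lemma square_lmeasurable: "square a R \<in> lmeasurable" by (simp add: lmeasurable_compact square_compact)

lemma Basis_other:
  fixes j :: R2
  assumes "j \<in> Basis"
  obtains i where "i \<in> Basis" "i \<noteq> j" "Basis = {i, j}" "i \<bullet> j = 0" "j \<bullet> i = 0"
proof -
  have "card (Basis :: R2 set) = 2" by simp
  then obtain x y where xy: "(Basis :: R2 set) = {x, y}" "x \<noteq> y" unfolding card_2_iff by blast
  have "\<exists>i. i \<in> Basis \<and> i \<noteq> j \<and> (Basis :: R2 set) = {i, j}"
  proof -
    have "j = x \<or> j = y" using assms unfolding xy(1) by simp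
    then show ?thesis
    proof
      assume "j = x" then show ?thesis using xy by (intro exI[of _ y]) (metis insertCI insert_commute)
    next
      assume "j = y" then show ?thesis using xy by (intro exI[of _ x]) (metis insertCI)
    qed
  qed
  then show ?thesis using that inner_not_same_Basis assms by metis
qed

text \<open>The bump is at most the indicator of a strip of width \<open>2 * \<epsilon>\<close>
  around a coordinate line, and the part of the strip in the square lies in a rectangle with sides
  \<open>2 * \<epsilon>\<close> and \<open>2 * R\<close>.\<close>

lemma slice_content:
  fixes a :: R2
  assumes j: "j \<in> Basis" and R: "R \<ge> 0" and \<epsilon>: "\<epsilon> > 0"
  shows "integral (square a R) (\<lambda>y. beta ((y \<bullet> j - s) / \<epsilon>)) \<le> 2 * \<epsilon> * (2 * R)"
proof -
  obtain i where i: "i \<in> Basis" "i \<noteq> j" "Basis = {i, j}" "i \<bullet> j = 0" "j \<bullet> i = 0" using Basis_other[OF j] .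
  define l u where "l = (a \<bullet> i - R) *\<^sub>R i + (s - \<epsilon>) *\<^sub>R j" and "u = (a \<bullet> i + R) *\<^sub>R i + (s + \<epsilon>) *\<^sub>R j"
  have lu: "l \<bullet> i = a \<bullet> i - R" "l \<bullet> j = s - \<epsilon>" "u \<bullet> i = a \<bullet> i + R" "u \<bullet> j = s + \<epsilon>"
    using i j by (auto simp: l_def u_def inner_add_left)
  have int: "(\<lambda>y. beta ((y \<bullet> j - s) / \<epsilon>)) integrable_on square a R" unfolding square_def
    by (intro integrable_continuous continuous_on_compose2[OF beta_continuous[of UNIV]]) (auto intro!: continuous_intros simp: \<epsilon>[THEN less_imp_neq, symmetric])
  have "integral (square a R) (\<lambda>y. beta ((y \<bullet> j - s) / \<epsilon>)) = integral UNIV (\<lambda>y. if y \<in> square a R then beta ((y \<bullet> j - s) / \<epsilon>) else 0)"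
    by (simp add: integral_restrict_UNIV)
  also have "\<dots> \<le> integral UNIV (indicator (cbox l u))"
  proof (rule integral_le)
    show "(\<lambda>y. if y \<in> square a R then beta ((y \<bullet> j - s) / \<epsilon>) else 0) integrable_on UNIV"
      using int by (simp add: integrable_restrict_UNIV)
    show "(indicator (cbox l u) :: R2 \<Rightarrow> real) integrable_on UNIV"
      by (simp add: integrable_on_indicator)
    fix y
    show "(if y \<in> square a R then beta ((y \<bullet> j - s) / \<epsilon>) else 0) \<le> (indicator (cbox l u) y :: real)"
    proof (cases "y \<in> square a R \<and> \<bar>(y \<bullet> j - s) / \<epsilon>\<bar> < 1")
      case True
      then have "\<bar>y \<bullet> j - s\<bar> < \<epsilon>" using \<epsilon> by (simp add: abs_divide divide_less_eq)
      moreover have "\<bar>y \<bullet> i - a \<bullet> i\<bar> \<le> R" using True i(1) by (auto simp: mem_square inner_diff_left)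
      ultimately have "y \<in> cbox l u" unfolding mem_box i(3) using lu by auto
      then show ?thesis using beta_le1 by auto
    next
      case False
      then have "y \<notin> square a R \<or> beta ((y \<bullet> j - s) / \<epsilon>) = 0" using beta_zero by (meson not_less)
      then show ?thesis by auto
    qed
  qed
  also have "\<dots> = measure lborel (cbox l u)" by (simp add: integral_indicator)
  also have "\<dots> = (\<Prod>k\<in>Basis. (u - l) \<bullet> k)"
  proof -
    have "l \<bullet> k \<le> u \<bullet> k" if "k \<in> Basis" for k using that lu R \<epsilon> unfolding i(3) by auto
    then show ?thesis by (simp add: content_cbox inner_diff_left)
  qed
  also have "\<dots> = 2 * \<epsilon> * (2 * R)" unfolding i(3) using i(2) lu by (simp add: inner_diff_left)
  finally show ?thesis .
qed

text \<open>The sign \<sigma> selects one of two opposite sides of a square: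
  \<open>c + \<sigma> * s\<close> moves at unit speed and stays \<epsilon>-close to w during a time
  of at most \<open>2 * \<epsilon>\<close>.\<close>

lemma slice_length:
  assumes \<epsilon>: "\<epsilon> > 0" and \<sigma>: "\<bar>\<sigma>\<bar> = 1"
  shows "integral {0..R} (\<lambda>s. beta ((w - (c + \<sigma> * s)) / \<epsilon>)) \<le> 2 * \<epsilon>"
proof -
  \<comment> \<open>The parameter with \<open>c + \<sigma> * m = w\<close>, because \<sigma> is its
    own inverse.\<close>
  define m where "m = \<sigma> * (w - c)"
  have \<sigma>2: "\<sigma> * \<sigma> = 1" using \<sigma> by (auto simp: abs_if split: if_splits)
  have int: "(\<lambda>s. beta ((w - (c + \<sigma> * s)) / \<epsilon>)) integrable_on {0..R}"
    by (intro integrable_continuous_real continuous_on_compose2[OF beta_continuous[of UNIV]]) (auto intro!: continuous_intros simp: \<epsilon>[THEN less_imp_neq, symmetric])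
  have "integral {0..R} (\<lambda>s. beta ((w - (c + \<sigma> * s)) / \<epsilon>)) = integral UNIV (\<lambda>s. if s \<in> {0..R} then beta ((w - (c + \<sigma> * s)) / \<epsilon>) else 0)"
    by (simp only: integral_restrict_UNIV)
  also have "\<dots> \<le> integral UNIV (indicator {m - \<epsilon>..m + \<epsilon>})"
  proof (rule integral_le)
    show "(\<lambda>s. if s \<in> {0..R} then beta ((w - (c + \<sigma> * s)) / \<epsilon>) else 0) integrable_on UNIV"
      using int by (simp only: integrable_restrict_UNIV)
    show "(indicator {m - \<epsilon>..m + \<epsilon>} :: real \<Rightarrow> real) integrable_on UNIV"
      using integrable_on_indicator[of "cbox (m-\<epsilon>) (m+\<epsilon>)" UNIV] by simp
    fix s
    show "(if s \<in> {0..R} then beta ((w - (c + \<sigma> * s)) / \<epsilon>) else 0) \<le> (indicator {m - \<epsilon>..m + \<epsilon>} s :: real)"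
    proof (cases "\<bar>(w - (c + \<sigma> * s)) / \<epsilon>\<bar> < 1")
      case True
      then have "\<bar>w - (c + \<sigma> * s)\<bar> < \<epsilon>" using \<epsilon> by (simp add: abs_divide divide_less_eq)
      then have "\<bar>\<sigma>\<bar> * \<bar>w - (c + \<sigma> * s)\<bar> < \<epsilon>" using \<sigma> by simp
      moreover have "\<bar>\<sigma>\<bar> * \<bar>w - (c + \<sigma> * s)\<bar> = \<bar>m - s\<bar>"
      proof -
        have "\<sigma> * (w - (c + \<sigma> * s)) = m - (\<sigma> * \<sigma>) * s" by (simp add: m_def algebra_simps)
        then show ?thesis using \<sigma>2 by (simp add: abs_mult[symmetric])
      qed
      ultimately have "s \<in> {m - \<epsilon>..m + \<epsilon>}" by auto
      then show ?thesis using beta_le1 by auto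
    next
      case False
      then have "beta ((w - (c + \<sigma> * s)) / \<epsilon>) = 0" using beta_zero by (meson not_less)
      then show ?thesis by auto
    qed
  qed
  also have "\<dots> = 2 * \<epsilon>" using integral_indicator[of "cbox (m-\<epsilon>) (m+\<epsilon>)" UNIV] \<epsilon> by simp
  finally show ?thesis .
qed

text \<open>Left unnormalised; the total mass is divided out at the end. The product form separates
  the direction along a line from the direction across it.\<close>

definition mollifier :: "real \<Rightarrow> R2 \<Rightarrow> R2 \<Rightarrow> real" where
  "mollifier \<epsilon> p y = (\<Prod>k\<in>Basis. beta ((y \<bullet> k - p \<bullet> k) / \<epsilon>))"

lemma mollifier_nonneg: "0 \<le> mollifier \<epsilon> p y"
  unfolding mollifier_def by (intro prod_nonneg) (auto simp: beta_nonneg)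

lemma beta_comp_continuous: "\<epsilon> > 0 \<Longrightarrow> continuous_on S (\<lambda>y::R2. beta ((y \<bullet> k - s) / \<epsilon>))"
  by (intro continuous_on_compose2[OF beta_continuous[of UNIV]]) (auto intro!: continuous_intros)

lemma mollifier_continuous: "\<epsilon> > 0 \<Longrightarrow> continuous_on S (mollifier \<epsilon> p)"
  unfolding mollifier_def by (intro continuous_on_prod beta_comp_continuous)

lemma mollifier_zero:
  assumes "\<epsilon> > 0" "mollifier \<epsilon> p y \<noteq> 0"
  shows "infnorm (y - p) \<le> \<epsilon>"
proof -
  have "y \<in> square p \<epsilon>" unfolding mem_square
  proof
    fix k :: R2 assume k: "k \<in> Basis"
    have "beta ((y \<bullet> k - p \<bullet> k) / \<epsilon>) \<noteq> 0" using assms(2) k unfolding mollifier_def by (auto simp: prod_zero_iff)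
    then have "\<bar>(y \<bullet> k - p \<bullet> k) / \<epsilon>\<bar> < 1" using beta_zero by (meson not_less)
    then show "\<bar>(y - p) \<bullet> k\<bar> \<le> \<epsilon>" using assms(1) by (simp add: abs_divide divide_less_eq inner_diff_left)
  qed
  then show ?thesis by (simp add: square_infnorm)
qed

lemma square_mono: "infnorm (p - a) + r \<le> R \<Longrightarrow> square p r \<subseteq> square a R"
proof
  fix x assume h: "infnorm (p - a) + r \<le> R" and x: "x \<in> square p r"
  have "infnorm (x - a) \<le> infnorm (x - p) + infnorm (p - a)" using infnorm_triangle[of "x - p" "p - a"] by simp
  then show "x \<in> square a R" using h x by (simp add: square_infnorm)
qed

text \<open>On the concentric square of half the size both factors are at least 1/2, and that square
  has area \<open>\<epsilon>^2\<close>.\<close>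

lemma mollifier_integral_lower:
  assumes \<epsilon>: "\<epsilon> > 0" and p: "square p (\<epsilon>/2) \<subseteq> square a R"
  shows "\<epsilon>^2 / 4 \<le> integral (square a R) (mollifier \<epsilon> p)"
proof -
  have "\<epsilon>^2 / 4 = integral (square p (\<epsilon>/2)) (\<lambda>y. 1/4)"
    using content_square[of "\<epsilon>/2" p] \<epsilon> by (simp add: square_def power_divide)
  also have "\<dots> \<le> integral (square p (\<epsilon>/2)) (mollifier \<epsilon> p)"
  proof (rule integral_le)
    show "(mollifier \<epsilon> p) integrable_on square p (\<epsilon>/2)" unfolding square_def by (intro integrable_continuous mollifier_continuous \<epsilon>)
    show "(\<lambda>y. 1/4::real) integrable_on square p (\<epsilon>/2)" unfolding square_def by auto
    fix y assume y: "y \<in> square p (\<epsilon>/2)"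
    have "(\<Prod>k\<in>(Basis::R2 set). 1/2::real) \<le> mollifier \<epsilon> p y" unfolding mollifier_def
    proof (rule prod_mono, intro conjI)
      fix k :: R2 assume k: "k \<in> Basis"
      have "\<bar>(y \<bullet> k - p \<bullet> k) / \<epsilon>\<bar> \<le> 1/2" using y k \<epsilon> by (auto simp: mem_square inner_diff_left abs_divide divide_le_eq)
      then show "1/2 \<le> beta ((y \<bullet> k - p \<bullet> k) / \<epsilon>)" by (rule beta_ge_half)
    qed auto
    then show "1/4 \<le> mollifier \<epsilon> p y" by (simp add: power2_eq_square)
  qed
  also have "\<dots> \<le> integral (square a R) (mollifier \<epsilon> p)"
    by (rule integral_subset_le[OF p]) (auto simp: square_def mollifier_nonneg intro!: integrable_continuous mollifier_continuous \<epsilon>)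
  finally show ?thesis .
qed

lemma integral_abs_le:
  fixes f g :: "'a::euclidean_space \<Rightarrow> real"
  assumes "f integrable_on S" "g integrable_on S" "\<And>x. x \<in> S \<Longrightarrow> \<bar>f x\<bar> \<le> g x"
  shows "\<bar>integral S f\<bar> \<le> integral S g"
  using integral_norm_bound_integral[of f S g] assms by simp

text \<open>Recovers Cauchy-Schwarz for weighted integrals from its arithmetic-geometric form with a
  free weight l; the choice \<open>l = Y / t\<close> is the one that is used.\<close>

lemma sq_le_prodI:
  fixes t X Y :: real
  assumes "Y > 0" "t \<ge> 0" "\<And>l. l > 0 \<Longrightarrow> t \<le> l / 2 * X + Y / (2 * l)" "X \<ge> 0"
  shows "t^2 \<le> X * Y"
proof (cases "t = 0")
  case False
  then have t: "t > 0" using assms by simp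
  have "t \<le> (Y / t) / 2 * X + Y / (2 * (Y / t))" by (rule assms(3)) (use t assms in auto)
  then have "t \<le> X * Y / (2 * t) + t / 2" using t assms(1) by (simp add: field_simps)
  then show ?thesis using t by (simp add: field_simps power2_eq_square)
qed (use assms in auto)

text \<open>Since p and q share the j-coordinate, the difference of their mollifiers is a bump in
  direction j times a difference of bumps in direction i. The latter is the derivative of a
  difference of two primitives, which cancels away from both points and so leaves compact
  support.\<close>

lemma line_test_function:
  assumes \<epsilon>: "0 < \<epsilon>" "\<epsilon> \<le> R" and ij: "i \<in> Basis" "j \<in> Basis" "i \<noteq> j" "(Basis :: R2 set) = {i, j}" "i \<bullet> j = 0" "j \<bullet> i = 0"
    and pq: "p \<in> square a R" "q \<in> square a R" "p \<bullet> j = q \<bullet> j"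
  obtains \<Phi> G where "c1 \<Phi> G" "\<And>y. y \<notin> square a (2*R) \<Longrightarrow> \<Phi> y = 0" "\<And>y. G y \<bullet> i = mollifier \<epsilon> q y - mollifier \<epsilon> p y"
    "\<And>y. \<bar>\<Phi> y\<bar> \<le> 2 * \<epsilon> * beta ((y \<bullet> j - p \<bullet> j) / \<epsilon>)"
proof -
  define L where "L k s y = (1/\<epsilon>) * (y \<bullet> k) - s / \<epsilon>" for k s and y :: R2
  have Lc: "c1 (L k s) (\<lambda>y. (1/\<epsilon>) *\<^sub>R k - 0)" for k s
    unfolding L_def by (intro c1_diff c1_cmult c1_inner c1_const)
  have Leq: "L k s y = (y \<bullet> k - s) / \<epsilon>" for k s y by (simp add: L_def diff_divide_distrib)
  define bj where "bj y = beta (L j (p \<bullet> j) y)" for y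
  define Bj where "Bj y = (-4 * L j (p \<bullet> j) y * max 0 (1 - (L j (p \<bullet> j) y)^2)) *\<^sub>R ((1/\<epsilon>) *\<^sub>R j - 0)" for y
  have b: "c1 bj Bj" unfolding bj_def Bj_def
    by (rule c1_compose[OF Lc beta_deriv]) (intro continuous_intros)
  have t: "c1 (\<lambda>y. bump_primitive (L i s y)) (\<lambda>y. beta (L i s y) *\<^sub>R ((1/\<epsilon>) *\<^sub>R i - 0))" for s
    by (rule c1_compose[OF Lc bump_primitive_deriv beta_continuous])
  define d where "d y = \<epsilon> * (bump_primitive (L i (q \<bullet> i) y) - bump_primitive (L i (p \<bullet> i) y))" for y
  define D where "D y = \<epsilon> *\<^sub>R (beta (L i (q \<bullet> i) y) *\<^sub>R ((1/\<epsilon>) *\<^sub>R i - 0) - beta (L i (p \<bullet> i) y) *\<^sub>R ((1/\<epsilon>) *\<^sub>R i - 0))" for y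
  have dD: "c1 d D" unfolding d_def D_def by (intro c1_cmult c1_diff t)
  show ?thesis
  proof (rule that[OF c1_mult[OF b dD]])
    have prod: "mollifier \<epsilon> z y = beta (L i (z \<bullet> i) y) * beta (L j (z \<bullet> j) y)" for z y
      unfolding mollifier_def ij(4) Leq using ij(3) by simp
    show "(bj y *\<^sub>R D y + d y *\<^sub>R Bj y) \<bullet> i = mollifier \<epsilon> q y - mollifier \<epsilon> p y" for y
      unfolding prod D_def Bj_def bj_def using ij pq(3) \<epsilon>
      by (simp add: inner_add_left inner_diff_left algebra_simps)
    show "\<bar>bj y * d y\<bar> \<le> 2 * \<epsilon> * beta ((y \<bullet> j - p \<bullet> j) / \<epsilon>)" for y
    proof -
      have "\<bar>bump_primitive (L i (q \<bullet> i) y) - bump_primitive (L i (p \<bullet> i) y)\<bar> \<le> 2"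
        using bump_primitive_nonneg[of "L i (q \<bullet> i) y"] bump_primitive_nonneg[of "L i (p \<bullet> i) y"] bump_primitive_le2[of "L i (q \<bullet> i) y"] bump_primitive_le2[of "L i (p \<bullet> i) y"]
        by (simp add: abs_le_iff)
      then have "\<bar>d y\<bar> \<le> 2 * \<epsilon>" using \<epsilon>(1) unfolding d_def by (simp add: abs_mult)
      then have "bj y * \<bar>d y\<bar> \<le> bj y * (2 * \<epsilon>)" by (intro mult_left_mono) (auto simp: bj_def beta_nonneg)
      then show ?thesis using beta_nonneg[of "L j (p \<bullet> j) y"] by (simp add: abs_mult bj_def Leq mult.commute)
    qed
    show "bj y * d y = 0" if y: "y \<notin> square a (2*R)" for y
    proof -
      obtain k where k: "k \<in> Basis" "\<bar>(y - a) \<bullet> k\<bar> > 2 * R" using y by (auto simp: mem_square not_le)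
      have P: "\<bar>(p - a) \<bullet> k\<bar> \<le> R" "\<bar>(q - a) \<bullet> k\<bar> \<le> R" using pq k by (auto simp: mem_square)
      \<comment> \<open>Outside the doubled square some coordinate of y is at least \<epsilon> away
        from those of p and q, on the same side of both. In direction i the primitives then agree,
        in direction j the bump vanishes.\<close>
      have far: "(y \<bullet> k - p \<bullet> k \<ge> \<epsilon> \<and> y \<bullet> k - q \<bullet> k \<ge> \<epsilon>) \<or> (y \<bullet> k - p \<bullet> k \<le> - \<epsilon> \<and> y \<bullet> k - q \<bullet> k \<le> - \<epsilon>)"
        using k(2) P \<epsilon>(2) unfolding inner_diff_left by linarith
      have LL: "(L k (p \<bullet> k) y \<ge> 1 \<and> L k (q \<bullet> k) y \<ge> 1) \<or> (L k (p \<bullet> k) y \<le> -1 \<and> L k (q \<bullet> k) y \<le> -1)"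
        using far \<epsilon>(1) unfolding Leq by (auto simp: le_divide_eq divide_le_eq)
      have "k = i \<or> k = j" using k(1) ij(4) by auto
      then show ?thesis
      proof
        assume "k = i"
        then have "bump_primitive (L i (q \<bullet> i) y) = bump_primitive (L i (p \<bullet> i) y)" using LL bump_primitive_right bump_primitive_left by metis
        then show ?thesis by (simp add: d_def)
      next
        assume "k = j"
        then have "bj y = 0" unfolding bj_def using LL by (intro beta_zero) auto
        then show ?thesis by simp
      qed
    qed
  qed
qed

text \<open>The energy of a strip divided by its width, up to a constant that comes from
  \<open>line_oscillation\<close>: 16 from the mass of the strip weight, 16 from squaring the lower
  bound \<open>\<epsilon>^2 / 4\<close> of the mollifier mass, 2 from splitting the square of a sum,
  and 2 from the bound \<open>2 * \<epsilon>\<close> on the test function.\<close>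

definition line_energy :: "real \<Rightarrow> R2 \<Rightarrow> real \<Rightarrow> (R2 \<Rightarrow> R2) \<Rightarrow> R2 \<Rightarrow> real \<Rightarrow> real" where
  "line_energy \<epsilon> a R g j s = (1024 * R / \<epsilon>) * integral (square a (2*R)) (\<lambda>y. norm (g y) ^ 2 * beta ((y \<bullet> j - s) / \<epsilon>))"

lemma sobolev_integrable_sq:
  assumes "sobolev \<Omega> v g" "square a R \<subseteq> \<Omega>"
  shows "(\<lambda>y. norm (g y) ^ 2) integrable_on square a R" "integral (square a R) (\<lambda>y. norm (g y) ^ 2) \<le> energy \<Omega> g"
proof -
  have i: "(\<lambda>y. norm (g y) ^ 2) integrable_on \<Omega>" using assms by (simp add: sobolev_def)
  then show 1: "(\<lambda>y. norm (g y) ^ 2) integrable_on square a R"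
  proof -
    have "(\<lambda>y. norm (g y) ^ 2) absolutely_integrable_on \<Omega>"
      using i by (rule nonnegative_absolutely_integrable_1) simp
    then have "(\<lambda>y. norm (g y) ^ 2) absolutely_integrable_on square a R"
      by (rule set_integrable_subset) (use assms(2) square_lmeasurable fmeasurableD in auto)
    then show ?thesis by (simp add: absolutely_integrable_on_def)
  qed
  show "integral (square a R) (\<lambda>y. norm (g y) ^ 2) \<le> energy \<Omega> g"
    unfolding energy_def by (rule integral_subset_le[OF assms(2) 1 i]) auto
qed

lemma integrable_mult_continuous:
  fixes f :: "R2 \<Rightarrow> real"
  assumes "f absolutely_integrable_on K" "compact K" "continuous_on K h"
  shows "(\<lambda>x. f x * h x) absolutely_integrable_on K"
proof -
  have "(\<lambda>x. h x * f x) absolutely_integrable_on K"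
    by (intro absolutely_integrable_bounded_measurable_product[of "(*)"])
      (use assms in \<open>auto intro!: bilinear_times continuous_imp_measurable_on_sets_lebesgue
        compact_imp_bounded compact_continuous_image lmeasurable_compact fmeasurableD\<close>)
  then show ?thesis by (simp add: mult.commute)
qed

text \<open>Each mollified average is within \<eta> of the value at its centre, and the two averages
  differ by the pairing of g with the strip test function. Cauchy-Schwarz bounds that pairing by the
  strip energy times the mass of the strip weight.\<close>

lemma line_oscillation:
  assumes s: "sobolev \<Omega> v g" and a: "square a (2*R) \<subseteq> \<Omega>" and \<epsilon>: "0 < \<epsilon>" "\<epsilon> \<le> R"
    and osc: "\<And>x y. x \<in> square a (2*R) \<Longrightarrow> y \<in> square a (2*R) \<Longrightarrow> infnorm (x - y) \<le> \<epsilon> \<Longrightarrow> \<bar>v x - v y\<bar> \<le> \<eta>"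
    and j: "j \<in> Basis" and pq: "p \<in> square a R" "q \<in> square a R" "p \<bullet> j = q \<bullet> j"
  shows "(v p - v q)^2 \<le> 8 * \<eta>^2 + line_energy \<epsilon> a R g j (p \<bullet> j)"
proof -
  obtain i where i: "i \<in> Basis" "i \<noteq> j" "Basis = {i, j}" "i \<bullet> j = 0" "j \<bullet> i = 0" using Basis_other[OF j] .
  let ?K = "square a (2*R)"
  have R: "R > 0" using \<epsilon> by simp
  have K: "compact ?K" by (rule square_compact)
  have sub: "square a R \<subseteq> ?K" using R by (intro square_mono) (simp add: infnorm_0)
  obtain \<Phi> G where \<Phi>: "c1 \<Phi> G" "\<And>y. y \<notin> ?K \<Longrightarrow> \<Phi> y = 0" "\<And>y. G y \<bullet> i = mollifier \<epsilon> q y - mollifier \<epsilon> p y"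
    "\<And>y. \<bar>\<Phi> y\<bar> \<le> 2 * \<epsilon> * beta ((y \<bullet> j - p \<bullet> j) / \<epsilon>)"
    using line_test_function[OF \<epsilon> i(1) j i(2-5) pq] by metis
  have w: "weak_gradient \<Omega> v g" and vc: "continuous_on \<Omega> v" using s by (auto simp: sobolev_def)
  have vK: "continuous_on ?K v" using vc a continuous_on_subset by blast
  have mi: "(mollifier \<epsilon> z) integrable_on ?K" for z unfolding square_def by (intro integrable_continuous mollifier_continuous \<epsilon>)
  have vmi: "(\<lambda>y. v y * mollifier \<epsilon> z y) integrable_on ?K" for z
    using vK unfolding square_def by (intro integrable_continuous continuous_intros mollifier_continuous \<epsilon>)
  define A where "A z = integral ?K (\<lambda>y. v y * mollifier \<epsilon> z y)" for z
  define I where "I z = integral ?K (mollifier \<epsilon> z)" for z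
  have Aeq: "A q - A p = - integral ?K (\<lambda>y. (g y \<bullet> i) * \<Phi> y)"
    using weak_gradientD[OF w \<Phi>(1) K a \<Phi>(2) i(1)] vmi unfolding A_def \<Phi>(3)
    by (simp add: right_diff_distrib integral_diff)
  \<comment> \<open>Testing the constant 1, whose weak gradient is 0, with the same \<Phi> shows
    that the two mollifiers have equal mass.\<close>
  have Ieq: "I q = I p"
    using weak_gradientD[OF weak_gradient_const[of \<Omega> 1] \<Phi>(1) K a \<Phi>(2) i(1)] mi unfolding I_def \<Phi>(3)
    by (simp add: integral_diff)
  have Ilow: "I z \<ge> \<epsilon>^2 / 4" if "z \<in> square a R" for z
    unfolding I_def using that \<epsilon> by (intro mollifier_integral_lower square_mono) (auto simp: square_infnorm)
  have Ap: "\<bar>A z - v z * I z\<bar> \<le> \<eta> * I z" if z: "z \<in> square a R" for z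
  proof -
    have "A z - v z * I z = integral ?K (\<lambda>y. v y * mollifier \<epsilon> z y - v z * mollifier \<epsilon> z y)"
      unfolding A_def I_def using vmi mi by (subst integral_diff) (auto intro: integrable_on_mult_right)
    also have "\<bar>\<dots>\<bar> \<le> integral ?K (\<lambda>y. \<eta> * mollifier \<epsilon> z y)"
    proof (rule integral_abs_le)
      show "(\<lambda>y. v y * mollifier \<epsilon> z y - v z * mollifier \<epsilon> z y) integrable_on ?K"
        using vmi mi by (intro integrable_diff integrable_on_mult_right)
      show "(\<lambda>y. \<eta> * mollifier \<epsilon> z y) integrable_on ?K" using mi by (intro integrable_on_mult_right)
      fix y assume y: "y \<in> ?K"
      show "\<bar>v y * mollifier \<epsilon> z y - v z * mollifier \<epsilon> z y\<bar> \<le> \<eta> * mollifier \<epsilon> z y"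
      proof (cases "mollifier \<epsilon> z y = 0")
        case False
        then have "\<bar>v y - v z\<bar> \<le> \<eta>" using osc[OF y, of z] mollifier_zero[OF \<epsilon>(1) False] z sub by auto
        then have "\<bar>v y - v z\<bar> * mollifier \<epsilon> z y \<le> \<eta> * mollifier \<epsilon> z y" by (intro mult_right_mono mollifier_nonneg)
        then show ?thesis using mollifier_nonneg[of \<epsilon> z y] by (simp add: left_diff_distrib[symmetric] abs_mult)
      qed simp
    qed
    finally show ?thesis by (simp add: I_def)
  qed
  define W where "W y = 2 * \<epsilon> * beta ((y \<bullet> j - p \<bullet> j) / \<epsilon>)" for y
  have Wc: "continuous_on ?K W" unfolding W_def by (intro continuous_intros beta_comp_continuous \<epsilon>)
  have W0: "W y \<ge> 0" for y using \<epsilon>(1) beta_nonneg by (simp add: W_def)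
  have g2a: "(\<lambda>y. norm (g y) ^ 2) absolutely_integrable_on ?K"
    using sobolev_integrable_sq(1)[OF s a] by (intro nonnegative_absolutely_integrable_1) auto
  have g2W: "(\<lambda>y. norm (g y) ^ 2 * W y) integrable_on ?K"
    using integrable_mult_continuous[OF g2a K Wc] by (simp add: absolutely_integrable_on_def)
  have Wi: "W integrable_on ?K" using Wc unfolding square_def by (rule integrable_continuous)
  define X where "X = integral ?K (\<lambda>y. norm (g y) ^ 2 * W y)"
  \<comment> \<open>The factor \<open>2 * \<epsilon>\<close> of the weight times the strip mass
    \<open>2 * \<epsilon> * (4 * R)\<close> in the square of half side \<open>2 * R\<close>.\<close>
  define Y where "Y = 16 * R * \<epsilon>^2"
  have WY: "integral ?K W \<le> Y"
  proof -
    have "integral ?K W = 2 * \<epsilon> * integral ?K (\<lambda>y. beta ((y \<bullet> j - p \<bullet> j) / \<epsilon>))" unfolding W_def by simp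
    also have "\<dots> \<le> 2 * \<epsilon> * (2 * \<epsilon> * (2 * (2 * R)))"
      using \<epsilon> R by (intro mult_left_mono slice_content j) auto
    finally show ?thesis by (simp add: Y_def power2_eq_square ac_simps)
  qed
  have gw: "g absolutely_integrable_on ?K" using w K a by (auto simp: weak_gradient_def)
  have giP: "(\<lambda>y. (g y \<bullet> i) * \<Phi> y) integrable_on ?K"
    using abs_integrable_inner_mult[OF gw K c1_continuous[OF \<Phi>(1)]] by (simp add: absolutely_integrable_on_def)
  have tb: "\<bar>A q - A p\<bar>^2 \<le> X * Y"
  proof (rule sq_le_prodI)
    show "Y > 0" using R \<epsilon> by (simp add: Y_def)
    show "X \<ge> 0" unfolding X_def using g2W W0 by (intro integral_nonneg) auto
    fix l :: real assume l: "l > 0"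
    have "\<bar>A q - A p\<bar> = \<bar>integral ?K (\<lambda>y. (g y \<bullet> i) * \<Phi> y)\<bar>" unfolding Aeq by simp
    also have "\<dots> \<le> integral ?K (\<lambda>y. l / 2 * (norm (g y) ^ 2 * W y) + 1 / (2 * l) * W y)"
    proof (rule integral_abs_le[OF giP])
      show "(\<lambda>y. l / 2 * (norm (g y) ^ 2 * W y) + 1 / (2 * l) * W y) integrable_on ?K"
        using g2W Wi by (intro integrable_add integrable_on_mult_right)
      fix y
      have "0 \<le> (l * norm (g y) - 1)^2" by simp
      then have "2 * l * norm (g y) \<le> l^2 * norm (g y) ^ 2 + 1" by (simp add: power2_diff power_mult_distrib)
      then have n: "norm (g y) \<le> l / 2 * norm (g y) ^ 2 + 1 / (2 * l)"
        using l by (simp add: field_simps power2_eq_square)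
      have "\<bar>(g y \<bullet> i) * \<Phi> y\<bar> \<le> norm (g y) * W y"
        unfolding abs_mult using Basis_le_norm[OF i(1), of "g y"] \<Phi>(4)[of y] unfolding W_def[symmetric]
        by (intro mult_mono) auto
      also have "\<dots> \<le> (l / 2 * norm (g y) ^ 2 + 1 / (2 * l)) * W y" by (intro mult_right_mono n W0)
      finally show "\<bar>(g y \<bullet> i) * \<Phi> y\<bar> \<le> l / 2 * (norm (g y) ^ 2 * W y) + 1 / (2 * l) * W y"
        by (simp add: distrib_right mult.assoc)
    qed
    also have "\<dots> = l / 2 * X + 1 / (2 * l) * integral ?K W"
      unfolding X_def using g2W Wi integrable_on_mult_right[OF Wi, of "1 / (2 * l)"]
      by (subst integral_add) (auto intro!: integrable_on_mult_right)
    also have "\<dots> \<le> l / 2 * X + 1 / (2 * l) * Y" using WY l by (intro add_left_mono mult_left_mono) auto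
    finally show "\<bar>A q - A p\<bar> \<le> l / 2 * X + Y / (2 * l)" by simp
  qed auto
  have Xeq: "(512 * R / \<epsilon>^2) * X = line_energy \<epsilon> a R g j (p \<bullet> j)"
  proof -
    have "(\<lambda>y. norm (g y) ^ 2 * W y) = (\<lambda>y. 2 * \<epsilon> * (norm (g y) ^ 2 * beta ((y \<bullet> j - p \<bullet> j) / \<epsilon>)))"
      by (auto simp: W_def)
    then have "X = 2 * \<epsilon> * integral ?K (\<lambda>y. norm (g y) ^ 2 * beta ((y \<bullet> j - p \<bullet> j) / \<epsilon>))"
      unfolding X_def by simp
    then show ?thesis unfolding line_energy_def using \<epsilon> by (simp add: power2_eq_square)
  qed
  define J where "J = I p"
  have "\<epsilon>^2 / 4 > 0" using \<epsilon> by simp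
  then have J: "J \<ge> \<epsilon>^2 / 4" "J > 0" using Ilow[OF pq(1)] unfolding J_def by linarith+
  have "\<bar>v p - v q\<bar> * J \<le> \<bar>A q - A p\<bar> + 2 * \<eta> * J"
  proof -
    have "\<bar>v p - v q\<bar> * J = \<bar>v p * J - v q * J\<bar>" using J(2) by (simp add: left_diff_distrib[symmetric] abs_mult)
    also have "\<dots> \<le> \<bar>A q - A p\<bar> + 2 * \<eta> * J"
      using Ap[OF pq(1)] Ap[OF pq(2)] unfolding Ieq J_def[symmetric] by linarith
    finally show ?thesis .
  qed
  then have "\<bar>v p - v q\<bar> \<le> \<bar>A q - A p\<bar> / J + 2 * \<eta>" using J by (simp add: field_simps)
  then have "\<bar>v p - v q\<bar>^2 \<le> (\<bar>A q - A p\<bar> / J + 2 * \<eta>)^2" by (intro power_mono) auto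
  also have "\<dots> \<le> 2 * (\<bar>A q - A p\<bar> / J)^2 + 2 * (2 * \<eta>)^2" by (smt (verit) sum_squares_bound power2_sum)
  also have "(\<bar>A q - A p\<bar> / J)^2 = \<bar>A q - A p\<bar>^2 / J^2" by (simp add: power_divide)
  also have "\<bar>A q - A p\<bar>^2 / J^2 \<le> X * Y / (\<epsilon>^2 / 4)^2"
    using tb J \<epsilon> order_trans[OF zero_le_power2 tb] by (intro frac_le power_mono) auto
  also have "X * Y / (\<epsilon>^2 / 4)^2 = (256 * R / \<epsilon>^2) * X" using \<epsilon> by (simp add: Y_def field_simps power2_eq_square)
  finally show ?thesis using Xeq by (simp add: power_mult_distrib)
qed

section \<open>Poincare inequalities\<close>

lemma square_subset_cball: "R \<ge> 0 \<Longrightarrow> square a R \<subseteq> cball a (2 * R)"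
proof
  fix x assume R: "R \<ge> 0" and x: "x \<in> square a R"
  have "norm (x - a) \<le> sqrt (DIM(R2)) * infnorm (x - a)" by (rule norm_le_infnorm)
  also have "\<dots> \<le> 2 * R" using x R by (intro mult_mono) (auto simp: square_infnorm infnorm_pos_le real_sqrt_le_iff intro: real_le_lsqrt)
  finally show "x \<in> cball a (2 * R)" by (simp add: dist_norm norm_minus_commute)
qed

lemma cball_subset_square: "cball a R \<subseteq> square a R"
  using infnorm_le_norm order_trans by (fastforce simp: square_infnorm dist_norm norm_minus_commute)

lemma square_subset_open:
  assumes "open U" "x \<in> U"
  obtains R where "R > 0" "square x R \<subseteq> U"
proof -
  obtain e where e: "e > 0" "cball x e \<subseteq> U" using assms open_contains_cball by blast
  then show ?thesis using square_subset_cball[of "e/2" x] by (intro that[of "e/2"]) auto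
qed

text \<open>Hides the mollification scale: \<delta> fixes \<epsilon> by uniform continuity, and
  \<open>H\<close> is the resulting strip energy. Integration over parallel lines produces a factor
  \<epsilon> that cancels the one in \<open>line_energy\<close>, so only the total energy remains.
  The integrals over \<open>{0..R}\<close> are for lines carrying sides of concentric squares, those
  over the square for lines through a variable point.\<close>

lemma line_control:
  assumes R: "R > 0" and a: "square a (2*R) \<subseteq> \<Omega>" and s: "sobolev \<Omega> v g" and \<delta>: "\<delta> > 0"
  obtains H :: "R2 \<Rightarrow> real \<Rightarrow> real" where
    "\<And>j s. 0 \<le> H j s"
    "\<And>j p q. j \<in> Basis \<Longrightarrow> p \<in> square a R \<Longrightarrow> q \<in> square a R \<Longrightarrow> p \<bullet> j = q \<bullet> j \<Longrightarrow> (v p - v q)^2 \<le> \<delta> + H j (p \<bullet> j)"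
    "\<And>j \<sigma>. j \<in> Basis \<Longrightarrow> \<bar>\<sigma>\<bar> = 1 \<Longrightarrow> (\<lambda>s. H j (a \<bullet> j + \<sigma> * s)) integrable_on {0..R}"
    "\<And>j \<sigma>. j \<in> Basis \<Longrightarrow> \<bar>\<sigma>\<bar> = 1 \<Longrightarrow> integral {0..R} (\<lambda>s. H j (a \<bullet> j + \<sigma> * s)) \<le> 2048 * R * energy \<Omega> g"
    "\<And>j. j \<in> Basis \<Longrightarrow> (\<lambda>p. H j (p \<bullet> j)) integrable_on square a R"
    "\<And>j. j \<in> Basis \<Longrightarrow> integral (square a R) (\<lambda>p. H j (p \<bullet> j)) \<le> 4096 * R^2 * energy \<Omega> g"
proof -
  let ?K = "square a (2*R)"
  \<comment> \<open>Makes the averaging error \<open>8 * \<eta>^2\<close> equal to \<delta>.\<close>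
  define \<eta> where "\<eta> = sqrt (\<delta>/8)"
  have \<eta>: "\<eta> > 0" "8 * \<eta>^2 = \<delta>" using \<delta> by (auto simp: \<eta>_def)
  have "continuous_on ?K v" using s a continuous_on_subset by (auto simp: sobolev_def)
  then have "uniformly_continuous_on ?K v" by (rule compact_uniformly_continuous[OF _ square_compact])
  then obtain d where d: "d > 0" "\<And>x y. x \<in> ?K \<Longrightarrow> y \<in> ?K \<Longrightarrow> dist y x < d \<Longrightarrow> dist (v y) (v x) < \<eta>"
    using \<eta>(1) unfolding uniformly_continuous_on_def by metis
  \<comment> \<open>The bound by R keeps the test function inside the doubled square; the third of d
    pays for the factor 2 between \<open>infnorm\<close> and the Euclidean distance.\<close>
  define \<epsilon> where "\<epsilon> = min R (d/3)"
  have \<epsilon>: "0 < \<epsilon>" "\<epsilon> \<le> R" "2 * \<epsilon> < d" using R d(1) by (auto simp: \<epsilon>_def)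
  have osc: "\<bar>v x - v y\<bar> \<le> \<eta>" if "x \<in> ?K" "y \<in> ?K" "infnorm (x - y) \<le> \<epsilon>" for x y
  proof -
    have "x \<in> cball y (2 * \<epsilon>)" using that(3) square_subset_cball[of \<epsilon> y] \<epsilon>(1) by (auto simp: square_infnorm)
    then have "dist x y < d" using \<epsilon>(3) by (simp add: dist_commute)
    then show ?thesis using d(2)[OF that(2,1)] by (simp add: dist_real_def)
  qed
  let ?f = "\<lambda>w. norm (g w) ^ 2"
  have fi: "?f integrable_on ?K" and fE: "integral ?K ?f \<le> energy \<Omega> g"
    using sobolev_integrable_sq[OF s a] by auto
  have c0: "1024 * R / \<epsilon> \<ge> 0" using R \<epsilon> by simp
  show ?thesis
  proof (rule that[of "\<lambda>j s. line_energy \<epsilon> a R g j s"])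
    show "0 \<le> line_energy \<epsilon> a R g j s" for j s
    proof -
      have "0 \<le> integral ?K (\<lambda>y. ?f y * beta ((y \<bullet> j - s) / \<epsilon>))"
      proof (rule integral_nonneg)
        have "?f absolutely_integrable_on ?K" using fi by (intro nonnegative_absolutely_integrable_1) auto
        from integrable_mult_continuous[OF this square_compact beta_comp_continuous[OF \<epsilon>(1)]]
        show "(\<lambda>y. ?f y * beta ((y \<bullet> j - s) / \<epsilon>)) integrable_on ?K" by (simp add: absolutely_integrable_on_def)
      qed (simp add: beta_nonneg)
      then show ?thesis unfolding line_energy_def using c0 by (rule mult_nonneg_nonneg[rotated])
    qed
    show "(v p - v q)^2 \<le> \<delta> + line_energy \<epsilon> a R g j (p \<bullet> j)"
      if "j \<in> Basis" "p \<in> square a R" "q \<in> square a R" "p \<bullet> j = q \<bullet> j" for j p q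
      using line_oscillation[OF s a \<epsilon>(1,2) osc that] \<eta>(2) by simp
  next
    fix j :: R2 and \<sigma> :: real assume j: "j \<in> Basis" and \<sigma>: "\<bar>\<sigma>\<bar> = 1"
    let ?k = "\<lambda>s w. beta ((w \<bullet> j - (a \<bullet> j + \<sigma> * s)) / \<epsilon>)"
    have S: "{0..R} \<in> lmeasurable" by simp
    have k: "continuous_on UNIV (\<lambda>x. ?k (fst x) (snd x))"
      using \<epsilon>(1) by (intro continuous_on_compose2[OF beta_continuous[of UNIV]] continuous_intros) auto
    note sch = schur_integral[OF S square_lmeasurable fi _ k beta_nonneg beta_le1 slice_length[OF \<epsilon>(1) \<sigma>]]
    show "(\<lambda>s. line_energy \<epsilon> a R g j (a \<bullet> j + \<sigma> * s)) integrable_on {0..R}"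
      unfolding line_energy_def using sch(1) by (intro integrable_on_mult_right) auto
    have "integral {0..R} (\<lambda>s. line_energy \<epsilon> a R g j (a \<bullet> j + \<sigma> * s)) \<le> (1024 * R / \<epsilon>) * (2 * \<epsilon> * integral ?K ?f)"
      unfolding line_energy_def integral_mult_right by (rule mult_left_mono[OF sch(2) c0]) auto
    also have "\<dots> = 2048 * R * integral ?K ?f" using \<epsilon> by simp
    also have "\<dots> \<le> 2048 * R * energy \<Omega> g" using R by (intro mult_left_mono fE) auto
    finally show "integral {0..R} (\<lambda>s. line_energy \<epsilon> a R g j (a \<bullet> j + \<sigma> * s)) \<le> 2048 * R * energy \<Omega> g" .
  next
    fix j :: R2 assume j: "j \<in> Basis"
    let ?k = "\<lambda>p w. beta ((w \<bullet> j - p \<bullet> j) / \<epsilon>)"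
    have k: "continuous_on UNIV (\<lambda>x. ?k (fst x) (snd x))"
      using \<epsilon>(1) by (intro continuous_on_compose2[OF beta_continuous[of UNIV]] continuous_intros) auto
    have even: "beta (- t) = beta t" for t by (simp add: beta_def)
    have sl: "integral (square a R) (\<lambda>p. ?k p w) \<le> 2 * \<epsilon> * (2 * R)" for w :: R2
    proof -
      have "(\<lambda>p. ?k p w) = (\<lambda>p. beta ((p \<bullet> j - w \<bullet> j) / \<epsilon>))"
        using even by (metis minus_diff_eq minus_divide_left)
      then show ?thesis using slice_content[OF j less_imp_le[OF R] \<epsilon>(1), of a "w \<bullet> j"] by simp
    qed
    note sch = schur_integral[OF square_lmeasurable square_lmeasurable fi _ k beta_nonneg beta_le1 sl]
    show "(\<lambda>p. line_energy \<epsilon> a R g j (p \<bullet> j)) integrable_on square a R"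
      unfolding line_energy_def using sch(1) by (intro integrable_on_mult_right) auto
    have "integral (square a R) (\<lambda>p. line_energy \<epsilon> a R g j (p \<bullet> j)) \<le> (1024 * R / \<epsilon>) * (2 * \<epsilon> * (2 * R) * integral ?K ?f)"
      unfolding line_energy_def integral_mult_right by (rule mult_left_mono[OF sch(2) c0]) auto
    also have "\<dots> = 4096 * R^2 * integral ?K ?f" using \<epsilon> by (simp add: power2_eq_square)
    also have "\<dots> \<le> 4096 * R^2 * energy \<Omega> g" by (intro mult_left_mono fE) auto
    finally show "integral (square a R) (\<lambda>p. line_energy \<epsilon> a R g j (p \<bullet> j)) \<le> 4096 * R^2 * energy \<Omega> g" .
  qed
qed

section \<open>From lines to squares: averaging over crossing radii and over overlapping
  squares\<close>

lemma square_add_le: "((x::real) + y)^2 \<le> 2 * x^2 + 2 * y^2"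
  by (smt (verit) sum_squares_bound power2_sum)

text \<open>The path from p to z turns once, at the point m with the j-coordinate of p and the
  i-coordinate of z. The second leg lies on the line through z selected by i; the first is charged
  to p by summing over both of its lines.\<close>

lemma two_line_oscillation:
  fixes H :: "R2 \<Rightarrow> real \<Rightarrow> real"
  assumes H0: "\<And>j s. 0 \<le> H j s"
    and H: "\<And>j p q. j \<in> Basis \<Longrightarrow> p \<in> square a R \<Longrightarrow> q \<in> square a R \<Longrightarrow> p \<bullet> j = q \<bullet> j \<Longrightarrow> (v p - v q)^2 \<le> \<delta> + H j (p \<bullet> j)"
    and p: "p \<in> square a R" and z: "z \<in> square a R" and i: "i \<in> Basis"
  shows "(v p - v z)^2 \<le> 4 * \<delta> + 2 * (\<Sum>k\<in>Basis. H k (p \<bullet> k)) + 2 * H i (z \<bullet> i)"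
proof -
  obtain j where j: "j \<in> Basis" "j \<noteq> i" "Basis = {j, i}" "j \<bullet> i = 0" "i \<bullet> j = 0" using Basis_other[OF i] .
  define m where "m = (p \<bullet> j) *\<^sub>R j + (z \<bullet> i) *\<^sub>R i"
  have m: "m \<bullet> j = p \<bullet> j" "m \<bullet> i = z \<bullet> i" using i j by (auto simp: m_def inner_add_left)
  have msq: "m \<in> square a R" using p z i j(1) m unfolding mem_square inner_diff_left j(3) by auto
  have "(v p - v z)^2 = ((v p - v m) + (v m - v z))^2" by simp
  also have "\<dots> \<le> 2 * (v p - v m)^2 + 2 * (v m - v z)^2" by (rule square_add_le)
  also have "\<dots> \<le> 2 * (\<delta> + H j (p \<bullet> j)) + 2 * (\<delta> + H i (m \<bullet> i))"
    by (intro add_mono mult_left_mono H p z msq i j) (use m in auto)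
  also have "H j (p \<bullet> j) \<le> (\<Sum>k\<in>Basis. H k (p \<bullet> k))" by (rule member_le_sum) (use j H0 in auto)
  finally show ?thesis using m by simp
qed

text \<open>For each radius s the point z lies on one of four lines, and its line term is bounded by
  \<open>W s\<close>, the sum over all four. This bound depends on s alone, so it can be averaged
  over the radii although z is chosen arbitrarily for each s. \<open>G\<close> is abstract to cover
  both v^2, when v vanishes at z, and 1/2 - v^2, when v is at least 1 there.\<close>

lemma crossing_integral:
  assumes r: "r > 0" and a: "square a (4*r) \<subseteq> \<Omega>" and s: "sobolev \<Omega> v g"
    and G: "G integrable_on square a (2*r)"
    and z: "\<And>p s. p \<in> square a (2*r) \<Longrightarrow> s \<in> {r..2*r} \<Longrightarrow> \<exists>z. infnorm (z - a) = s \<and> G p \<le> (v p - v z)^2"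
  shows "integral (square a (2*r)) G \<le> 589824 * r^2 * energy \<Omega> g"
proof (rule field_le_epsilon)
  fix e :: real assume e: "e > 0"
  \<comment> \<open>The error \<open>4 * \<delta>\<close>, integrated over a square of area
    \<open>16 * r^2\<close>, is exactly e.\<close>
  define \<delta> where "\<delta> = e / (64 * r^2)"
  have \<delta>: "\<delta> > 0" using e r by (simp add: \<delta>_def)
  let ?Q = "square a (2*r)" and ?E = "energy \<Omega> g"
  obtain H :: "R2 \<Rightarrow> real \<Rightarrow> real" where H:
    "\<And>j s. 0 \<le> H j s"
    "\<And>j p q. j \<in> Basis \<Longrightarrow> p \<in> ?Q \<Longrightarrow> q \<in> ?Q \<Longrightarrow> p \<bullet> j = q \<bullet> j \<Longrightarrow> (v p - v q)^2 \<le> \<delta> + H j (p \<bullet> j)"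
    "\<And>j \<sigma>. j \<in> Basis \<Longrightarrow> \<bar>\<sigma>\<bar> = 1 \<Longrightarrow> (\<lambda>s. H j (a \<bullet> j + \<sigma> * s)) integrable_on {0..2*r}"
    "\<And>j \<sigma>. j \<in> Basis \<Longrightarrow> \<bar>\<sigma>\<bar> = 1 \<Longrightarrow> integral {0..2*r} (\<lambda>s. H j (a \<bullet> j + \<sigma> * s)) \<le> 2048 * (2*r) * ?E"
    "\<And>j. j \<in> Basis \<Longrightarrow> (\<lambda>p. H j (p \<bullet> j)) integrable_on ?Q"
    "\<And>j. j \<in> Basis \<Longrightarrow> integral ?Q (\<lambda>p. H j (p \<bullet> j)) \<le> 4096 * (2*r)^2 * ?E"
    using line_control[of "2*r" a \<Omega> v g \<delta>] r a s \<delta> by auto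
  define W where "W s = (\<Sum>k\<in>Basis. H k (a \<bullet> k + 1 * s)) + (\<Sum>k\<in>Basis. H k (a \<bullet> k + (-1) * s))" for s
  have Hsub: "(\<lambda>s. H j (a \<bullet> j + \<sigma> * s)) integrable_on {r..2*r}"
    "integral {r..2*r} (\<lambda>s. H j (a \<bullet> j + \<sigma> * s)) \<le> 4096 * r * ?E" if "j \<in> Basis" "\<bar>\<sigma>\<bar> = 1" for j \<sigma>
  proof -
    show 1: "(\<lambda>s. H j (a \<bullet> j + \<sigma> * s)) integrable_on {r..2*r}"
      using H(3)[OF that] r by (rule_tac integrable_on_subinterval) auto
    have "integral {r..2*r} (\<lambda>s. H j (a \<bullet> j + \<sigma> * s)) \<le> integral {0..2*r} (\<lambda>s. H j (a \<bullet> j + \<sigma> * s))"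
      using r H(1) by (intro integral_subset_le 1 H(3) that) auto
    then show "integral {r..2*r} (\<lambda>s. H j (a \<bullet> j + \<sigma> * s)) \<le> 4096 * r * ?E" using H(4)[OF that] by simp
  qed
  have Wi: "W integrable_on {r..2*r}" unfolding W_def
    by (intro integrable_add integrable_sum Hsub) auto
  have WE: "integral {r..2*r} W \<le> 16384 * r * ?E"
  proof -
    have i1: "integral {r..2*r} (\<lambda>s. \<Sum>k\<in>Basis. H k (a \<bullet> k + \<sigma> * s)) \<le> 8192 * r * ?E" if "\<bar>\<sigma>\<bar> = 1" for \<sigma>
    proof -
      have "integral {r..2*r} (\<lambda>s. \<Sum>k\<in>Basis. H k (a \<bullet> k + \<sigma> * s)) = (\<Sum>k\<in>Basis. integral {r..2*r} (\<lambda>s. H k (a \<bullet> k + \<sigma> * s)))"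
        by (intro integral_sum Hsub that) auto
      also have "\<dots> \<le> (\<Sum>k\<in>(Basis::R2 set). 4096 * r * ?E)" by (intro sum_mono Hsub that)
      finally show ?thesis by simp
    qed
    have "integral {r..2*r} W = integral {r..2*r} (\<lambda>s. \<Sum>k\<in>Basis. H k (a \<bullet> k + 1 * s)) + integral {r..2*r} (\<lambda>s. \<Sum>k\<in>Basis. H k (a \<bullet> k + (-1) * s))"
      unfolding W_def by (intro integral_add integrable_sum Hsub) auto
    then show ?thesis using i1[of 1] i1[of "-1"] by linarith
  qed
  define h where "h p = (\<Sum>k\<in>Basis. H k (p \<bullet> k))" for p
  have hi: "h integrable_on ?Q" unfolding h_def by (intro integrable_sum H(5)) auto
  have hE: "integral ?Q h \<le> 32768 * r^2 * ?E"
  proof -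
    have "integral ?Q h = (\<Sum>k\<in>Basis. integral ?Q (\<lambda>p. H k (p \<bullet> k)))"
      unfolding h_def by (intro integral_sum H(5)) auto
    also have "\<dots> \<le> (\<Sum>k\<in>(Basis::R2 set). 4096 * (2*r)^2 * ?E)" by (intro sum_mono H(6))
    finally show ?thesis by (simp add: power_mult_distrib)
  qed
  have pw: "G p \<le> 4 * \<delta> + 2 * h p + 32768 * ?E" if p: "p \<in> ?Q" for p
  proof -
    have ps: "G p \<le> 4 * \<delta> + 2 * h p + 2 * W s" if st: "s \<in> {r..2*r}" for s
    proof -
      obtain z where z: "infnorm (z - a) = s" "G p \<le> (v p - v z)^2" using z[OF p st] by blast
      \<comment> \<open>The maximum in \<open>infnorm\<close> is attained in some direction i, and
        this direction selects the line through z.\<close>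
      have "infnorm (z - a) \<in> (\<lambda>i. \<bar>(z - a) \<bullet> i\<bar>) ` Basis" unfolding infnorm_Max by (intro Max_in) auto
      then obtain i where i: "i \<in> Basis" "s = \<bar>(z - a) \<bullet> i\<bar>" using z(1) by auto
      have zQ: "z \<in> ?Q" using z(1) st by (simp add: square_infnorm)
      have "z \<bullet> i = a \<bullet> i + 1 * s \<or> z \<bullet> i = a \<bullet> i + (-1) * s" using i(2) by (auto simp: inner_diff_left)
      then have "H i (z \<bullet> i) \<le> W s"
      proof
        assume "z \<bullet> i = a \<bullet> i + 1 * s"
        then have "H i (z \<bullet> i) \<le> (\<Sum>k\<in>Basis. H k (a \<bullet> k + 1 * s))"
          using member_le_sum[of i Basis "\<lambda>k. H k (a \<bullet> k + 1 * s)"] i(1) H(1) by auto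
        moreover have "0 \<le> (\<Sum>k\<in>Basis. H k (a \<bullet> k + (-1) * s))" by (intro sum_nonneg H(1))
        ultimately show ?thesis unfolding W_def by linarith
      next
        assume "z \<bullet> i = a \<bullet> i + (-1) * s"
        then have "H i (z \<bullet> i) \<le> (\<Sum>k\<in>Basis. H k (a \<bullet> k + (-1) * s))"
          using member_le_sum[of i Basis "\<lambda>k. H k (a \<bullet> k + (-1) * s)"] i(1) H(1) by auto
        moreover have "0 \<le> (\<Sum>k\<in>Basis. H k (a \<bullet> k + 1 * s))" by (intro sum_nonneg H(1))
        ultimately show ?thesis unfolding W_def by linarith
      qed
      then show ?thesis using z(2) two_line_oscillation[of H a "2*r" v \<delta>, OF H(1,2) p zQ i(1)] unfolding h_def by linarith
    qed
    \<comment> \<open>The left side does not depend on s, so integrating over an interval of length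
      r and dividing by r replaces \<open>W s\<close> by its mean.\<close>
    have "r * G p = integral {r..2*r} (\<lambda>s. G p)" using r by simp
    also have "\<dots> \<le> integral {r..2*r} (\<lambda>s. (4 * \<delta> + 2 * h p) + 2 * W s)"
      by (rule integral_le) (use ps Wi in \<open>auto intro!: integrable_add integrable_on_mult_right\<close>)
    also have "\<dots> = r * (4 * \<delta> + 2 * h p) + 2 * integral {r..2*r} W"
      using r by (subst integral_add) (auto intro!: integrable_on_mult_right Wi)
    also have "\<dots> \<le> r * (4 * \<delta> + 2 * h p) + 2 * (16384 * r * ?E)" using WE by simp
    also have "\<dots> = r * (4 * \<delta> + 2 * h p + 32768 * ?E)" by (simp add: algebra_simps)
    finally show ?thesis using r by simp
  qed
  have cQ: "measure lborel ?Q = 16 * r^2" using content_square[of "2*r" a] r by (simp add: square_def power_mult_distrib)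
  have "integral ?Q G \<le> integral ?Q (\<lambda>p. (4 * \<delta> + 32768 * ?E) + 2 * h p)"
    by (rule integral_le[OF G]) (use pw hi in \<open>auto simp: square_def algebra_simps intro!: integrable_add integrable_on_mult_right\<close>)
  also have "\<dots> = integral ?Q (\<lambda>p. 4 * \<delta> + 32768 * ?E) + 2 * integral ?Q h"
    by (subst integral_add) (use hi in \<open>auto simp: square_def intro!: integrable_on_mult_right\<close>)
  also have "integral ?Q (\<lambda>p. 4 * \<delta> + 32768 * ?E) = measure lborel ?Q * (4 * \<delta> + 32768 * ?E)"
    unfolding square_def by simp
  also have "\<dots> + 2 * integral ?Q h \<le> measure lborel ?Q * (4 * \<delta> + 32768 * ?E) + 2 * (32768 * r^2 * ?E)"
    by (intro add_left_mono mult_left_mono hE) simp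
  \<comment> \<open>The area \<open>16 * r^2\<close> times 32768 from the mean of \<open>W\<close>,
    plus twice the bound 32768 on the integral of \<open>h\<close>: 18 * 32768 = 589824.\<close>
  also have "\<dots> = 589824 * r^2 * ?E + 64 * r^2 * \<delta>" unfolding cQ by (simp add: algebra_simps)
  also have "64 * r^2 * \<delta> = e" using r by (simp add: \<delta>_def)
  finally show "integral ?Q G \<le> 589824 * r^2 * ?E + e" .
qed

lemma sobolev_sq_integrable:
  assumes "sobolev \<Omega> v g" "compact T" "T \<subseteq> \<Omega>"
  shows "(\<lambda>x. (v x)^2) integrable_on T"
proof -
  have "continuous_on \<Omega> v" using assms(1) by (simp add: sobolev_def)
  then have "continuous_on T v" using assms(3) by (rule continuous_on_subset)
  then have "continuous_on T (\<lambda>x. (v x)^2)" by (rule continuous_on_power)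
  from continuous_compact_abs_integrable[OF assms(2) this] show ?thesis by (simp add: absolutely_integrable_on_def)
qed

text \<open>A point p of the large square and a point q of the small one are joined by a path with
  one turn, so v(p)^2 is at most 2 v(q)^2 plus line terms. Averaging over q and integrating over p
  transfers an L^2 bound from the small square to the large one at the cost of energy.\<close>

lemma overlap_integral:
  assumes R: "R > 0" and a: "square a (2*R) \<subseteq> \<Omega>" and b: "\<rho> > 0" "square b \<rho> \<subseteq> square a R"
  obtains C where "C \<ge> 0" "\<And>v g. sobolev \<Omega> v g \<Longrightarrow>
    integral (square a R) (\<lambda>x. (v x)^2) \<le> C * (integral (square b \<rho>) (\<lambda>x. (v x)^2) + energy \<Omega> g)"
proof -
  let ?Q = "square a R" and ?B = "square b \<rho>"
  have cQ: "measure lborel ?Q = 4 * R^2" using content_square[OF R, of a] by (simp add: square_def)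
  have cB: "measure lborel ?B = 4 * \<rho>^2" using content_square[OF b(1), of b] by (simp add: square_def)
  have QO: "?Q \<subseteq> \<Omega>" using a R square_mono[of a a R "2*R"] by (auto simp: infnorm_0)
  \<comment> \<open>The sum of the two coefficients in \<open>main\<close>, so that it dominates
    each of them.\<close>
  define C where "C = 2 * R^2 / \<rho>^2 + (4 * R^2 / (4 * \<rho>^2)) * (4 * 8192 * R^2) + 4 * 8192 * R^2"
  have main: "integral ?Q (\<lambda>x. (v x)^2) \<le> (2 * R^2 / \<rho>^2) * integral ?B (\<lambda>x. (v x)^2) +
      ((4 * R^2 / (4 * \<rho>^2)) * (4 * 8192 * R^2) + 4 * 8192 * R^2) * energy \<Omega> g" if s: "sobolev \<Omega> v g" for v g
  proof (rule field_le_epsilon)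
    fix e :: real assume e: "e > 0"
    define \<delta> where "\<delta> = e / (32 * R^2)"
    have \<delta>: "\<delta> > 0" using e R by (simp add: \<delta>_def)
    let ?E = "energy \<Omega> g"
    obtain H :: "R2 \<Rightarrow> real \<Rightarrow> real" where H:
      "\<And>j s. 0 \<le> H j s"
      "\<And>j p q. j \<in> Basis \<Longrightarrow> p \<in> ?Q \<Longrightarrow> q \<in> ?Q \<Longrightarrow> p \<bullet> j = q \<bullet> j \<Longrightarrow> (v p - v q)^2 \<le> \<delta> + H j (p \<bullet> j)"
      "\<And>j. j \<in> Basis \<Longrightarrow> (\<lambda>p. H j (p \<bullet> j)) integrable_on ?Q"
      "\<And>j. j \<in> Basis \<Longrightarrow> integral ?Q (\<lambda>p. H j (p \<bullet> j)) \<le> 4096 * R^2 * ?E"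
      using line_control[OF R a s \<delta>] by metis
    define h where "h p = (\<Sum>k\<in>Basis. H k (p \<bullet> k))" for p
    have h0: "h p \<ge> 0" for p unfolding h_def by (intro sum_nonneg H)
    have hi: "h integrable_on ?Q" unfolding h_def by (intro integrable_sum H(3)) auto
    have hE: "integral ?Q h \<le> 8192 * R^2 * ?E"
    proof -
      have "integral ?Q h = (\<Sum>k\<in>Basis. integral ?Q (\<lambda>p. H k (p \<bullet> k)))"
        unfolding h_def by (intro integral_sum H(3)) auto
      also have "\<dots> \<le> (\<Sum>k\<in>(Basis::R2 set). 4096 * R^2 * ?E)" by (intro sum_mono H(4))
      finally show ?thesis by simp
    qed
    have hB: "h integrable_on ?B" using hi b(2) unfolding square_def by (rule integrable_on_subcbox)
    have hBE: "integral ?B h \<le> 8192 * R^2 * ?E"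
      using integral_subset_le[OF b(2) hB hi] h0 hE by force
    have pq: "(v p)^2 \<le> 2 * (v q)^2 + 8 * \<delta> + 4 * h p + 4 * h q" if "p \<in> ?Q" "q \<in> ?Q" for p q
    proof -
      obtain i :: R2 where i: "i \<in> Basis" using SOME_Basis by blast
      have "H i (q \<bullet> i) \<le> h q" unfolding h_def using H(1) i by (intro member_le_sum) auto
      then have 1: "(v p - v q)^2 \<le> 4 * \<delta> + 2 * h p + 2 * h q"
        using two_line_oscillation[of H a R v \<delta>, OF H(1,2) that i] unfolding h_def by linarith
      have "(v p)^2 = (v q + (v p - v q))^2" by simp
      also have "\<dots> \<le> 2 * (v q)^2 + 2 * (v p - v q)^2" by (rule square_add_le)
      finally show ?thesis using 1 by linarith
    qed
    have vQ: "(\<lambda>x. (v x)^2) integrable_on ?Q" by (rule sobolev_sq_integrable[OF s square_compact QO])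
    have vB: "(\<lambda>x. (v x)^2) integrable_on ?B" using sobolev_sq_integrable[OF s square_compact] b(2) QO by blast
    have cst: "(\<lambda>q. c) integrable_on square x r" for c :: real and x r unfolding square_def by (rule integrable_const)
    have ci: "integral (square x r) (\<lambda>q. c) = measure lborel (square x r) * c" for c :: real and x r by (simp add: square_def)
    have pw: "(v p)^2 \<le> (1 / (4 * \<rho>^2)) * (2 * integral ?B (\<lambda>x. (v x)^2) + 4 * 8192 * R^2 * ?E) + 8 * \<delta> + 4 * h p"
      if p: "p \<in> ?Q" for p
    proof -
      have "4 * \<rho>^2 * (v p)^2 = integral ?B (\<lambda>q. (v p)^2)" by (simp only: ci cB)
      also have "\<dots> \<le> integral ?B (\<lambda>q. (2 * (v q)^2 + 4 * h q) + (8 * \<delta> + 4 * h p))"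
        by (rule integral_le) (use pq[OF p] b(2) hB vB cst in \<open>auto simp: algebra_simps intro!: integrable_add integrable_on_mult_right\<close>)
      also have "\<dots> = integral ?B (\<lambda>q. 2 * (v q)^2 + 4 * h q) + integral ?B (\<lambda>q. 8 * \<delta> + 4 * h p)"
        by (intro integral_add integrable_add integrable_on_mult_right vB hB cst)
      also have "integral ?B (\<lambda>q. 2 * (v q)^2 + 4 * h q) = 2 * integral ?B (\<lambda>q. (v q)^2) + 4 * integral ?B h"
        by (subst integral_add) (auto intro!: integrable_on_mult_right vB hB)
      also have "integral ?B (\<lambda>q. 8 * \<delta> + 4 * h p) = 4 * \<rho>^2 * (8 * \<delta> + 4 * h p)" by (simp only: ci cB)
      finally have "4 * \<rho>^2 * (v p)^2 \<le> (2 * integral ?B (\<lambda>q. (v q)^2) + 4 * 8192 * R^2 * ?E) + 4 * \<rho>^2 * (8 * \<delta> + 4 * h p)"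
        using hBE by linarith
      then show ?thesis using b(1) by (simp add: field_simps)
    qed
    define c where "c = (1 / (4 * \<rho>^2)) * (2 * integral ?B (\<lambda>x. (v x)^2) + 4 * 8192 * R^2 * ?E) + 8 * \<delta>"
    have "integral ?Q (\<lambda>x. (v x)^2) \<le> integral ?Q (\<lambda>p. c + 4 * h p)"
      by (rule integral_le[OF vQ]) (use pw hi cst in \<open>auto simp: c_def intro!: integrable_add integrable_on_mult_right\<close>)
    also have "\<dots> = integral ?Q (\<lambda>p. c) + 4 * integral ?Q h"
      by (subst integral_add) (auto intro!: integrable_on_mult_right hi cst)
    also have "integral ?Q (\<lambda>p. c) = 4 * R^2 * c" by (simp only: ci cQ)
    also have "4 * R^2 * c + 4 * integral ?Q h \<le> 4 * R^2 * c + 4 * (8192 * R^2 * ?E)"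
      by (intro add_left_mono mult_left_mono hE) simp
    also have "\<dots> = (2 * R^2 / \<rho>^2) * integral ?B (\<lambda>x. (v x)^2) +
      ((4 * R^2 / (4 * \<rho>^2)) * (4 * 8192 * R^2) + 4 * 8192 * R^2) * ?E + 32 * R^2 * \<delta>"
      unfolding c_def using b(1) by (simp add: field_simps)
    also have "32 * R^2 * \<delta> = e" using R by (simp add: \<delta>_def)
    finally show "integral ?Q (\<lambda>x. (v x)^2) \<le> (2 * R^2 / \<rho>^2) * integral ?B (\<lambda>x. (v x)^2) +
      ((4 * R^2 / (4 * \<rho>^2)) * (4 * 8192 * R^2) + 4 * 8192 * R^2) * ?E + e" .
  qed
  show ?thesis
  proof (rule that[of C])
    show "C \<ge> 0" by (auto simp: C_def)
    fix v g assume s: "sobolev \<Omega> v g"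
    have B0: "integral ?B (\<lambda>x. (v x)^2) \<ge> 0"
      using sobolev_sq_integrable[OF s square_compact] b(2) QO by (intro integral_nonneg) auto
    have "(2 * R^2 / \<rho>^2) * integral ?B (\<lambda>x. (v x)^2) \<le> C * integral ?B (\<lambda>x. (v x)^2)"
      by (intro mult_right_mono B0) (auto simp: C_def)
    moreover have "((4 * R^2 / (4 * \<rho>^2)) * (4 * 8192 * R^2) + 4 * 8192 * R^2) * energy \<Omega> g \<le> C * energy \<Omega> g"
      by (intro mult_right_mono energy_nonneg) (auto simp: C_def)
    ultimately show "integral ?Q (\<lambda>x. (v x)^2) \<le> C * (integral ?B (\<lambda>x. (v x)^2) + energy \<Omega> g)"
      using main[OF s] by (simp add: distrib_left)
  qed
qed

text \<open>The intermediate value theorem for the continuous function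
  \<open>infnorm (z - a)\<close> on A.\<close>

lemma connected_crosses_sphere:
  fixes A :: "R2 set"
  assumes "connected A" "x \<in> A" "infnorm (x - a) \<le> s" "y \<in> A" "s \<le> infnorm (y - a)"
  obtains z where "z \<in> A" "infnorm (z - a) = s"
proof -
  have "connected ((\<lambda>z. infnorm (z - a)) ` A)"
    using assms(1) by (intro connected_continuous_image continuous_intros)
  then have "{infnorm (x - a)..infnorm (y - a)} \<subseteq> (\<lambda>z. infnorm (z - a)) ` A"
    using assms(2,4) by (intro connected_contains_Icc) auto
  then have "s \<in> (\<lambda>z. infnorm (z - a)) ` A" using assms(3,5) by auto
  then show ?thesis using that by auto
qed

text \<open>On a small square around f1 the inequality holds because F, running from f1 to f2
  outside the square, contains a zero of v at every radius of the averaging range. It spreads to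
  overlapping squares by \<open>overlap_integral\<close>, reaches every point of \<Omega> by
  connectedness, and is summed over a finite cover of T.\<close>

lemma poincare:
  assumes \<Omega>: "open \<Omega>" "connected \<Omega>" and F: "connected F" "F \<subseteq> \<Omega>" "f1 \<in> F" "f2 \<in> F" "f1 \<noteq> f2"
    and T: "compact T" "T \<subseteq> \<Omega>"
  obtains C where "C \<ge> 0"
    "\<And>v g. sobolev \<Omega> v g \<Longrightarrow> (\<And>x. x \<in> F \<Longrightarrow> v x = 0) \<Longrightarrow> integral T (\<lambda>x. (v x)^2) \<le> C * energy \<Omega> g"
proof -
  define bounded_on where "bounded_on S C \<longleftrightarrow> C \<ge> 0 \<and> (\<forall>v g. sobolev \<Omega> v g \<longrightarrow> (\<forall>x\<in>F. v x = 0) \<longrightarrow>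
      integral S (\<lambda>x. (v x)^2) \<le> C * energy \<Omega> g)" for S :: "R2 set" and C
  define good where "good x \<longleftrightarrow> (\<exists>\<rho>>0. \<exists>C. square x \<rho> \<subseteq> \<Omega> \<and> bounded_on (square x \<rho>) C)" for x
  have shrink: "bounded_on S C" if "bounded_on S' C" "S \<subseteq> S'" "compact S" "compact S'" "S' \<subseteq> \<Omega>" for S S' C
    unfolding bounded_on_def
  proof (intro conjI allI impI)
    show "C \<ge> 0" using that(1) by (simp add: bounded_on_def)
    fix v g assume v: "sobolev \<Omega> v g" "\<forall>x\<in>F. v x = 0"
    have "integral S (\<lambda>x. (v x)^2) \<le> integral S' (\<lambda>x. (v x)^2)"
      using that by (intro integral_subset_le sobolev_sq_integrable[OF v(1)]) auto
    also have "\<dots> \<le> C * energy \<Omega> g" using that(1) v by (auto simp: bounded_on_def)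
    finally show "integral S (\<lambda>x. (v x)^2) \<le> C * energy \<Omega> g" .
  qed
  have good1: "good f1"
  proof -
    have "open (\<Omega> - {f2})" using \<Omega> by auto
    then obtain R where R: "R > 0" "square f1 R \<subseteq> \<Omega> - {f2}" using square_subset_open[of "\<Omega> - {f2}" f1] F by blast
    define r where "r = R / 4"
    have r: "r > 0" "square f1 (4*r) \<subseteq> \<Omega>" using R by (auto simp: r_def)
    \<comment> \<open>Every radius in the averaging range then separates f1 from f2, which forces F
      to cross.\<close>
    have "f2 \<notin> square f1 (2*r)" using R square_mono[of f1 f1 "2*r" R] by (auto simp: r_def infnorm_0)
    then have far: "2 * r \<le> infnorm (f2 - f1)" by (simp add: square_infnorm)
    have "bounded_on (square f1 (2*r)) (589824 * r^2)"
      unfolding bounded_on_def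
    proof (intro conjI allI impI)
      fix v g assume v: "sobolev \<Omega> v g" "\<forall>x\<in>F. v x = 0"
      show "integral (square f1 (2*r)) (\<lambda>x. (v x)^2) \<le> 589824 * r^2 * energy \<Omega> g"
      proof (rule crossing_integral[OF r v(1)])
        show "(\<lambda>x. (v x)^2) integrable_on square f1 (2*r)"
          using r square_mono[of f1 f1 "2*r" "4*r"]
          by (intro sobolev_sq_integrable[OF v(1) square_compact]) (auto simp: infnorm_0)
        fix p s assume "s \<in> {r..2*r}"
        then obtain z where "z \<in> F" "infnorm (z - f1) = s"
          using connected_crosses_sphere[OF F(1,3) _ F(4), of f1 s] far r by (auto simp: infnorm_0)
        then show "\<exists>z. infnorm (z - f1) = s \<and> (v p)^2 \<le> (v p - v z)^2" using v(2) by (intro exI[of _ z]) auto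
      qed
    qed simp
    then show ?thesis unfolding good_def
      using r square_mono[of f1 f1 "2*r" "4*r"] by (intro exI[of _ "2*r"]) (auto simp: infnorm_0)
  qed
  \<comment> \<open>The admissible distance from y to x depends on x and \<Omega> only, not on the
    possibly tiny good square around y. This is what makes failure of goodness an open condition as
    well.\<close>
  have good_near: "good x" if R: "R > 0" "square x (2*R) \<subseteq> \<Omega>" and y: "y \<in> ball x (R/2)" "good y" for x y R
  proof -
    obtain \<rho> C where \<rho>: "\<rho> > 0" "square y \<rho> \<subseteq> \<Omega>" "bounded_on (square y \<rho>) C" using y(2) unfolding good_def by blast
    define \<tau> where "\<tau> = min \<rho> (R/2)"
    have \<tau>: "\<tau> > 0" "\<tau> \<le> \<rho>" "\<tau> \<le> R/2" using \<rho> R by (auto simp: \<tau>_def)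
    have "infnorm (y - x) \<le> R/2" using y(1) infnorm_le_norm[of "y - x"] by (simp add: dist_norm norm_minus_commute)
    then have sub: "square y \<tau> \<subseteq> square x R" using \<tau> by (intro square_mono) auto
    have b: "bounded_on (square y \<tau>) C"
      using \<tau> by (intro shrink[OF \<rho>(3) square_mono square_compact square_compact \<rho>(2)]) (auto simp: infnorm_0)
    obtain C' where C': "C' \<ge> 0" "\<And>v g. sobolev \<Omega> v g \<Longrightarrow>
        integral (square x R) (\<lambda>x. (v x)^2) \<le> C' * (integral (square y \<tau>) (\<lambda>x. (v x)^2) + energy \<Omega> g)"
      using overlap_integral[OF R \<tau>(1) sub] by metis
    have "bounded_on (square x R) (C' * (C + 1))"
      unfolding bounded_on_def
    proof (intro conjI allI impI)
      show "0 \<le> C' * (C + 1)" using C'(1) b by (simp add: bounded_on_def)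
      fix v g assume v: "sobolev \<Omega> v g" "\<forall>x\<in>F. v x = 0"
      have "integral (square x R) (\<lambda>x. (v x)^2) \<le> C' * (integral (square y \<tau>) (\<lambda>x. (v x)^2) + energy \<Omega> g)" by (rule C'(2)[OF v(1)])
      also have "\<dots> \<le> C' * (C * energy \<Omega> g + energy \<Omega> g)"
        using b v C'(1) by (intro mult_left_mono add_right_mono) (auto simp: bounded_on_def)
      finally show "integral (square x R) (\<lambda>x. (v x)^2) \<le> C' * (C + 1) * energy \<Omega> g" by (simp add: algebra_simps)
    qed
    then show ?thesis unfolding good_def using R square_mono[of x x R "2*R"] by (intro exI[of _ R]) (auto simp: infnorm_0)
  qed
  have good_all: "good x" if "x \<in> \<Omega>" for x
  proof -
    define A B where "A = {x \<in> \<Omega>. good x}" and "B = {x \<in> \<Omega>. \<not> good x}"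
    have "open A" unfolding open_contains_ball
    proof
      fix x assume "x \<in> A"
      then obtain \<rho> C where \<rho>: "\<rho> > 0" "square x \<rho> \<subseteq> \<Omega>" "bounded_on (square x \<rho>) C" unfolding A_def good_def by blast
      have "y \<in> A" if y: "y \<in> ball x (\<rho>/2)" for y
      proof -
        have "infnorm (y - x) \<le> \<rho>/2" using y infnorm_le_norm[of "y - x"] by (simp add: dist_norm norm_minus_commute)
        then have sub: "square y (\<rho>/2) \<subseteq> square x \<rho>" by (intro square_mono) auto
        then have "bounded_on (square y (\<rho>/2)) C" using shrink[OF \<rho>(3) _ square_compact square_compact \<rho>(2)] by blast
        moreover have "y \<in> \<Omega>" using sub \<rho> by (auto simp: square_infnorm infnorm_0 subset_iff)
        ultimately show ?thesis unfolding A_def good_def using sub \<rho>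
          by (intro CollectI conjI exI[of _ "\<rho>/2"] exI[of _ C]) auto
      qed
      then show "\<exists>e>0. ball x e \<subseteq> A" using \<rho>(1) by (intro exI[of _ "\<rho>/2"]) auto
    qed
    moreover have "open B" unfolding open_contains_ball
    proof
      fix x assume x: "x \<in> B"
      obtain R where R: "R > 0" "square x R \<subseteq> \<Omega>" using square_subset_open[OF \<Omega>(1), of x] x by (auto simp: B_def)
      have "y \<in> B" if y: "y \<in> ball x (R/4)" for y
      proof -
        have "\<not> good y" using good_near[of "R/2" x y] R x y by (auto simp: B_def)
        moreover have "y \<in> \<Omega>" using R y cball_subset_square[of x R] by (auto simp: subset_iff)
        ultimately show ?thesis by (simp add: B_def)
      qed
      then show "\<exists>e>0. ball x e \<subseteq> B" using R(1) by (intro exI[of _ "R/4"]) auto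
    qed
    moreover have "A \<inter> \<Omega> \<noteq> {}" using good1 F by (auto simp: A_def)
    ultimately have "B \<inter> \<Omega> = {}"
      using connectedD[OF \<Omega>(2), of A B] by (auto simp: A_def B_def)
    then show ?thesis using that by (auto simp: B_def)
  qed
  then have "\<forall>x\<in>\<Omega>. \<exists>\<rho> C. \<rho> > 0 \<and> square x \<rho> \<subseteq> \<Omega> \<and> bounded_on (square x \<rho>) C" unfolding good_def by blast
  then obtain \<rho> C where \<rho>: "\<And>x. x \<in> \<Omega> \<Longrightarrow> \<rho> x > 0" "\<And>x. x \<in> \<Omega> \<Longrightarrow> square x (\<rho> x) \<subseteq> \<Omega>"
      "\<And>x. x \<in> \<Omega> \<Longrightarrow> bounded_on (square x (\<rho> x)) (C x)" by metis
  have "T \<subseteq> (\<Union>x\<in>T. ball x (\<rho> x))" using \<rho>(1) T(2) by force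
  then obtain D where D: "D \<subseteq> T" "finite D" "T \<subseteq> (\<Union>x\<in>D. ball x (\<rho> x))"
    using compactE_image[OF T(1), of T "\<lambda>x. ball x (\<rho> x)"] by blast
  have D\<Omega>: "D \<subseteq> \<Omega>" using D T by blast
  show ?thesis
  proof (rule that[of "\<Sum>x\<in>D. C x"])
    show "0 \<le> (\<Sum>x\<in>D. C x)" using \<rho>(3) D\<Omega> by (intro sum_nonneg) (auto simp: bounded_on_def)
    fix v g assume v: "sobolev \<Omega> v g" "\<And>x. x \<in> F \<Longrightarrow> v x = 0"
    let ?r = "\<lambda>S y. if y \<in> S then (v y)^2 else 0"
    have i: "(?r S) integrable_on UNIV" if "compact S" "S \<subseteq> \<Omega>" for S
      unfolding integrable_restrict_UNIV by (rule sobolev_sq_integrable[OF v(1) that])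
    have "integral T (\<lambda>x. (v x)^2) = integral UNIV (?r T)" by (simp add: integral_restrict_UNIV)
    also have "\<dots> \<le> integral UNIV (\<lambda>y. \<Sum>x\<in>D. ?r (square x (\<rho> x)) y)"
    proof (rule integral_le)
      show "?r T integrable_on UNIV" by (rule i[OF T])
      show "(\<lambda>y. \<Sum>x\<in>D. ?r (square x (\<rho> x)) y) integrable_on UNIV"
        by (intro integrable_sum D i square_compact \<rho>(2)) (use D\<Omega> in auto)
      fix y
      show "?r T y \<le> (\<Sum>x\<in>D. ?r (square x (\<rho> x)) y)"
      proof (cases "y \<in> T")
        case True
        then obtain x where x: "x \<in> D" "y \<in> ball x (\<rho> x)" using D(3) by blast
        then have "y \<in> square x (\<rho> x)" using cball_subset_square[of x "\<rho> x"] by auto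
        then have "?r T y = ?r (square x (\<rho> x)) y" using True by simp
        also have "\<dots> \<le> (\<Sum>x\<in>D. ?r (square x (\<rho> x)) y)" by (rule member_le_sum[OF x(1) _ D(2)]) auto
        finally show ?thesis .
      next
        case False
        then show ?thesis by (simp add: sum_nonneg)
      qed
    qed
    also have "\<dots> = (\<Sum>x\<in>D. integral UNIV (?r (square x (\<rho> x))))"
      by (intro integral_sum D i square_compact \<rho>(2)) (use D\<Omega> in auto)
    also have "\<dots> = (\<Sum>x\<in>D. integral (square x (\<rho> x)) (\<lambda>x. (v x)^2))" by (simp add: integral_restrict_UNIV)
    also have "\<dots> \<le> (\<Sum>x\<in>D. C x * energy \<Omega> g)"
      using \<rho>(3) D\<Omega> v by (intro sum_mono) (auto simp: bounded_on_def subset_iff)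
    finally show "integral T (\<lambda>x. (v x)^2) \<le> (\<Sum>x\<in>D. C x) * energy \<Omega> g" by (simp add: sum_distrib_right)
  qed
qed

section \<open>Comparison of the two metrics\<close>

text \<open>T carries the gradient of \<eta> and not \<eta> itself, so the estimate applies to one
  minus a cutoff. The factors 2 come from splitting the square of the sum of the two product rule
  terms.\<close>

lemma energy_cutoff:
  assumes \<Omega>: "open \<Omega>" and s: "sobolev \<Omega> v g" and \<eta>: "c1 \<eta> G" "\<And>x. 0 \<le> \<eta> x" "\<And>x. \<eta> x \<le> 1"
    and T: "compact T" "T \<subseteq> \<Omega>" "\<And>x. x \<notin> T \<Longrightarrow> G x = 0" and L: "\<And>x. norm (G x) \<le> L"
  shows "sobolev \<Omega> (\<lambda>x. \<eta> x * v x) (\<lambda>x. \<eta> x *\<^sub>R g x + v x *\<^sub>R G x)"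
    "energy \<Omega> (\<lambda>x. \<eta> x *\<^sub>R g x + v x *\<^sub>R G x) \<le> 2 * energy \<Omega> g + 2 * L^2 * integral T (\<lambda>x. (v x)^2)"
proof -
  have vc: "continuous_on \<Omega> v" and w: "weak_gradient \<Omega> v g" and gi: "(\<lambda>x. norm (g x) ^ 2) integrable_on \<Omega>"
    using s by (auto simp: sobolev_def)
  have w2: "weak_gradient \<Omega> (\<lambda>x. \<eta> x * v x) (\<lambda>x. \<eta> x *\<^sub>R g x + v x *\<^sub>R G x)"
    by (rule weak_gradient_mult[OF w vc \<eta>(1)])
  let ?r = "\<lambda>y. if y \<in> T then (v y)^2 else 0"
  have ri: "?r integrable_on \<Omega>"
  proof -
    have "(\<lambda>y. if y \<in> \<Omega> then ?r y else 0) = ?r" using T(2) by (intro ext) auto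
    moreover have "?r integrable_on UNIV"
      unfolding integrable_restrict_UNIV by (rule sobolev_sq_integrable[OF s T(1,2)])
    ultimately have "(\<lambda>y. if y \<in> \<Omega> then ?r y else 0) integrable_on UNIV" by (simp only:)
    then show ?thesis unfolding integrable_restrict_UNIV .
  qed
  have re: "integral \<Omega> ?r = integral T (\<lambda>x. (v x)^2)"
    using integral_support[OF T(2), of ?r] by (simp cong: integral_cong)
  have Fi: "(\<lambda>x. 2 * norm (g x) ^ 2 + 2 * L^2 * ?r x) integrable_on \<Omega>"
    using gi ri by (intro integrable_add integrable_on_mult_right)
  have le: "norm (\<eta> x *\<^sub>R g x + v x *\<^sub>R G x) ^ 2 \<le> 2 * norm (g x) ^ 2 + 2 * L^2 * ?r x" for x
  proof -
    have "norm (\<eta> x *\<^sub>R g x + v x *\<^sub>R G x) ^ 2 \<le> 2 * norm (\<eta> x *\<^sub>R g x) ^ 2 + 2 * norm (v x *\<^sub>R G x) ^ 2"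
      using norm_add_sq_le[of 1 "\<eta> x *\<^sub>R g x" "v x *\<^sub>R G x"] by simp
    moreover have "norm (\<eta> x *\<^sub>R g x) ^ 2 \<le> norm (g x) ^ 2"
      using \<eta>(2,3)[of x] by (intro power_mono) (auto intro: mult_left_le_one_le)
    moreover have "norm (v x *\<^sub>R G x) ^ 2 \<le> L^2 * ?r x"
    proof (cases "x \<in> T")
      case True
      have "norm (v x *\<^sub>R G x) ^ 2 = norm (G x) ^ 2 * (v x)^2" by (simp add: power_mult_distrib)
      also have "\<dots> \<le> L^2 * (v x)^2" by (intro mult_right_mono power_mono L) auto
      finally show ?thesis using True by simp
    qed (use T(3) in auto)
    ultimately show ?thesis unfolding mult.assoc by linarith
  qed
  have i: "(\<lambda>x. norm (\<eta> x *\<^sub>R g x + v x *\<^sub>R G x) ^ 2) integrable_on \<Omega>"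
    by (rule sq_integrable_bounded_by[OF weak_gradient_measurable[OF w2 \<Omega>] \<Omega> Fi le])
  show "sobolev \<Omega> (\<lambda>x. \<eta> x * v x) (\<lambda>x. \<eta> x *\<^sub>R g x + v x *\<^sub>R G x)"
    unfolding sobolev_def using w2 i vc c1_continuous[OF \<eta>(1)] by (auto intro!: continuous_on_mult)
  have "energy \<Omega> (\<lambda>x. \<eta> x *\<^sub>R g x + v x *\<^sub>R G x) \<le> integral \<Omega> (\<lambda>x. 2 * norm (g x) ^ 2 + 2 * L^2 * ?r x)"
    unfolding energy_def by (rule integral_le[OF i Fi le])
  also have "\<dots> = 2 * energy \<Omega> g + 2 * L^2 * integral \<Omega> ?r"
    unfolding energy_def using gi ri
    by (subst integral_add) (auto intro!: integrable_on_mult_right simp del: if_distrib)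
  finally show "energy \<Omega> (\<lambda>x. \<eta> x *\<^sub>R g x + v x *\<^sub>R G x) \<le> 2 * energy \<Omega> g + 2 * L^2 * integral T (\<lambda>x. (v x)^2)"
    unfolding re .
qed

lemma admissible_zero: "admissible_cap F A \<Omega> v g \<Longrightarrow> x \<in> F \<Longrightarrow> x \<in> \<Omega> \<Longrightarrow> v x = 0"
  unfolding admissible_cap_def by blast

lemma admissible_one: "admissible_cap F A \<Omega> v g \<Longrightarrow> x \<in> A \<Longrightarrow> x \<in> \<Omega> \<Longrightarrow> 1 \<le> v x"
  unfolding admissible_cap_def by blast

text \<open>The factor \<open>1 - \<eta>\<close> vanishes near F1 and equals 1 off T, a subset of
  V1, so v is changed only away from A. Since v vanishes on F2, the new term with v^2 on T is
  absorbed by the energy.\<close>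

lemma cap_change_continuum:
  assumes D1: "cap_domain \<Omega> F1 V1" and D2: "cap_domain \<Omega> F2 V2"
  obtains C where "C > 0" "\<And>A. A \<inter> V1 = {} \<Longrightarrow> A \<inter> V2 = {} \<Longrightarrow> cap F1 A \<Omega> \<le> C * cap F2 A \<Omega>"
proof -
  interpret D1: cap_domain \<Omega> F1 V1 by (rule D1)
  interpret D2: cap_domain \<Omega> F2 V2 by (rule D2)
  obtain \<eta> G T U where c: "c1 \<eta> G" "\<And>x. 0 \<le> \<eta> x" "\<And>x. \<eta> x \<le> 1" "open U" "F1 \<subseteq> U"
    "\<And>x. x \<in> U \<Longrightarrow> \<eta> x = 1" "compact T" "T \<subseteq> V1" "\<And>x. x \<notin> T \<Longrightarrow> \<eta> x = 0"
    using cutoff_exists[OF D1.F_compact D1.V_open D1.F_sub] by metis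
  have T\<Omega>: "T \<subseteq> \<Omega>" using c(8) D1.V_sub by auto
  have G0: "G x = 0" if "x \<notin> T" for x
    using c1_grad_support[OF c(1) compact_imp_closed[OF c(7)] c(9) that] .
  have "bounded (G ` T)" using c1_continuous_grad[OF c(1)] c(7) compact_continuous_image compact_imp_bounded by blast
  then obtain L where L: "\<And>x. x \<in> T \<Longrightarrow> norm (G x) \<le> L" "L > 0" by (auto simp: bounded_pos)
  have GL: "norm (0 - G x) \<le> L" for x using L G0 by (cases "x \<in> T") auto
  obtain f1 f2 where f: "f1 \<in> F2" "f2 \<in> F2" "f1 \<noteq> f2" using D2.F_two by blast
  obtain P where P: "P \<ge> 0" "\<And>v g. sobolev \<Omega> v g \<Longrightarrow> (\<And>x. x \<in> F2 \<Longrightarrow> v x = 0) \<Longrightarrow> integral T (\<lambda>x. (v x)^2) \<le> P * energy \<Omega> g"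
    using poincare[OF D1.open_dom D1.connected_dom D2.F_connected D2.F_dom f c(7) T\<Omega>] by metis
  define C where "C = 2 + 2 * L^2 * P"
  have C: "C > 0" using P(1) unfolding C_def by (simp add: add_pos_nonneg)
  have "cap F1 A \<Omega> \<le> C * cap F2 A \<Omega>" if A: "A \<inter> V1 = {}" "A \<inter> V2 = {}" for A
  proof -
    have "cap F1 A \<Omega> / C \<le> cap F2 A \<Omega>"
    proof (rule cap_greatest[OF D2.admissible_disjoint_exists[OF A(2)]])
      fix v g assume adm: "admissible_cap F2 A \<Omega> v g"
      have s: "sobolev \<Omega> v g" by (rule admissible_imp_sobolev[OF adm])
      have v0: "v x = 0" if "x \<in> F2" for x using admissible_zero[OF adm that] D2.F_dom that by auto
      have c': "c1 (\<lambda>x. 1 - \<eta> x) (\<lambda>x. 0 - G x)" by (intro c1_diff c1_const c)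
      note e = energy_cutoff[OF D1.open_dom s c' _ _ c(7) T\<Omega> _ GL]
      let ?w = "\<lambda>x. (1 - \<eta> x) * v x" and ?h = "\<lambda>x. (1 - \<eta> x) *\<^sub>R g x + v x *\<^sub>R (0 - G x)"
      have sw: "sobolev \<Omega> ?w ?h" using e(1) c(2,3) G0 by simp
      have "energy \<Omega> ?h \<le> 2 * energy \<Omega> g + 2 * L^2 * integral T (\<lambda>x. (v x)^2)" using e(2) c(2,3) G0 by simp
      also have "\<dots> \<le> 2 * energy \<Omega> g + 2 * L^2 * (P * energy \<Omega> g)"
        using P(2)[OF s v0] by (intro add_left_mono mult_left_mono) auto
      also have "\<dots> = C * energy \<Omega> g" by (simp add: C_def algebra_simps)
      finally have eh: "energy \<Omega> ?h \<le> C * energy \<Omega> g" .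
      obtain W where W: "open W" "A \<subseteq> W" "\<forall>x\<in>W \<inter> \<Omega>. 1 \<le> v x" using adm unfolding admissible_cap_def by blast
      have vn: "\<And>x. x \<in> \<Omega> \<Longrightarrow> 0 \<le> v x" using adm unfolding admissible_cap_def by blast
      have "admissible_cap F1 A \<Omega> ?w ?h"
      proof (rule admissibleI[OF sw _ c(4,5)])
        \<comment> \<open>Removing T keeps a neighbourhood of A, since T lies in V1 and A avoids V1;
          on what remains the factor is 1.\<close>
        show "open (W - T)" using W(1) c(7) by (auto intro: compact_imp_closed)
        show "A \<subseteq> W - T" using W(2) A(1) c(8) by auto
        show "1 \<le> ?w x" if "x \<in> W - T" "x \<in> \<Omega>" for x using that W(3) c(9) by auto
      qed (use vn c(3,6) in auto)
      then have "cap F1 A \<Omega> \<le> C * energy \<Omega> g" using cap_le_energy eh order_trans by blast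
      then show "cap F1 A \<Omega> / C \<le> energy \<Omega> g" using C by (simp add: divide_le_eq mult.commute)
    qed
    then show ?thesis using C by (simp add: divide_le_eq mult.commute)
  qed
  then show ?thesis using that C by blast
qed

section \<open>Lower bounds for crossing sets and the comparison of costs\<close>

text \<open>If v is at least 1 at z, then 1/2 - v(p)^2 is at most (v(p) - v(z))^2. Integrated in p,
  the constant 1/2 contributes \<open>8 * r^2\<close>; the integral of v^2 is bounded by the energy
  through the Poincare inequality and the right side through \<open>crossing_integral\<close>. Hence
  the energy cannot be small.\<close>

lemma crossing_capacity:
  assumes D: "cap_domain \<Omega> F V" and r: "r > 0" "square q (4*r) \<subseteq> \<Omega>"
  obtains c where "c > 0" "\<And>A. A \<inter> V = {} \<Longrightarrow> (\<And>s. s \<in> {r..2*r} \<Longrightarrow> \<exists>z\<in>A. infnorm (z - q) = s) \<Longrightarrow> c \<le> cap F A \<Omega>"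
proof -
  interpret D: cap_domain \<Omega> F V by (rule D)
  have sub: "square q (2*r) \<subseteq> \<Omega>" using r square_mono[of q q "2*r" "4*r"] by (auto simp: infnorm_0)
  obtain f1 f2 where f: "f1 \<in> F" "f2 \<in> F" "f1 \<noteq> f2" using D.F_two by blast
  obtain P where P: "P \<ge> 0" "\<And>v g. sobolev \<Omega> v g \<Longrightarrow> (\<And>x. x \<in> F \<Longrightarrow> v x = 0) \<Longrightarrow>
      integral (square q (2*r)) (\<lambda>x. (v x)^2) \<le> P * energy \<Omega> g"
    using poincare[OF D.open_dom D.connected_dom D.F_connected D.F_dom f square_compact sub] by metis
  define C where "C = 589824 * r^2 + P"
  have C: "C > 0" using r P(1) unfolding C_def by (simp add: add_pos_nonneg)
  show ?thesis
  proof (rule that[of "8 * r^2 / C"])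
    show "8 * r^2 / C > 0" using r C by simp
    fix A assume A: "A \<inter> V = {}" "\<And>s. s \<in> {r..2*r} \<Longrightarrow> \<exists>z\<in>A. infnorm (z - q) = s"
    show "8 * r^2 / C \<le> cap F A \<Omega>"
    proof (rule cap_greatest[OF D.admissible_disjoint_exists[OF A(1)]])
      fix v g assume adm: "admissible_cap F A \<Omega> v g"
      have s: "sobolev \<Omega> v g" by (rule admissible_imp_sobolev[OF adm])
      have v0: "v x = 0" if "x \<in> F" for x using admissible_zero[OF adm that] D.F_dom that by auto
      let ?Q = "square q (2*r)"
      have vi: "(\<lambda>x. (v x)^2) integrable_on ?Q" by (rule sobolev_sq_integrable[OF s square_compact sub])
      have ci: "(\<lambda>x. 1/2::real) integrable_on ?Q" unfolding square_def by (rule integrable_const)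
      have "integral ?Q (\<lambda>x. 1/2 - (v x)^2) \<le> 589824 * r^2 * energy \<Omega> g"
      proof (rule crossing_integral[OF r s])
        show "(\<lambda>x. 1/2 - (v x)^2) integrable_on ?Q" by (intro integrable_diff ci vi)
        fix p t assume t: "t \<in> {r..2*r}"
        obtain z where z: "z \<in> A" "infnorm (z - q) = t" using A(2)[OF t] by blast
        have "z \<in> \<Omega>" using z(2) t sub by (auto simp: square_infnorm subset_iff)
        then have "1 \<le> v z" using admissible_one[OF adm z(1)] by simp
        then have "1 \<le> (v z)^2" by (simp add: one_le_power)
        also have "\<dots> = (v p + (v z - v p))^2" by simp
        also have "\<dots> \<le> 2 * (v p)^2 + 2 * (v z - v p)^2" by (rule square_add_le)
        finally have "1/2 - (v p)^2 \<le> (v p - v z)^2" by (simp add: power2_commute)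
        then show "\<exists>z. infnorm (z - q) = t \<and> 1/2 - (v p)^2 \<le> (v p - v z)^2" using z(2) by blast
      qed
      moreover have "integral ?Q (\<lambda>x. 1/2 - (v x)^2) = 8 * r^2 - integral ?Q (\<lambda>x. (v x)^2)"
      proof -
        have "integral ?Q (\<lambda>x. 1/2 :: real) = 8 * r^2"
          using content_square[of "2*r" q] r by (simp add: square_def power_mult_distrib)
        then show ?thesis using integral_diff[OF ci vi] by simp
      qed
      ultimately have "8 * r^2 \<le> C * energy \<Omega> g" using P(2)[OF s v0] unfolding C_def distrib_right by linarith
      then show "8 * r^2 / C \<le> energy \<Omega> g" using C by (simp add: divide_le_eq mult.commute)
    qed
  qed
qed

text \<open>The compact set off which a cutoff vanishes contains the open set on which the cutoff is
  1.\<close>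

lemma compact_neighbourhood_exists:
  fixes C :: "R2 set"
  assumes "compact C" "open \<Omega>" "C \<subseteq> \<Omega>"
  obtains K where "compact K" "C \<subseteq> interior K" "K \<subseteq> \<Omega>"
proof -
  obtain \<eta> G T U where c: "open U" "C \<subseteq> U" "\<And>x. x \<in> U \<Longrightarrow> \<eta> x = (1::real)" "compact T" "T \<subseteq> \<Omega>" "\<And>x. x \<notin> T \<Longrightarrow> \<eta> x = 0"
    using cutoff_exists[OF assms] by metis
  have "U \<subseteq> T" using c(3,6) by force
  then have "U \<subseteq> interior T" using c(1) by (rule interior_maximal)
  then show ?thesis using that c by blast
qed

text \<open>K has a buffer: besides a neighbourhood K1 of both closures it contains squares centred
  at finitely many points q of the boundary of K1. A connected set that has a point off K and meets
  V1 or V2 comes within \<open>r q\<close> of some q and also leaves the square of half side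
  \<open>2 * r q\<close>, so it crosses every square boundary in between. These squares avoid V1 and
  V2, and finitely many of them share one lower bound.\<close>

lemma cost_comparison:
  assumes D1: "cap_domain \<Omega> F1 V1" and D2: "cap_domain \<Omega> F2 V2"
  obtains K M where "compact K" "K \<subseteq> \<Omega>" "M > 0"
    "\<And>A x. connected A \<Longrightarrow> A \<subseteq> \<Omega> \<Longrightarrow> x \<in> A \<Longrightarrow> x \<notin> K \<Longrightarrow> curve_cost \<Omega> F1 V1 A \<le> M * curve_cost \<Omega> F2 V2 A"
proof -
  interpret D1: cap_domain \<Omega> F1 V1 by (rule D1)
  interpret D2: cap_domain \<Omega> F2 V2 by (rule D2)
  define C0 where "C0 = closure V1 \<union> closure V2"
  have C0: "compact C0" "C0 \<subseteq> \<Omega>" "V1 \<subseteq> C0" "V2 \<subseteq> C0"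
    using D1.V_cl D2.V_cl closure_subset by (auto simp: C0_def)
  obtain K1 where K1: "compact K1" "C0 \<subseteq> interior K1" "K1 \<subseteq> \<Omega>"
    using compact_neighbourhood_exists[OF C0(1) D1.open_dom C0(2)] by metis
  have fr: "compact (frontier K1)" "frontier K1 \<subseteq> \<Omega> - C0"
    using K1 compact_frontier[OF K1(1)] by (auto simp: frontier_def compact_imp_closed closure_closed)
  have opn: "open (\<Omega> - C0)" using D1.open_dom C0(1) by (auto intro: compact_imp_closed)
  define cross where "cross q r c \<longleftrightarrow> r > 0 \<and> square q (4*r) \<subseteq> \<Omega> - C0 \<and> c > 0 \<and>
     (\<forall>A. A \<inter> V2 = {} \<longrightarrow> (\<forall>s\<in>{r..2*r}. \<exists>z\<in>A. infnorm (z - q) = s) \<longrightarrow> c \<le> cap F2 A \<Omega>)" for q r c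
  have "\<forall>q\<in>frontier K1. \<exists>r c. cross q r c"
  proof
    fix q assume "q \<in> frontier K1"
    then obtain R where R: "R > 0" "square q R \<subseteq> \<Omega> - C0" using square_subset_open[OF opn, of q] fr(2) by blast
    define r where "r = R/4"
    have r: "r > 0" "square q (4*r) \<subseteq> \<Omega> - C0" using R by (auto simp: r_def)
    have "square q (4*r) \<subseteq> \<Omega>" using r(2) by auto
    then obtain c where c: "c > 0" "\<And>A. A \<inter> V2 = {} \<Longrightarrow> (\<And>s. s \<in> {r..2*r} \<Longrightarrow> \<exists>z\<in>A. infnorm (z - q) = s) \<Longrightarrow> c \<le> cap F2 A \<Omega>"
      using crossing_capacity[OF D2 r(1)] by metis
    have "cross q r c" unfolding cross_def
      by (intro conjI allI impI r c) auto
    then show "\<exists>r c. cross q r c" by blast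
  qed
  then obtain r c where cr: "\<And>q. q \<in> frontier K1 \<Longrightarrow> cross q (r q) (c q)" by metis
  have rc: "\<And>q. q \<in> frontier K1 \<Longrightarrow> r q > 0" "\<And>q. q \<in> frontier K1 \<Longrightarrow> square q (4 * r q) \<subseteq> \<Omega> - C0"
    "\<And>q. q \<in> frontier K1 \<Longrightarrow> c q > 0"
    "\<And>q A. q \<in> frontier K1 \<Longrightarrow> A \<inter> V2 = {} \<Longrightarrow> \<forall>s\<in>{r q..2 * r q}. \<exists>z\<in>A. infnorm (z - q) = s \<Longrightarrow> c q \<le> cap F2 A \<Omega>"
    using cr unfolding cross_def by simp_all
  have "frontier K1 \<subseteq> (\<Union>q\<in>frontier K1. ball q (r q))" using rc(1) by force
  then obtain D where D: "D \<subseteq> frontier K1" "finite D" "frontier K1 \<subseteq> (\<Union>q\<in>D. ball q (r q))"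
    using compactE_image[OF fr(1), of "frontier K1" "\<lambda>q. ball q (r q)"] by blast
  define K where "K = K1 \<union> (\<Union>q\<in>D. square q (2 * r q))"
  have sub2: "square q (2 * r q) \<subseteq> \<Omega> - C0" if "q \<in> frontier K1" for q
    using rc(1,2)[OF that] square_mono[of q q "2 * r q" "4 * r q"] by (auto simp: infnorm_0)
  have K: "compact K" "K \<subseteq> \<Omega>"
    unfolding K_def using K1 D sub2 by (auto intro!: compact_Un compact_UN square_compact; blast)+
  \<comment> \<open>Inserting 1 keeps the minimum defined when D is empty and preserves
    positivity.\<close>
  define c0 where "c0 = Min (insert 1 (c ` D))"
  have c0: "c0 > 0" "\<And>q. q \<in> D \<Longrightarrow> c0 \<le> c q"
    unfolding c0_def using D rc(3) by (auto simp: subset_iff)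
  obtain B where B: "B > 0" "\<And>A. curve_cost \<Omega> F1 V1 A \<le> B" using D1.cost_bounded by metis
  obtain C where C: "C > 0" "\<And>A. A \<inter> V1 = {} \<Longrightarrow> A \<inter> V2 = {} \<Longrightarrow> cap F1 A \<Omega> \<le> C * cap F2 A \<Omega>"
    using cap_change_continuum[OF D1 D2] by metis
  \<comment> \<open>The first summand serves sets that avoid V1 and V2, whose costs are pure
    capacities; the second serves crossing sets, as upper bound of one cost over lower bound of the
    other.\<close>
  define M where "M = sqrt C + B / sqrt c0"
  have M: "M > 0" using C B c0 by (simp add: M_def add_pos_pos)
  have "curve_cost \<Omega> F1 V1 A \<le> M * curve_cost \<Omega> F2 V2 A" if A: "connected A" "A \<subseteq> \<Omega>" "x \<in> A" "x \<notin> K" for A x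
  proof (cases "A \<inter> (V1 \<union> V2) = {}")
    case True
    then have e: "A \<inter> V1 = {}" "A \<inter> V2 = {}" "A - V1 = A" "A - V2 = A" by auto
    have "curve_cost \<Omega> F1 V1 A = sqrt (cap F1 A \<Omega>)" by (simp add: curve_cost_def e cap_empty)
    also have "\<dots> \<le> sqrt (C * cap F2 A \<Omega>)" using C(2)[OF e(1,2)] by simp
    also have "\<dots> = sqrt C * curve_cost \<Omega> F2 V2 A" by (simp add: curve_cost_def e cap_empty real_sqrt_mult)
    also have "\<dots> \<le> M * curve_cost \<Omega> F2 V2 A"
      using B c0 by (intro mult_right_mono D2.cost_nonneg) (simp add: M_def)
    finally show ?thesis .
  next
    case False
    then obtain p where p: "p \<in> A" "p \<in> C0" using C0 by auto
    have "A \<inter> K1 \<noteq> {}" using p K1(2) interior_subset by blast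
    moreover have "A - K1 \<noteq> {}" using A(3,4) by (auto simp: K_def)
    ultimately have "A \<inter> frontier K1 \<noteq> {}" by (rule connected_Int_frontier[OF A(1)])
    then obtain y where y: "y \<in> A" "y \<in> frontier K1" by blast
    then obtain q where q: "q \<in> D" "y \<in> ball q (r q)" using D(3) by blast
    have qf: "q \<in> frontier K1" using q D by auto
    have yq: "infnorm (y - q) \<le> r q" using q(2) cball_subset_square[of q "r q"] by (auto simp: square_infnorm subset_iff)
    have xq: "2 * r q \<le> infnorm (x - q)" using A(4) q(1) by (auto simp: K_def square_infnorm not_le)
    have "c q \<le> cap F2 (A - V2) \<Omega>"
    proof (rule rc(4)[OF qf])
      show "\<forall>s\<in>{r q..2 * r q}. \<exists>z\<in>A - V2. infnorm (z - q) = s"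
      proof
        fix s assume s: "s \<in> {r q..2 * r q}"
        obtain z where z: "z \<in> A" "infnorm (z - q) = s"
          using connected_crosses_sphere[OF A(1) y(1) _ A(3), of q s] yq xq s by auto
        have "z \<in> square q (2 * r q)" using z(2) s by (simp add: square_infnorm)
        then have "z \<notin> V2" using sub2[OF qf] C0(4) by auto
        then show "\<exists>z\<in>A - V2. infnorm (z - q) = s" using z by blast
      qed
    qed auto
    then have "sqrt c0 \<le> sqrt (cap F2 (A - V2) \<Omega>)" using c0(2)[OF q(1)] by simp
    also have "\<dots> \<le> curve_cost \<Omega> F2 V2 A" unfolding curve_cost_def using cap_nonneg[OF D2.admissible_Int_exists] by simp
    finally have low: "sqrt c0 \<le> curve_cost \<Omega> F2 V2 A" .
    have "curve_cost \<Omega> F1 V1 A \<le> B" by (rule B(2))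
    also have "\<dots> = B / sqrt c0 * sqrt c0" using c0(1) by simp
    also have "\<dots> \<le> B / sqrt c0 * curve_cost \<Omega> F2 V2 A"
      using low B c0 by (intro mult_left_mono) auto
    also have "\<dots> \<le> M * curve_cost \<Omega> F2 V2 A"
      using C(1) by (intro mult_right_mono D2.cost_nonneg) (simp add: M_def)
    finally show ?thesis .
  qed
  then show ?thesis using that K M by blast
qed

text \<open>Costs are compared curve by curve with one constant, so the infima compare. It is enough
  that x is off K, because the comparison of costs asks for a single point of the image off
  K.\<close>

lemma metric_comparison:
  assumes D1: "cap_domain \<Omega> F1 V1" and D2: "cap_domain \<Omega> F2 V2"
  obtains K M where "compact K" "K \<subseteq> \<Omega>" "M > 0"
    "\<And>x y. x \<in> \<Omega> \<Longrightarrow> y \<in> \<Omega> \<Longrightarrow> x \<notin> K \<Longrightarrow> cap_metric \<Omega> F1 V1 x y \<le> M * cap_metric \<Omega> F2 V2 x y"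
proof -
  interpret D1: cap_domain \<Omega> F1 V1 by (rule D1)
  interpret D2: cap_domain \<Omega> F2 V2 by (rule D2)
  obtain K M where KM: "compact K" "K \<subseteq> \<Omega>" "M > 0"
    "\<And>A x. connected A \<Longrightarrow> A \<subseteq> \<Omega> \<Longrightarrow> x \<in> A \<Longrightarrow> x \<notin> K \<Longrightarrow> curve_cost \<Omega> F1 V1 A \<le> M * curve_cost \<Omega> F2 V2 A"
    using cost_comparison[OF D1 D2] by metis
  have "D1.\<rho> x y \<le> M * D2.\<rho> x y" if xy: "x \<in> \<Omega>" "y \<in> \<Omega>" "x \<notin> K" for x y
  proof -
    have "D1.\<rho> x y / M \<le> D2.\<rho> x y"
    proof (rule D2.metric_greatest[OF xy(1,2)])
      fix l assume l: "l \<in> curves_joining \<Omega> x y"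
      have "D1.\<rho> x y \<le> curve_cost \<Omega> F1 V1 (path_image l)" by (rule D1.metric_le[OF l])
      also have "\<dots> \<le> M * curve_cost \<Omega> F2 V2 (path_image l)"
        by (rule KM(4)[of _ x]) (use l xy(3) in \<open>auto simp: curves_joining_def rectifiable_path_def connected_path_image\<close>)
      finally show "D1.\<rho> x y / M \<le> curve_cost \<Omega> F2 V2 (path_image l)"
        using KM(3) by (simp add: divide_le_eq mult.commute)
    qed
    then show ?thesis using KM(3) by (simp add: divide_le_eq mult.commute)
  qed
  then show ?thesis using that KM by blast
qed

text \<open>Boundary points are represented by sequences that are Cauchy for the first metric. Since
  \<open>lim\<close> is meaningful only for convergent sequences, convergence of both distance
  sequences is part of the conclusion.\<close>

theorem theorem2p8:
  fixes \<Omega> F1 V1 F2 V2 :: "R2 set"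
  assumes "open \<Omega>" and "connected \<Omega>" and "\<Omega> \<noteq> {}"
    and "cap_pair \<Omega> F1 V1" and "cap_pair \<Omega> F2 V2"
  shows "\<exists>K>0. \<forall>x y. boundary_seq \<Omega> (cap_metric \<Omega> F1 V1) x \<and>
                      boundary_seq \<Omega> (cap_metric \<Omega> F1 V1) y \<longrightarrow>
           convergent (\<lambda>n. cap_metric \<Omega> F1 V1 (x n) (y n)) \<and>
           convergent (\<lambda>n. cap_metric \<Omega> F2 V2 (x n) (y n)) \<and>
           lim (\<lambda>n. cap_metric \<Omega> F2 V2 (x n) (y n)) / K
              \<le> lim (\<lambda>n. cap_metric \<Omega> F1 V1 (x n) (y n)) \<and>
           lim (\<lambda>n. cap_metric \<Omega> F1 V1 (x n) (y n))
              \<le> K * lim (\<lambda>n. cap_metric \<Omega> F2 V2 (x n) (y n))"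
proof -
  have D1: "cap_domain \<Omega> F1 V1" and D2: "cap_domain \<Omega> F2 V2"
    using assms by (simp_all add: cap_domain_def)
  interpret D1: cap_domain \<Omega> F1 V1 by (rule D1)
  interpret D2: cap_domain \<Omega> F2 V2 by (rule D2)
  obtain K M where KM: "compact K" "K \<subseteq> \<Omega>" "M > 0"
    "\<And>x y. x \<in> \<Omega> \<Longrightarrow> y \<in> \<Omega> \<Longrightarrow> x \<notin> K \<Longrightarrow> D1.\<rho> x y \<le> M * D2.\<rho> x y"
    using metric_comparison[OF D1 D2] by metis
  obtain K' M' where KM': "compact K'" "K' \<subseteq> \<Omega>" "M' > 0"
    "\<And>x y. x \<in> \<Omega> \<Longrightarrow> y \<in> \<Omega> \<Longrightarrow> x \<notin> K' \<Longrightarrow> D2.\<rho> x y \<le> M' * D1.\<rho> x y"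
    using metric_comparison[OF D2 D1] by metis
  \<comment> \<open>One constant for both directions; nonnegativity of the metrics permits enlarging
    M and M' to it.\<close>
  define N where "N = max M M'"
  have N: "N > 0" "M \<le> N" "M' \<le> N" using KM(3) by (auto simp: N_def)
  have d1: "D1.\<rho> x y \<le> N * D2.\<rho> x y" if "x \<in> \<Omega>" "y \<in> \<Omega>" "x \<notin> K" for x y
    using KM(4)[OF that] mult_right_mono[OF N(2) D2.metric_nonneg[OF that(1,2)]] by linarith
  have d2: "D2.\<rho> x y \<le> N * D1.\<rho> x y" if "x \<in> \<Omega>" "y \<in> \<Omega>" "x \<notin> K'" for x y
    using KM'(4)[OF that] mult_right_mono[OF N(3) D1.metric_nonneg[OF that(1,2)]] by linarith
  \<comment> \<open>Late terms of a boundary sequence lie off K', where the second metric is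
    dominated by the first, so the Cauchy property passes to the second metric.\<close>
  have cauchy2: "\<exists>n0. \<forall>m\<ge>n0. \<forall>n\<ge>n0. D2.\<rho> (s m) (s n) < e" if s: "boundary_seq \<Omega> D1.\<rho> s" and e: "e > 0" for s e
  proof -
    obtain n1 where n1: "\<And>n. n \<ge> n1 \<Longrightarrow> s n \<notin> K'"
      using D1.boundary_seq_leaves_compact[OF s KM'(1,2)] by (auto simp: eventually_sequentially)
    have "e / N > 0" using e N by simp
    then obtain n2 where n2: "\<forall>m\<ge>n2. \<forall>n\<ge>n2. D1.\<rho> (s m) (s n) < e / N"
      using s unfolding boundary_seq_def by blast
    have "D2.\<rho> (s m) (s n) < e" if mn: "m \<ge> max n1 n2" "n \<ge> max n1 n2" for m n
    proof -
      have "D2.\<rho> (s m) (s n) \<le> N * D1.\<rho> (s m) (s n)"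
        using s n1 mn by (intro d2) (auto simp: boundary_seq_def)
      also have "\<dots> < N * (e / N)" using n2 mn N by (intro mult_strict_left_mono) auto
      finally show ?thesis using N by simp
    qed
    then show ?thesis by blast
  qed
  show ?thesis
  proof (intro exI[of _ N] conjI[OF N(1)] allI impI, elim conjE)
    fix x y assume x: "boundary_seq \<Omega> D1.\<rho> x" and y: "boundary_seq \<Omega> D1.\<rho> y"
    have x\<Omega>: "\<And>n. x n \<in> \<Omega>" and y\<Omega>: "\<And>n. y n \<in> \<Omega>" using x y by (auto simp: boundary_seq_def)
    have c1: "convergent (\<lambda>n. D1.\<rho> (x n) (y n))"
      by (rule metric_pair_cauchy[of \<Omega>, OF D1.metric_triangle x\<Omega> _ y\<Omega>]) (use x y in \<open>auto simp: boundary_seq_def\<close>)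
    have c2: "convergent (\<lambda>n. D2.\<rho> (x n) (y n))"
      by (rule metric_pair_cauchy[of \<Omega>, OF D2.metric_triangle x\<Omega> cauchy2[OF x] y\<Omega> cauchy2[OF y]])
    have l1: "(\<lambda>n. D1.\<rho> (x n) (y n)) \<longlonglongrightarrow> lim (\<lambda>n. D1.\<rho> (x n) (y n))"
      and l2: "(\<lambda>n. D2.\<rho> (x n) (y n)) \<longlonglongrightarrow> lim (\<lambda>n. D2.\<rho> (x n) (y n))"
      using c1 c2 by (auto simp: convergent_LIMSEQ_iff)
    \<comment> \<open>Here x n is eventually off K, while y n may be any point of \<Omega>.\<close>
    have e1: "\<forall>\<^sub>F n in sequentially. D1.\<rho> (x n) (y n) \<le> N * D2.\<rho> (x n) (y n)"
      using D1.boundary_seq_leaves_compact[OF x KM(1,2)] by eventually_elim (rule d1[OF x\<Omega> y\<Omega>])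
    have e2: "\<forall>\<^sub>F n in sequentially. D2.\<rho> (x n) (y n) \<le> N * D1.\<rho> (x n) (y n)"
      using D1.boundary_seq_leaves_compact[OF x KM'(1,2)] by eventually_elim (rule d2[OF x\<Omega> y\<Omega>])
    have "lim (\<lambda>n. D1.\<rho> (x n) (y n)) \<le> N * lim (\<lambda>n. D2.\<rho> (x n) (y n))"
      by (rule tendsto_le[OF _ tendsto_mult_left[OF l2] l1 e1]) simp
    moreover have "lim (\<lambda>n. D2.\<rho> (x n) (y n)) \<le> N * lim (\<lambda>n. D1.\<rho> (x n) (y n))"
      by (rule tendsto_le[OF _ tendsto_mult_left[OF l1] l2 e2]) simp
    ultimately show "convergent (\<lambda>n. D1.\<rho> (x n) (y n)) \<and> convergent (\<lambda>n. D2.\<rho> (x n) (y n)) \<and>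
        lim (\<lambda>n. D2.\<rho> (x n) (y n)) / N \<le> lim (\<lambda>n. D1.\<rho> (x n) (y n)) \<and>
        lim (\<lambda>n. D1.\<rho> (x n) (y n)) \<le> N * lim (\<lambda>n. D2.\<rho> (x n) (y n))"
      using c1 c2 N by (simp add: divide_le_eq mult.commute)
  qed
qed

end
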